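(* Let $W>0$, $\alpha>0$, and let $(H_\tau)_{\tau\in\mathbb{R}}$ be the continuous-time Rayleigh fading channel with stationary covariance function $\tilde R$ and decay function $g$ (defined in the context), so that its real and imaginary parts each have covariance function $R(\tau,\tau')=\tilde R(\tau-\tau')g(\tau)g(\tau')$. Let $\hat H_f=\int_{-\infty}^{\infty}e^{-j2\pi f\tau}H_\tau\,d\tau$, $f\in\mathbb{R}$, be its Fourier transform. Then the ergodic capacity $$C=E\left[\int_{-W/2}^{W/2}\log_2\bigl(1+\alpha|\hat H_f|^2\bigr)\,df\right]$$ is given by $$C=\frac{1}{\ln 2}\int_{-W/2}^{W/2}\exp\left(\frac{1}{2\alpha\hat\sigma^2(f)}\right)\mathrm{Ei}_1\left(\frac{1}{2\alpha\hat\sigma^2(f)}\right)df,$$ where $$\hat\sigma^2(f)=\int_0^\infty\int_0^\infty R(\tau,\tau')\cos\bigl(2\pi(\tau-\tau')f\bigr)\,d\tau\,d\tau',\qquad f\in\mathbb{R}.$$ If $\tilde R$ satisfies $\tilde R(\tilde\tau)=\tilde c\,\delta(\tilde\tau)$ for some $\tilde c>0$, with $\delta$ the Dirac delta distribution (uncorrelated scattering), one obtains $$C=\frac{W}{\ln 2}\exp\left(\frac{1}{c\alpha}\right)\mathrm{Ei}_1\left(\frac{1}{c\alpha}\right),$$ where $c=2\tilde c\int_{-\infty}^{\infty}g^2(\tau)\,d\tau$ is the only parameter of the channel impulse response $(H_\tau)$ that has an influence on the capacity. (This last expression for $C$ in the uncorrelated case is well known.)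
   Context: Continuous-time Rayleigh fading channel: $(\tilde X_\tau)_{\tau\in\mathbb{R}}$ and $(\tilde Y_\tau)_{\tau\in\mathbb{R}}$ are independent and identically distributed real (wide-sense) stationary Gaussian processes with zero mean and continuous covariance function $\tilde R$, i.e. $E[\tilde X_\tau\tilde X_{\tau'}]=\tilde R(\tau-\tau')$. The function $g$ has the form $g(\tau)=u(\tau)\mathbf 1_{[0,\infty)}(\tau)$, $\tau\in\mathbb{R}$, where $u$ is a suitable real function modeling power decay and $\mathbf 1_{[0,\infty)}$ is the indicator function of $[0,\infty)$; $g$ is Riemann integrable in the sense that $\int_{-\infty}^{\infty}g(\tau)\,d\tau$ exists as an improper Riemann integral. The mean energy $2\int_{-\infty}^{\infty}R(\tau,\tau)\,d\tau$ of $(H_\tau)$ is finite if $g^2$ is likewise Riemann integrable, which is regarded as a reasonable assumption. Put $X_\tau=\tilde X_\tau g(\tau)$, $Y_\tau=\tilde Y_\tau g(\tau)$ and $H_\tau=X_\tau+jY_\tau$, where $j$ is the imaginary unit. The integrals of random processes (those defining $\hat H_f$ and the integral inside the expectation defining $C$) are stochastic Riemann integrals (in the sense of mean-square calculus). The constant $\alpha=P/(N_0W)$ is the average signal-to-noise ratio, where $P$ is the mean power constraint on the channel input, which is band-limited to $(-W/2,W/2)$ with constant power spectral density $P/W$, and the additive white Gaussian noise has independent identically distributed real and imaginary parts each of power spectral density $N_0/2$. Capacity is in bits/s. $\mathrm{Ei}_m(z)=\int_1^\infty e^{-tz}t^{-m}\,dt$; in particular $\mathrm{Ei}_1(z)=-\mathrm{Ei}(-z)$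 with $\mathrm{Ei}$ the exponential integral. The Dirac case, in which $\tilde R$ is not a continuous function, is a formal statement: $\hat\sigma^2(f)$ is obtained by using the sifting property of $\delta$ in the double integral. *)

theory Defs
  imports "HOL-Probability.Probability"
begin

section \<open>Riemann integrals, deterministic and in mean square\<close>

definition riemann_filter :: "real \<Rightarrow> real \<Rightarrow> (real \<times> real set) set filter" where
  "riemann_filter a b =
     (INF d\<in>{0<..}. principal {p. p tagged_division_of {a..b} \<and> (\<lambda>x. ball x d) fine p})"

text \<open>The gauge in \<^const>\<open>riemann_filter\<close> is constant, so that it expresses that the mesh tends
  to 0: this is the Riemann integral, not the Henstock--Kurzweil integral. In particular an
  integrable function is bounded on \<open>{a..b}\<close>.\<close>

definition has_riemann_integral ::
  "(real \<Rightarrow> 'b::real_normed_vector) \<Rightarrow> 'b \<Rightarrow> real \<Rightarrow> real \<Rightarrow> bool" where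
  "has_riemann_integral h I a b \<longleftrightarrow>
     ((\<lambda>p. \<Sum>(x, K)\<in>p. measure lborel K *\<^sub>R h x) \<longlongrightarrow> I) (riemann_filter a b)"

text \<open>Improper integral over the whole line. For \<open>a > b\<close> the interval is empty and the integral
  is 0, which is irrelevant for the limit.\<close>

definition has_improper_riemann_integral ::
  "(real \<Rightarrow> 'b::real_normed_vector) \<Rightarrow> 'b \<Rightarrow> bool" where
  "has_improper_riemann_integral h I \<longleftrightarrow>
     (\<exists>J. (\<forall>a b. has_riemann_integral h (J a b) a b) \<and>
          ((\<lambda>(a, b). J a b) \<longlongrightarrow> I) (at_bot \<times>\<^sub>F at_top))"

definition L2_rv :: "'a measure \<Rightarrow> ('a \<Rightarrow> 'b::real_normed_vector) \<Rightarrow> bool" where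
  "L2_rv M Z \<longleftrightarrow> Z \<in> borel_measurable M \<and> integrable M (\<lambda>\<omega>. (norm (Z \<omega>))\<^sup>2)"

definition ms_tendsto ::
  "'a measure \<Rightarrow> ('i \<Rightarrow> 'a \<Rightarrow> 'b::real_normed_vector) \<Rightarrow> ('a \<Rightarrow> 'b) \<Rightarrow> 'i filter \<Rightarrow> bool" where
  "ms_tendsto M Z L F \<longleftrightarrow>
     L2_rv M L \<and> (\<forall>\<^sub>F i in F. L2_rv M (Z i)) \<and>
     ((\<lambda>i. \<integral>\<omega>. (norm (Z i \<omega> - L \<omega>))\<^sup>2 \<partial>M) \<longlongrightarrow> 0) F"

text \<open>Mean-square integrals are determined only up to almost sure equality, hence relations.\<close>

definition ms_has_riemann_integral ::
  "'a measure \<Rightarrow> (real \<Rightarrow> 'a \<Rightarrow> 'b::real_normed_vector) \<Rightarrow> ('a \<Rightarrow> 'b) \<Rightarrow> real \<Rightarrow> real \<Rightarrow> bool"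
  where
  "ms_has_riemann_integral M Z I a b \<longleftrightarrow>
     ms_tendsto M (\<lambda>p \<omega>. \<Sum>(x, K)\<in>p. measure lborel K *\<^sub>R Z x \<omega>) I (riemann_filter a b)"

definition ms_has_improper_riemann_integral ::
  "'a measure \<Rightarrow> (real \<Rightarrow> 'a \<Rightarrow> 'b::real_normed_vector) \<Rightarrow> ('a \<Rightarrow> 'b) \<Rightarrow> bool" where
  "ms_has_improper_riemann_integral M Z I \<longleftrightarrow>
     (\<exists>J. (\<forall>a b. ms_has_riemann_integral M Z (J a b) a b) \<and>
          ms_tendsto M (\<lambda>(a, b). J a b) I (at_bot \<times>\<^sub>F at_top))"

section \<open>Gaussian processes\<close>

text \<open>Degenerate (constant) Gaussian variables are included.\<close>

definition gaussian_rv :: "'a measure \<Rightarrow> ('a \<Rightarrow> real) \<Rightarrow> bool" where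
  "gaussian_rv M Z \<longleftrightarrow> Z \<in> borel_measurable M \<and>
     ((\<exists>m s. 0 < s \<and> distributed M lborel Z (normal_density m s)) \<or>
      (\<exists>m. AE \<omega> in M. Z \<omega> = m))"

definition gaussian_process :: "'a measure \<Rightarrow> 'i set \<Rightarrow> ('i \<Rightarrow> 'a \<Rightarrow> real) \<Rightarrow> bool" where
  "gaussian_process M T X \<longleftrightarrow>
     (\<forall>F c. finite F \<and> F \<subseteq> T \<longrightarrow> gaussian_rv M (\<lambda>\<omega>. \<Sum>t\<in>F. c t * X t \<omega>))"

definition iid_processes ::
  "'a measure \<Rightarrow> 'i set \<Rightarrow> ('i \<Rightarrow> 'a \<Rightarrow> real) \<Rightarrow> ('i \<Rightarrow> 'a \<Rightarrow> real) \<Rightarrow> bool" where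
  "iid_processes M T X Y \<longleftrightarrow>
     (let S = Pi\<^sub>M T (\<lambda>_. borel); X' = (\<lambda>\<omega>. \<lambda>t\<in>T. X t \<omega>); Y' = (\<lambda>\<omega>. \<lambda>t\<in>T. Y t \<omega>)
      in prob_space.indep_var M S X' S Y' \<and> distr M S X' = distr M S Y')"

definition stationary_gaussian ::
  "'a measure \<Rightarrow> (real \<Rightarrow> real) \<Rightarrow> (real \<Rightarrow> 'a \<Rightarrow> real) \<Rightarrow> bool" where
  "stationary_gaussian M Rt X \<longleftrightarrow>
     gaussian_process M UNIV X \<and>
     (\<forall>\<tau>. (\<integral>\<omega>. X \<tau> \<omega> \<partial>M) = 0) \<and>
     (\<forall>\<tau> \<tau>'. (\<integral>\<omega>. X \<tau> \<omega> * X \<tau>' \<omega> \<partial>M) = Rt (\<tau> - \<tau>'))"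

section \<open>The Rayleigh fading channel\<close>

definition decay_function :: "(real \<Rightarrow> real) \<Rightarrow> bool" where
  "decay_function g \<longleftrightarrow>
     (\<exists>u. g = (\<lambda>\<tau>. u \<tau> * indicator {0..} \<tau>)) \<and>
     (\<exists>I. has_improper_riemann_integral g I) \<and>
     (\<exists>I. has_improper_riemann_integral (\<lambda>\<tau>. (g \<tau>)\<^sup>2) I)"

definition rayleigh_channel ::
  "'a measure \<Rightarrow> (real \<Rightarrow> real) \<Rightarrow> (real \<Rightarrow> 'a \<Rightarrow> real) \<Rightarrow> (real \<Rightarrow> 'a \<Rightarrow> real) \<Rightarrow> bool" where
  "rayleigh_channel M Rt Xt Yt \<longleftrightarrow>
     continuous_on UNIV Rt \<and> stationary_gaussian M Rt Xt \<and> stationary_gaussian M Rt Yt \<and>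
     iid_processes M UNIV Xt Yt"

definition impulse_response ::
  "(real \<Rightarrow> 'a \<Rightarrow> real) \<Rightarrow> (real \<Rightarrow> 'a \<Rightarrow> real) \<Rightarrow> (real \<Rightarrow> real) \<Rightarrow> real \<Rightarrow> 'a \<Rightarrow> complex" where
  "impulse_response Xt Yt g \<tau> \<omega> = Complex (Xt \<tau> \<omega> * g \<tau>) (Yt \<tau> \<omega> * g \<tau>)"

definition is_fourier_transform ::
  "'a measure \<Rightarrow> (real \<Rightarrow> 'a \<Rightarrow> complex) \<Rightarrow> (real \<Rightarrow> 'a \<Rightarrow> complex) \<Rightarrow> bool" where
  "is_fourier_transform M H Hhat \<longleftrightarrow>
     (\<forall>f. ms_has_improper_riemann_integral M
            (\<lambda>\<tau> \<omega>. exp (- \<i> * complex_of_real (2 * pi * f * \<tau>)) * H \<tau> \<omega>) (Hhat f))"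

definition has_ergodic_capacity ::
  "'a measure \<Rightarrow> real \<Rightarrow> real \<Rightarrow> (real \<Rightarrow> 'a \<Rightarrow> complex) \<Rightarrow> real \<Rightarrow> bool" where
  "has_ergodic_capacity M W \<alpha> Hhat C \<longleftrightarrow>
     (\<exists>I. ms_has_riemann_integral M
            (\<lambda>f \<omega>. log 2 (1 + \<alpha> * (cmod (Hhat f \<omega>))\<^sup>2)) I (- W / 2) (W / 2) \<and>
          C = (\<integral>\<omega>. I \<omega> \<partial>M))"

definition channel_cov :: "(real \<Rightarrow> real) \<Rightarrow> (real \<Rightarrow> real) \<Rightarrow> real \<Rightarrow> real \<Rightarrow> real" where
  "channel_cov Rt g \<tau> \<tau>' = Rt (\<tau> - \<tau>') * g \<tau> * g \<tau>'"

definition sigma2_hat :: "(real \<Rightarrow> real) \<Rightarrow> (real \<Rightarrow> real) \<Rightarrow> real \<Rightarrow> real" where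
  "sigma2_hat Rt g f =
     integral {0..} (\<lambda>\<tau>'. integral {0..} (\<lambda>\<tau>.
       channel_cov Rt g \<tau> \<tau>' * cos (2 * pi * (\<tau> - \<tau>') * f)))"

text \<open>In \<open>exp (1 / s) * Ei_gen 1 (1 / s)\<close> the case \<open>s = 0\<close> (zero received power at the frequency
  in question) is to be read as the limit for \<open>s\<close> tending to 0 from the right, which is 0. This is
  also the value in HOL: \<open>1 / 0 = 0\<close>, and the divergent integral \<open>Ei_gen 1 0\<close> is 0.\<close>

definition Ei_gen :: "nat \<Rightarrow> real \<Rightarrow> real" where
  "Ei_gen m z = integral {1..} (\<lambda>t. exp (- t * z) / t ^ m)"

section \<open>Covariance distributions and uncorrelated scattering\<close>

definition dirac_delta :: "(real \<Rightarrow> real) \<Rightarrow> real" where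
  "dirac_delta \<phi> = \<phi> 0"

text \<open>For a distribution \<open>T\<close> on the line, \<open>double_integral T F\<close> is the double integral of
  \<open>T (\<tau> - \<tau>') F (\<tau>, \<tau>')\<close>, the inner integration being over \<open>\<tau> = \<tau>' + s\<close>.\<close>

definition double_integral ::
  "((real \<Rightarrow> real) \<Rightarrow> real) \<Rightarrow> (real \<Rightarrow> real \<Rightarrow> real) \<Rightarrow> real" where
  "double_integral T F = integral UNIV (\<lambda>\<tau>'. T (\<lambda>s. F (\<tau>' + s) \<tau>'))"

text \<open>The integration over the whole line agrees with that over \<open>{0..}\<close> since decay functions
  vanish on the negative half-line.\<close>

definition sigma2_hat_dist :: "((real \<Rightarrow> real) \<Rightarrow> real) \<Rightarrow> (real \<Rightarrow> real) \<Rightarrow> real \<Rightarrow> real" where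
  "sigma2_hat_dist T g f =
     double_integral T (\<lambda>\<tau> \<tau>'. g \<tau> * g \<tau>' * cos (2 * pi * (\<tau> - \<tau>') * f))"

text \<open>A process whose covariance is the Dirac distribution has no values at single times. It is
  a generalized process: \<open>X \<phi>\<close> stands for the integral of \<open>X\<^sub>\<tau> \<phi> \<tau>\<close> over \<open>\<tau>\<close>. The test functions
  must include the decay functions multiplied by cosines and sines.\<close>

definition test_functions :: "(real \<Rightarrow> real) set" where
  "test_functions = {\<phi>. (\<forall>a b. \<exists>I. has_riemann_integral \<phi> I a b) \<and>
                        (\<exists>I. has_improper_riemann_integral (\<lambda>\<tau>. (\<phi> \<tau>)\<^sup>2) I)}"

definition gen_stationary_gaussian ::
  "'a measure \<Rightarrow> ((real \<Rightarrow> real) \<Rightarrow> real) \<Rightarrow> ((real \<Rightarrow> real) \<Rightarrow> 'a \<Rightarrow> real) \<Rightarrow> bool" where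
  "gen_stationary_gaussian M T X \<longleftrightarrow>
     gaussian_process M test_functions X \<and>
     (\<forall>\<phi>\<in>test_functions. (\<integral>\<omega>. X \<phi> \<omega> \<partial>M) = 0) \<and>
     (\<forall>\<phi>\<in>test_functions. \<forall>\<psi>\<in>test_functions.
        (\<integral>\<omega>. X \<phi> \<omega> * X \<psi> \<omega> \<partial>M) = double_integral T (\<lambda>\<tau> \<tau>'. \<phi> \<tau> * \<psi> \<tau>'))"

definition gen_rayleigh_channel ::
  "'a measure \<Rightarrow> ((real \<Rightarrow> real) \<Rightarrow> real) \<Rightarrow>
   ((real \<Rightarrow> real) \<Rightarrow> 'a \<Rightarrow> real) \<Rightarrow> ((real \<Rightarrow> real) \<Rightarrow> 'a \<Rightarrow> real) \<Rightarrow> bool" where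
  "gen_rayleigh_channel M T Xt Yt \<longleftrightarrow>
     gen_stationary_gaussian M T Xt \<and> gen_stationary_gaussian M T Yt \<and>
     iid_processes M test_functions Xt Yt"

text \<open>Real and imaginary part of the integral of
  \<open>(cos (2 \<pi> f \<tau>) - \<i> sin (2 \<pi> f \<tau>)) g \<tau> (X\<^sub>\<tau> + \<i> Y\<^sub>\<tau>)\<close>.\<close>

definition gen_fourier_transform ::
  "((real \<Rightarrow> real) \<Rightarrow> 'a \<Rightarrow> real) \<Rightarrow> ((real \<Rightarrow> real) \<Rightarrow> 'a \<Rightarrow> real) \<Rightarrow> (real \<Rightarrow> real) \<Rightarrow>
   real \<Rightarrow> 'a \<Rightarrow> complex" where
  "gen_fourier_transform Xt Yt g f \<omega> =
     (let c = (\<lambda>\<tau>. cos (2 * pi * f * \<tau>) * g \<tau>); s = (\<lambda>\<tau>. sin (2 * pi * f * \<tau>) * g \<tau>)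
      in Complex (Xt c \<omega> + Yt s \<omega>) (Yt c \<omega> - Xt s \<omega>))"

end

theory Submission
  imports Defs
begin

text \<open>Mean-square limits preserve inner products with a fixed square-integrable variable. Applied
  first to the integral over \<open>\<tau>\<close> and then to that over \<open>\<tau>'\<close>, this identifies the iterated integral
  \<open>2 \<sigma>\<^sup>2(f)\<close> with the second moment of \<open>H\<^sub>f\<close>. It also shows that \<open>H\<^sub>f\<close>, a limit of linear
  combinations of the Gaussian processes, is circularly symmetric Gaussian, whence
  \<open>E exp (- t \<bar>H\<^sub>f\<bar>\<^sup>2) = 1 / (1 + 2 t \<sigma>\<^sup>2(f))\<close>. Inserting this into the Frullani representation of
  \<open>ln (1 + \<alpha> \<bar>H\<^sub>f\<bar>\<^sup>2)\<close> gives the expression with the exponential integral. Existence of the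
  mean-square integrals rests on the completeness of the space of square-integrable variables.\<close>

subsection \<open>Square-integrable random variables\<close>

text \<open>Nothing makes the processes jointly measurable in \<omega> and \<tau>, so Fubini cannot
  exchange an expectation with an integral over \<tau>. Every such exchange is made by testing: the
  inner product with a fixed square-integrable variable commutes with Riemann sums and is continuous
  in mean square. The scalar integrals that arise may converge only conditionally, which the gauge
  integrals in \<open>sigma2_hat\<close> tolerate. The obstacle to existence on bounded intervals is
  that g is merely Riemann integrable and the process merely mean-square continuous; two Riemann
  sums are compared directly on the common refinement of their divisions. On the half-line,
  integrability of g and of its square does not suffice: for
  \<open>g \<tau> = sin \<tau> / \<tau>\<close> and covariance \<open>cos\<close> the mean-square
  integral diverges at \<open>f = 0\<close>. Absolute integrability of g supplies a tail bound
  there. In the uncorrelated case second moments are computed exactly and only the square of g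
  enters them.\<close>

lemma L2_rvD:
  assumes "L2_rv M Z"
  shows "Z \<in> borel_measurable M" "integrable M (\<lambda>\<omega>. (norm (Z \<omega>))\<^sup>2)"
  using assms by (auto simp: L2_rv_def)

lemma L2_rv_bound:
  fixes Z :: "'a \<Rightarrow> 'b::real_normed_vector" and Y :: "'a \<Rightarrow> 'c::real_normed_vector"
  assumes "L2_rv M Y" "Z \<in> borel_measurable M" "\<And>\<omega>. norm (Z \<omega>) \<le> K * norm (Y \<omega>)"
  shows "L2_rv M Z"
proof -
  have [measurable]: "Z \<in> borel_measurable M" "Y \<in> borel_measurable M"
    using assms by (auto simp: L2_rv_def)
  have "(norm (Z \<omega>))\<^sup>2 \<le> K\<^sup>2 * (norm (Y \<omega>))\<^sup>2" for \<omega>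
    using power_mono[OF assms(3)[of \<omega>], of 2] by (simp add: power_mult_distrib)
  then have "integrable M (\<lambda>\<omega>. (norm (Z \<omega>))\<^sup>2)"
    by (intro Bochner_Integration.integrable_bound[OF integrable_mult_right[OF L2_rvD(2)[OF assms(1)], of "K\<^sup>2"]])
       auto
  then show ?thesis by (simp add: L2_rv_def assms)
qed

lemma L2_rv_add:
  fixes Y Z :: "'a \<Rightarrow> 'b::{second_countable_topology,real_inner}"
  assumes "L2_rv M Y" "L2_rv M Z"
  shows "L2_rv M (\<lambda>\<omega>. Y \<omega> + Z \<omega>)"
proof -
  have [measurable]: "Z \<in> borel_measurable M" "Y \<in> borel_measurable M"
    using assms by (auto simp: L2_rv_def)
  have "(norm (Y \<omega> + Z \<omega>))\<^sup>2 \<le> 2 * (norm (Y \<omega>))\<^sup>2 + 2 * (norm (Z \<omega>))\<^sup>2" for \<omega>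
    using power_mono[OF norm_triangle_ineq[of "Y \<omega>" "Z \<omega>"], of 2]
      sum_squares_bound[of "norm (Y \<omega>)" "norm (Z \<omega>)"]
    by (simp add: power2_sum)
  then have "integrable M (\<lambda>\<omega>. (norm (Y \<omega> + Z \<omega>))\<^sup>2)"
    by (intro Bochner_Integration.integrable_bound[OF Bochner_Integration.integrable_add[OF
          integrable_mult_right[OF L2_rvD(2)[OF assms(1)], of 2]
          integrable_mult_right[OF L2_rvD(2)[OF assms(2)], of 2]]]) auto
  then show ?thesis by (simp add: L2_rv_def)
qed

lemma L2_rv_scaleR:
  fixes Z :: "'a \<Rightarrow> 'b::{second_countable_topology,real_inner}"
  assumes "L2_rv M Z"
  shows "L2_rv M (\<lambda>\<omega>. c *\<^sub>R Z \<omega>)"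
  using assms by (intro L2_rv_bound[OF assms, of _ "\<bar>c\<bar>"]) (auto simp: L2_rv_def)

lemma L2_rv_diff:
  fixes Y Z :: "'a \<Rightarrow> 'b::{second_countable_topology,real_inner}"
  assumes "L2_rv M Y" "L2_rv M Z"
  shows "L2_rv M (\<lambda>\<omega>. Y \<omega> - Z \<omega>)"
  using L2_rv_add[OF assms(1) L2_rv_scaleR[OF assms(2), of "-1"]] by simp

lemma L2_rv_sum:
  fixes Z :: "'i \<Rightarrow> 'a \<Rightarrow> 'b::{second_countable_topology,real_inner}"
  assumes "\<And>i. i \<in> A \<Longrightarrow> L2_rv M (Z i)"
  shows "L2_rv M (\<lambda>\<omega>. \<Sum>i\<in>A. Z i \<omega>)"
  using assms
  by (induction A rule: infinite_finite_induct) (auto simp: L2_rv_def[of _ "\<lambda>_. 0"] intro!: L2_rv_add)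

lemma L2_rv_integrable_inner:
  fixes Y Z :: "'a \<Rightarrow> 'b::{second_countable_topology,real_inner}"
  assumes "L2_rv M Y" "L2_rv M Z"
  shows "integrable M (\<lambda>\<omega>. Y \<omega> \<bullet> Z \<omega>)"
proof -
  have [measurable]: "Z \<in> borel_measurable M" "Y \<in> borel_measurable M"
    using assms by (auto simp: L2_rv_def)
  have "\<bar>Y \<omega> \<bullet> Z \<omega>\<bar> \<le> (norm (Y \<omega>))\<^sup>2 + (norm (Z \<omega>))\<^sup>2" for \<omega>
    using Cauchy_Schwarz_ineq2[of "Y \<omega>" "Z \<omega>"] sum_squares_bound[of "norm (Y \<omega>)" "norm (Z \<omega>)"]
      zero_le_power2[of "norm (Y \<omega>)"] zero_le_power2[of "norm (Z \<omega>)"]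
    by linarith
  then show ?thesis
    by (intro Bochner_Integration.integrable_bound[OF Bochner_Integration.integrable_add[OF
          L2_rvD(2)[OF assms(1)] L2_rvD(2)[OF assms(2)]]]) auto
qed

lemma L2_rv_integral_square_add:
  fixes Y Z :: "'a \<Rightarrow> 'b::{second_countable_topology,real_inner}"
  assumes "L2_rv M Y" "L2_rv M Z"
  shows "(\<integral>\<omega>. (norm (Y \<omega> + Z \<omega>))\<^sup>2 \<partial>M) =
     (\<integral>\<omega>. (norm (Y \<omega>))\<^sup>2 \<partial>M) + 2 * (\<integral>\<omega>. Y \<omega> \<bullet> Z \<omega> \<partial>M) + (\<integral>\<omega>. (norm (Z \<omega>))\<^sup>2 \<partial>M)"
proof -
  have "(norm (Y \<omega> + Z \<omega>))\<^sup>2 = (norm (Y \<omega>))\<^sup>2 + 2 * (Y \<omega> \<bullet> Z \<omega>) + (norm (Z \<omega>))\<^sup>2" for \<omega>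
    by (simp add: power2_norm_eq_inner inner_add inner_commute)
  then show ?thesis
    using assms by (simp add: L2_rvD L2_rv_integrable_inner)
qed

lemma L2_rv_integral_square_diff:
  fixes Y Z :: "'a \<Rightarrow> 'b::{second_countable_topology,real_inner}"
  assumes "L2_rv M Y" "L2_rv M Z"
  shows "(\<integral>\<omega>. (norm (Y \<omega> - Z \<omega>))\<^sup>2 \<partial>M) =
     (\<integral>\<omega>. (norm (Y \<omega>))\<^sup>2 \<partial>M) - 2 * (\<integral>\<omega>. Y \<omega> \<bullet> Z \<omega> \<partial>M) + (\<integral>\<omega>. (norm (Z \<omega>))\<^sup>2 \<partial>M)"
  using L2_rv_integral_square_add[OF assms(1) L2_rv_scaleR[OF assms(2), of "-1"]]
  by simp

text \<open>The second moment of \<open>Y + t Z\<close> is a nonnegative quadratic polynomial in t,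
  so its discriminant is not positive.\<close>

lemma L2_rv_Cauchy_Schwarz:
  fixes Y Z :: "'a \<Rightarrow> 'b::{second_countable_topology,real_inner}"
  assumes "L2_rv M Y" "L2_rv M Z"
  shows "\<bar>\<integral>\<omega>. Y \<omega> \<bullet> Z \<omega> \<partial>M\<bar> \<le>
    sqrt (\<integral>\<omega>. (norm (Y \<omega>))\<^sup>2 \<partial>M) * sqrt (\<integral>\<omega>. (norm (Z \<omega>))\<^sup>2 \<partial>M)"
proof -
  define a b c where "a = (\<integral>\<omega>. (norm (Y \<omega>))\<^sup>2 \<partial>M)" and "b = (\<integral>\<omega>. Y \<omega> \<bullet> Z \<omega> \<partial>M)"
    and "c = (\<integral>\<omega>. (norm (Z \<omega>))\<^sup>2 \<partial>M)"
  have quad: "0 \<le> a + 2 * t * b + t\<^sup>2 * c" for t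
  proof -
    have "0 \<le> (\<integral>\<omega>. (norm (Y \<omega> + t *\<^sub>R Z \<omega>))\<^sup>2 \<partial>M)" by simp
    also have "\<dots> = a + 2 * t * b + t\<^sup>2 * c"
      unfolding a_def b_def c_def
      by (subst L2_rv_integral_square_add[OF assms(1) L2_rv_scaleR[OF assms(2)]])
         (simp add: power_mult_distrib)
    finally show ?thesis .
  qed
  have c0: "0 \<le> c" by (simp add: c_def)
  have "b\<^sup>2 \<le> a * c"
  proof (cases "c = 0")
    case True
    have "b = 0"
    proof (rule ccontr)
      assume "b \<noteq> 0"
      \<comment> \<open>With \<open>c = 0\<close> the polynomial is affine in t, and this t gives it
        the value -1.\<close>
      then show False using quad[of "- (a + 1) / (2 * b)"] True by (simp add: field_simps)
    qed
    then show ?thesis using True by simp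
  next
    case False
    then have "0 < c" using c0 by simp
    \<comment> \<open>The minimiser of the quadratic.\<close>
    then show ?thesis using quad[of "- b / c"]
      by (simp add: power2_eq_square field_simps)
  qed
  then have "sqrt (b\<^sup>2) \<le> sqrt (a * c)" by (rule real_sqrt_le_mono)
  then show ?thesis unfolding a_def b_def c_def by (simp add: real_sqrt_mult)
qed

context prob_space begin

lemma L2_rv_const: "L2_rv M (\<lambda>_. c)"
  by (simp add: L2_rv_def)

lemma L2_rv_integrable:
  fixes Z :: "'a \<Rightarrow> 'b::euclidean_space"
  assumes "L2_rv M Z"
  shows "integrable M Z"
proof (rule Bochner_Integration.integrable_bound[where f = "\<lambda>\<omega>. 1 + (norm (Z \<omega>))\<^sup>2"])
  show "integrable M (\<lambda>\<omega>. 1 + (norm (Z \<omega>))\<^sup>2)" "Z \<in> borel_measurable M"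
    using assms by (auto simp: L2_rv_def)
  have "norm (Z \<omega>) \<le> 1 + (norm (Z \<omega>))\<^sup>2" for \<omega>
    using sum_squares_bound[of "norm (Z \<omega>)" 1] zero_le_power2[of "norm (Z \<omega>)"]
      norm_ge_zero[of "Z \<omega>"] unfolding power_one mult_1_right by linarith
  then show "AE \<omega> in M. norm (Z \<omega>) \<le> norm (1 + (norm (Z \<omega>))\<^sup>2)"
    by (intro AE_I2) (smt (verit) real_norm_def)
qed

text \<open>Cauchy-Schwarz against the constant 1, whose second moment is 1 on a probability
  space.\<close>

lemma L2_rv_integral_norm_le:
  fixes Z :: "'a \<Rightarrow> 'b::euclidean_space"
  assumes "L2_rv M Z"
  shows "(\<integral>\<omega>. norm (Z \<omega>) \<partial>M) \<le> sqrt (\<integral>\<omega>. (norm (Z \<omega>))\<^sup>2 \<partial>M)"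
proof -
  have "L2_rv M (\<lambda>\<omega>. norm (Z \<omega>))" using assms by (auto simp: L2_rv_def)
  from L2_rv_Cauchy_Schwarz[OF this L2_rv_const[of "1::real"]] show ?thesis
    by (simp add: prob_space)
qed

end

section \<open>Limits in mean square\<close>

lemma ms_tendsto_inner:
  fixes Z :: "'i \<Rightarrow> 'a \<Rightarrow> 'b::euclidean_space"
  assumes "ms_tendsto M Z L F" "L2_rv M V"
  shows "((\<lambda>i. \<integral>\<omega>. Z i \<omega> \<bullet> V \<omega> \<partial>M) \<longlongrightarrow> (\<integral>\<omega>. L \<omega> \<bullet> V \<omega> \<partial>M)) F"
proof -
  have L: "L2_rv M L" and ev: "\<forall>\<^sub>F i in F. L2_rv M (Z i)"
    and lim: "((\<lambda>i. \<integral>\<omega>. (norm (Z i \<omega> - L \<omega>))\<^sup>2 \<partial>M) \<longlongrightarrow> 0) F"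
    using assms(1) by (auto simp: ms_tendsto_def)
  \<comment> \<open>By Cauchy-Schwarz this product dominates the difference of the inner
    products.\<close>
  have "((\<lambda>i. sqrt (\<integral>\<omega>. (norm (Z i \<omega> - L \<omega>))\<^sup>2 \<partial>M) * sqrt (\<integral>\<omega>. (norm (V \<omega>))\<^sup>2 \<partial>M))
     \<longlongrightarrow> sqrt 0 * sqrt (\<integral>\<omega>. (norm (V \<omega>))\<^sup>2 \<partial>M)) F"
    by (intro tendsto_intros lim)
  then have bound0: "((\<lambda>i. sqrt (\<integral>\<omega>. (norm (Z i \<omega> - L \<omega>))\<^sup>2 \<partial>M) * sqrt (\<integral>\<omega>. (norm (V \<omega>))\<^sup>2 \<partial>M))
     \<longlongrightarrow> 0) F"
    by simp
  have "((\<lambda>i. (\<integral>\<omega>. Z i \<omega> \<bullet> V \<omega> \<partial>M) - (\<integral>\<omega>. L \<omega> \<bullet> V \<omega> \<partial>M)) \<longlongrightarrow> 0) F"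
  proof (rule Lim_null_comparison)
    show "\<forall>\<^sub>F i in F. norm ((\<integral>\<omega>. Z i \<omega> \<bullet> V \<omega> \<partial>M) - (\<integral>\<omega>. L \<omega> \<bullet> V \<omega> \<partial>M)) \<le>
       sqrt (\<integral>\<omega>. (norm (Z i \<omega> - L \<omega>))\<^sup>2 \<partial>M) * sqrt (\<integral>\<omega>. (norm (V \<omega>))\<^sup>2 \<partial>M)"
      using ev
    proof eventually_elim
      case (elim i)
      have "(\<integral>\<omega>. Z i \<omega> \<bullet> V \<omega> \<partial>M) - (\<integral>\<omega>. L \<omega> \<bullet> V \<omega> \<partial>M) = (\<integral>\<omega>. (Z i \<omega> - L \<omega>) \<bullet> V \<omega> \<partial>M)"
        using elim L assms(2) by (simp add: inner_diff_left L2_rv_integrable_inner)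
      then show ?case
        using L2_rv_Cauchy_Schwarz[OF L2_rv_diff[OF elim L] assms(2)] by simp
    qed
  qed (fact bound0)
  then show ?thesis by (simp add: LIM_zero_iff)
qed

text \<open>The square of the norm of Z equals that of \<open>Z - L\<close>, plus twice the inner
  product of Z and L, minus the square of the norm of L; each term converges.\<close>

lemma ms_tendsto_integral_square:
  fixes Z :: "'i \<Rightarrow> 'a \<Rightarrow> 'b::euclidean_space"
  assumes "ms_tendsto M Z L F"
  shows "((\<lambda>i. \<integral>\<omega>. (norm (Z i \<omega>))\<^sup>2 \<partial>M) \<longlongrightarrow> (\<integral>\<omega>. (norm (L \<omega>))\<^sup>2 \<partial>M)) F"
proof -
  have L: "L2_rv M L" and ev: "\<forall>\<^sub>F i in F. L2_rv M (Z i)"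
    and lim: "((\<lambda>i. \<integral>\<omega>. (norm (Z i \<omega> - L \<omega>))\<^sup>2 \<partial>M) \<longlongrightarrow> 0) F"
    using assms(1) by (auto simp: ms_tendsto_def)
  have "((\<lambda>i. (\<integral>\<omega>. (norm (Z i \<omega> - L \<omega>))\<^sup>2 \<partial>M) + 2 * (\<integral>\<omega>. Z i \<omega> \<bullet> L \<omega> \<partial>M)
     - (\<integral>\<omega>. (norm (L \<omega>))\<^sup>2 \<partial>M)) \<longlongrightarrow>
     0 + 2 * (\<integral>\<omega>. L \<omega> \<bullet> L \<omega> \<partial>M) - (\<integral>\<omega>. (norm (L \<omega>))\<^sup>2 \<partial>M)) F"
    by (intro tendsto_intros lim ms_tendsto_inner[OF assms L])
  then have "((\<lambda>i. (\<integral>\<omega>. (norm (Z i \<omega> - L \<omega>))\<^sup>2 \<partial>M) + 2 * (\<integral>\<omega>. Z i \<omega> \<bullet> L \<omega> \<partial>M)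
     - (\<integral>\<omega>. (norm (L \<omega>))\<^sup>2 \<partial>M)) \<longlongrightarrow> (\<integral>\<omega>. (norm (L \<omega>))\<^sup>2 \<partial>M)) F"
    by (simp add: power2_norm_eq_inner)
  then show ?thesis
    by (rule Lim_transform_eventually)
       (use ev in eventually_elim, auto simp: L2_rv_integral_square_diff[OF _ L])
qed

lemma norm_square_triangle:
  fixes x y z :: "'b::real_inner"
  shows "(norm (x - z))\<^sup>2 \<le> 2 * (norm (x - y))\<^sup>2 + 2 * (norm (y - z))\<^sup>2"
  using power_mono[OF norm_triangle_ineq[of "x - y" "y - z"], of 2]
    sum_squares_bound[of "norm (x - y)" "norm (y - z)"]
  by (simp add: power2_sum)

lemma L2_rv_square_triangle:
  fixes X Y Z :: "'a \<Rightarrow> 'b::{second_countable_topology,real_inner}"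
  assumes "L2_rv M X" "L2_rv M Y" "L2_rv M Z"
  shows "(\<integral>\<omega>. (norm (X \<omega> - Z \<omega>))\<^sup>2 \<partial>M) \<le>
    2 * (\<integral>\<omega>. (norm (X \<omega> - Y \<omega>))\<^sup>2 \<partial>M) + 2 * (\<integral>\<omega>. (norm (Y \<omega> - Z \<omega>))\<^sup>2 \<partial>M)"
proof -
  note I = L2_rvD(2)[OF L2_rv_diff[OF assms(1,2)]] L2_rvD(2)[OF L2_rv_diff[OF assms(2,3)]]
    L2_rvD(2)[OF L2_rv_diff[OF assms(1,3)]]
  have "(\<integral>\<omega>. (norm (X \<omega> - Z \<omega>))\<^sup>2 \<partial>M) \<le>
    (\<integral>\<omega>. 2 * (norm (X \<omega> - Y \<omega>))\<^sup>2 + 2 * (norm (Y \<omega> - Z \<omega>))\<^sup>2 \<partial>M)"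
    using I by (intro integral_mono norm_square_triangle) auto
  then show ?thesis using I by simp
qed

subsection \<open>Completeness\<close>

context prob_space begin

text \<open>Riesz-Fischer. A mean-square Cauchy sequence is Cauchy in mean, which yields an almost
  surely convergent subsequence; Fatou's lemma along it bounds the distance of every late term from
  the pointwise limit.\<close>

lemma L2_complete_sequence:
  fixes S :: "nat \<Rightarrow> 'a \<Rightarrow> 'b::euclidean_space"
  assumes L2: "\<And>n. L2_rv M (S n)"
    and Cauchy: "\<And>e. e > 0 \<Longrightarrow> \<exists>N. \<forall>m\<ge>N. \<forall>n\<ge>N. (\<integral>\<omega>. (norm (S m \<omega> - S n \<omega>))\<^sup>2 \<partial>M) < e"
  shows "\<exists>L. ms_tendsto M S L sequentially"
proof -
  have [measurable]: "S n \<in> borel_measurable M" for n using L2 by (simp add: L2_rv_def)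
  have L1: "\<exists>N. \<forall>i\<ge>N. \<forall>j\<ge>N. LINT \<omega>|M. norm (S i \<omega> - S j \<omega>) < e" if "e > 0" for e
  proof -
    obtain N where N: "\<And>m n. m \<ge> N \<Longrightarrow> n \<ge> N \<Longrightarrow> (\<integral>\<omega>. (norm (S m \<omega> - S n \<omega>))\<^sup>2 \<partial>M) < e\<^sup>2"
      using Cauchy[of "e\<^sup>2"] \<open>e > 0\<close> by auto
    have "LINT \<omega>|M. norm (S i \<omega> - S j \<omega>) < e" if "i \<ge> N" "j \<ge> N" for i j
      using L2_rv_integral_norm_le[OF L2_rv_diff[OF L2 L2], of i j]
        real_sqrt_less_mono[OF N[OF that]] \<open>e > 0\<close>
      by simp
    then show ?thesis by blast
  qed
  obtain r where r: "strict_mono r" "AE \<omega> in M. Cauchy (\<lambda>i. S (r i) \<omega>)"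
    using cauchy_L1_AE_cauchy_subseq[OF L2_rv_integrable[OF L2] L1] by blast
  define L where "L \<omega> = lim (\<lambda>i. S (r i) \<omega>)" for \<omega>
  have [measurable]: "L \<in> borel_measurable M" unfolding L_def by measurable
  have conv: "AE \<omega> in M. (\<lambda>i. S (r i) \<omega>) \<longlonglongrightarrow> L \<omega>"
    using r(2) by eventually_elim (simp add: L_def Cauchy_convergent_iff convergent_LIMSEQ_iff)
  have bound: "(\<integral>\<^sup>+\<omega>. ennreal ((norm (S n \<omega> - L \<omega>))\<^sup>2) \<partial>M) \<le> ennreal e"
    if e: "e > 0" and N: "\<And>m. m \<ge> N \<Longrightarrow> (\<integral>\<omega>. (norm (S n \<omega> - S m \<omega>))\<^sup>2 \<partial>M) < e" for n N e
  proof -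
    have "(\<integral>\<^sup>+\<omega>. ennreal ((norm (S n \<omega> - L \<omega>))\<^sup>2) \<partial>M) =
       (\<integral>\<^sup>+\<omega>. liminf (\<lambda>i. ennreal ((norm (S n \<omega> - S (r i) \<omega>))\<^sup>2)) \<partial>M)"
    proof (rule nn_integral_cong_AE, use conv in eventually_elim)
      case (elim \<omega>)
      then have "(\<lambda>i. ennreal ((norm (S n \<omega> - S (r i) \<omega>))\<^sup>2)) \<longlonglongrightarrow> ennreal ((norm (S n \<omega> - L \<omega>))\<^sup>2)"
        by (intro tendsto_intros)
      then show ?case by (rule lim_imp_Liminf[OF sequentially_bot, symmetric])
    qed
    also have "\<dots> \<le> liminf (\<lambda>i. \<integral>\<^sup>+\<omega>. ennreal ((norm (S n \<omega> - S (r i) \<omega>))\<^sup>2) \<partial>M)"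
      by (rule nn_integral_liminf) measurable
    also have "\<dots> = liminf (\<lambda>i. ennreal (\<integral>\<omega>. (norm (S n \<omega> - S (r i) \<omega>))\<^sup>2 \<partial>M))"
      using L2_rvD(2)[OF L2_rv_diff[OF L2 L2]]
      by (subst nn_integral_eq_integral) auto
    also have "\<dots> \<le> ennreal e"
    proof (rule Liminf_le)
      show "\<forall>\<^sub>F i in sequentially. ennreal (\<integral>\<omega>. (norm (S n \<omega> - S (r i) \<omega>))\<^sup>2 \<partial>M) \<le> ennreal e"
        using eventually_ge_at_top[of N]
      proof eventually_elim
        case (elim i)
        then show ?case
          using N[of "r i"] seq_suble[OF r(1), of i] e by (intro ennreal_leI) auto
      qed
    qed auto
    finally show ?thesis .
  qed
  have fin: "\<exists>N. \<forall>n\<ge>N. L2_rv M (\<lambda>\<omega>. S n \<omega> - L \<omega>) \<and> (\<integral>\<omega>. (norm (S n \<omega> - L \<omega>))\<^sup>2 \<partial>M) \<le> e"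
    if e: "e > 0" for e
  proof -
    obtain N where N: "\<And>m n. m \<ge> N \<Longrightarrow> n \<ge> N \<Longrightarrow> (\<integral>\<omega>. (norm (S m \<omega> - S n \<omega>))\<^sup>2 \<partial>M) < e"
      using Cauchy[OF e] by auto
    have "L2_rv M (\<lambda>\<omega>. S n \<omega> - L \<omega>) \<and> (\<integral>\<omega>. (norm (S n \<omega> - L \<omega>))\<^sup>2 \<partial>M) \<le> e" if "n \<ge> N" for n
    proof -
      have b: "(\<integral>\<^sup>+\<omega>. ennreal ((norm (S n \<omega> - L \<omega>))\<^sup>2) \<partial>M) \<le> ennreal e"
        using bound[OF e N[OF that]] by blast
      then have i: "integrable M (\<lambda>\<omega>. (norm (S n \<omega> - L \<omega>))\<^sup>2)"
        by (intro integrableI_bounded) (auto simp: le_less_trans)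
      then have "ennreal (\<integral>\<omega>. (norm (S n \<omega> - L \<omega>))\<^sup>2 \<partial>M) \<le> ennreal e"
        using b by (subst (asm) nn_integral_eq_integral) auto
      then show ?thesis using i e by (simp add: L2_rv_def)
    qed
    then show ?thesis by blast
  qed
  obtain N where "\<And>n. n \<ge> N \<Longrightarrow> L2_rv M (\<lambda>\<omega>. S n \<omega> - L \<omega>)" using fin[of 1] by auto
  then have "L2_rv M L"
    using L2_rv_diff[OF L2[of N], of "\<lambda>\<omega>. S N \<omega> - L \<omega>"] by simp
  moreover have "(\<lambda>n. \<integral>\<omega>. (norm (S n \<omega> - L \<omega>))\<^sup>2 \<partial>M) \<longlonglongrightarrow> 0"
  proof (rule LIMSEQ_I)
    fix e :: real assume "e > 0"
    then obtain N where N: "\<And>n. n \<ge> N \<Longrightarrow> (\<integral>\<omega>. (norm (S n \<omega> - L \<omega>))\<^sup>2 \<partial>M) \<le> e / 2"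
      using fin[of "e/2"] by auto
    then have "norm ((\<integral>\<omega>. (norm (S n \<omega> - L \<omega>))\<^sup>2 \<partial>M) - 0) < e" if "n \<ge> N" for n
      using N[OF that] \<open>e > 0\<close> by simp
    then show "\<exists>no. \<forall>n\<ge>no. norm ((\<integral>\<omega>. (norm (S n \<omega> - L \<omega>))\<^sup>2 \<partial>M) - 0) < e" by blast
  qed
  ultimately show ?thesis using L2 by (auto simp: ms_tendsto_def)
qed

text \<open>Riemann sums form a family along a filter, not a sequence. A sequence is extracted whose
  n-th member satisfies the Cauchy conditions up to level n; its limit attracts the whole
  family.\<close>

lemma L2_complete:
  fixes S :: "'i \<Rightarrow> 'a \<Rightarrow> 'b::euclidean_space"
  assumes F: "F \<noteq> bot" and L2: "\<And>i. L2_rv M (S i)"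
    and Cauchy: "\<And>e. e > 0 \<Longrightarrow> \<exists>P. eventually P F \<and>
       (\<forall>i j. P i \<longrightarrow> P j \<longrightarrow> (\<integral>\<omega>. (norm (S i \<omega> - S j \<omega>))\<^sup>2 \<partial>M) < e)"
  shows "\<exists>L. ms_tendsto M S L F"
proof -
  have "\<exists>P. \<forall>n. eventually (P n) F \<and> (\<forall>i j. P n i \<longrightarrow> P n j \<longrightarrow>
      (\<integral>\<omega>. (norm (S i \<omega> - S j \<omega>))\<^sup>2 \<partial>M) < 1 / Suc n)"
    by (intro choice allI Cauchy) simp
  then obtain P where ev: "\<And>n. eventually (P n) F"
    and P: "\<And>n i j. P n i \<Longrightarrow> P n j \<Longrightarrow> (\<integral>\<omega>. (norm (S i \<omega> - S j \<omega>))\<^sup>2 \<partial>M) < 1 / Suc n"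
    by blast
  \<comment> \<open>The \<open>P m\<close> need not be decreasing in m, so one index is taken from
    finitely many of them at once.\<close>
  have "\<exists>i. \<forall>m\<le>n. P m i" for n :: nat
  proof -
    have "\<forall>\<^sub>F i in F. \<forall>m\<in>{..n}. P m i" by (intro eventually_ball_finite) (auto simp: ev)
    from eventually_happens'[OF F this] show ?thesis by auto
  qed
  then obtain i where i: "\<And>n m. m \<le> n \<Longrightarrow> P m (i n)" by metis
  have small: "\<exists>n. 1 / real (Suc n) < e" if "e > 0" for e
    using reals_Archimedean[OF that] by (auto simp: inverse_eq_divide)
  have "\<exists>N. \<forall>m\<ge>N. \<forall>n\<ge>N. (\<integral>\<omega>. (norm (S (i m) \<omega> - S (i n) \<omega>))\<^sup>2 \<partial>M) < e" if e: "e > 0" for e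
  proof -
    obtain N where "1 / real (Suc N) < e" using small[OF e] by blast
    then have "(\<integral>\<omega>. (norm (S (i m) \<omega> - S (i n) \<omega>))\<^sup>2 \<partial>M) < e" if "m \<ge> N" "n \<ge> N" for m n
      using P[OF i[OF that(1)] i[OF that(2)]] by linarith
    then show ?thesis by blast
  qed
  from L2_complete_sequence[of "\<lambda>n. S (i n)", OF L2 this]
  obtain L where L: "ms_tendsto M (\<lambda>n. S (i n)) L sequentially" by blast
  then have L2L: "L2_rv M L" and lim: "(\<lambda>n. \<integral>\<omega>. (norm (S (i n) \<omega> - L \<omega>))\<^sup>2 \<partial>M) \<longlonglongrightarrow> 0"
    by (auto simp: ms_tendsto_def)
  have "((\<lambda>j. \<integral>\<omega>. (norm (S j \<omega> - L \<omega>))\<^sup>2 \<partial>M) \<longlongrightarrow> 0) F"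
  proof (rule tendstoI)
    fix e :: real assume e: "e > 0"
    \<comment> \<open>The triangle inequality for squared norms carries a factor 2 on both terms,
      hence quarters: \<open>2 * e / 4 + 2 * e / 4 = e\<close>.\<close>
    obtain N where N: "1 / real (Suc N) < e / 4" using small[of "e/4"] e by auto
    have "\<forall>\<^sub>F n in sequentially. (\<integral>\<omega>. (norm (S (i n) \<omega> - L \<omega>))\<^sup>2 \<partial>M) < e / 4 \<and> n \<ge> N"
      using order_tendstoD(2)[OF lim, of "e/4"] e eventually_ge_at_top[of N] by (auto intro: eventually_conj)
    then obtain n where n: "(\<integral>\<omega>. (norm (S (i n) \<omega> - L \<omega>))\<^sup>2 \<partial>M) < e / 4" "n \<ge> N"
      using eventually_happens'[OF sequentially_bot] by blast
    show "\<forall>\<^sub>F j in F. dist (\<integral>\<omega>. (norm (S j \<omega> - L \<omega>))\<^sup>2 \<partial>M) 0 < e"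
      using ev[of N]
    proof eventually_elim
      case (elim j)
      show ?case
        using P[OF elim i[OF n(2)]] n(1) N L2_rv_square_triangle[OF L2 L2 L2L, of j "i n"]
        by simp
    qed
  qed
  then show ?thesis using L2 L2L by (auto simp: ms_tendsto_def)
qed

end

subsection \<open>Riemann integrals\<close>

lemma fine_ball_mono:
  assumes "(\<lambda>x. ball x d) fine p" "d \<le> e"
  shows "(\<lambda>x. ball x e) fine p"
  using assms subset_ball[OF assms(2)] unfolding fine_def by blast

lemma eventually_riemann_filter:
  "eventually P (riemann_filter a b) \<longleftrightarrow>
     (\<exists>d>0. \<forall>p. p tagged_division_of {a..b} \<longrightarrow> (\<lambda>x. ball x d) fine p \<longrightarrow> P p)"
proof -
  have "\<exists>x\<in>{0<..}. principal {p. p tagged_division_of {a..b} \<and> (\<lambda>y. ball y x) fine p}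
      \<le> inf (principal {p. p tagged_division_of {a..b} \<and> (\<lambda>y. ball y d) fine p})
            (principal {p. p tagged_division_of {a..b} \<and> (\<lambda>y. ball y e) fine p})"
    if "d > 0" "e > 0" for d e :: real
    using that by (intro bexI[of _ "min d e"]) (auto elim: fine_ball_mono)
  then show ?thesis
    unfolding riemann_filter_def
    by (subst eventually_INF_base) (auto simp: eventually_principal)
qed

text \<open>Cousin's lemma: every gauge has a fine tagged division. Uniqueness of limits and
  completeness along this filter depend on it.\<close>

lemma riemann_filter_nontrivial: "riemann_filter a b \<noteq> bot"
proof
  assume "riemann_filter a b = bot"
  then have "eventually (\<lambda>_. False) (riemann_filter a b)" by simp
  then obtain d where "d > 0"
    and d: "\<forall>p. p tagged_division_of {a..b} \<longrightarrow> (\<lambda>x. ball x d) fine p \<longrightarrow> False"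
    unfolding eventually_riemann_filter by blast
  then show False
    using fine_division_exists_real[of "\<lambda>x. ball x d" a b] by (metis gauge_ball)
qed

lemma improper_filter_nontrivial: "(at_bot :: real filter) \<times>\<^sub>F (at_top :: real filter) \<noteq> bot"
  by (simp add: prod_filter_eq_bot)

text \<open>A constant gauge is a gauge, so the Riemann integral is a case of the gauge integral.
  This transports limits of Riemann sums to \<open>integral\<close>.\<close>

lemma has_riemann_integral_imp_has_integral:
  assumes "has_riemann_integral h I a b"
  shows "(h has_integral I) {a..b}"
  unfolding box_real(2)[symmetric] has_integral
proof (intro allI impI)
  fix e :: real assume "e > 0"
  then have "\<forall>\<^sub>F p in riemann_filter a b. dist (\<Sum>(x, K)\<in>p. measure lborel K *\<^sub>R h x) I < e"
    using assms tendstoD unfolding has_riemann_integral_def by blast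
  then obtain d where "d > 0" and d: "\<And>p. p tagged_division_of {a..b} \<Longrightarrow> (\<lambda>x. ball x d) fine p \<Longrightarrow>
      dist (\<Sum>(x, K)\<in>p. measure lborel K *\<^sub>R h x) I < e"
    by (auto simp: eventually_riemann_filter)
  then show "\<exists>\<gamma>. gauge \<gamma> \<and> (\<forall>\<D>. \<D> tagged_division_of cbox a b \<and> \<gamma> fine \<D> \<longrightarrow>
      norm ((\<Sum>(x, k)\<in>\<D>. measure lborel k *\<^sub>R h x) - I) < e)"
    by (intro exI[of _ "\<lambda>x. ball x d"]) (auto simp: dist_norm)
qed

lemma has_improper_riemann_integral_imp_has_integral:
  fixes h :: "real \<Rightarrow> 'b::banach"
  assumes "has_improper_riemann_integral h I"
  shows "(h has_integral I) UNIV"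
proof -
  obtain J where J: "\<And>a b. has_riemann_integral h (J a b) a b"
    and lim: "((\<lambda>(a, b). J a b) \<longlongrightarrow> I) (at_bot \<times>\<^sub>F at_top)"
    using assms by (auto simp: has_improper_riemann_integral_def)
  note hi = has_riemann_integral_imp_has_integral[OF J]
  show ?thesis
    unfolding has_integral_alt'
  proof (intro conjI allI impI)
    fix a b :: real
    show "(\<lambda>x. if x \<in> UNIV then h x else 0) integrable_on cbox a b"
      using hi[of a b] by (auto simp: integrable_on_def)
  next
    fix e :: real assume "e > 0"
    then have "\<forall>\<^sub>F x in at_bot \<times>\<^sub>F at_top. dist (case x of (a, b) \<Rightarrow> J a b) I < e"
      using tendstoD[OF lim] by blast
    then obtain P Q where P: "eventually P at_bot" and Q: "eventually Q at_top"
      and PQ: "\<And>a b. P a \<Longrightarrow> Q b \<Longrightarrow> dist (J a b) I < e"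
      by (auto simp: eventually_prod_filter)
    obtain A where A: "\<And>a. a \<le> A \<Longrightarrow> P a" using P by (auto simp: eventually_at_bot_linorder)
    obtain B where B: "\<And>b. b \<ge> B \<Longrightarrow> Q b" using Q by (auto simp: eventually_at_top_linorder)
    \<comment> \<open>The ball is open; the extra 1 puts the two points of modulus
      \<open>max 1 (max \<bar>A\<bar> \<bar>B\<bar>)\<close> inside it, which forces a and b beyond
      A and B.\<close>
    define R where "R = max 1 (max \<bar>A\<bar> \<bar>B\<bar>) + 1"
    have "norm (integral (cbox a b) h - I) < e" if "ball 0 R \<subseteq> cbox a b" for a b
    proof -
      have "- (max 1 (max \<bar>A\<bar> \<bar>B\<bar>)) \<in> cbox a b" "max 1 (max \<bar>A\<bar> \<bar>B\<bar>) \<in> cbox a b"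
        using that by (auto simp: R_def subset_iff)
      then have "a \<le> - max 1 (max \<bar>A\<bar> \<bar>B\<bar>)" "max 1 (max \<bar>A\<bar> \<bar>B\<bar>) \<le> b" by auto
      then have "a \<le> A" "B \<le> b" by linarith+
      then show ?thesis
        using PQ[OF A B] integral_unique[OF hi[of a b]] by (simp add: dist_norm)
    qed
    moreover have "R > 0" by (simp add: R_def)
    ultimately show "\<exists>B>0. \<forall>a b. ball 0 B \<subseteq> cbox a b \<longrightarrow>
        norm (integral (cbox a b) (\<lambda>x. if x \<in> UNIV then h x else 0) - I) < e"
      by auto
  qed
qed

lemma tendsto_integral_improper:
  fixes h :: "real \<Rightarrow> 'b::banach"
  assumes "(h has_integral I) UNIV"
  shows "((\<lambda>(a, b). integral {a..b} h) \<longlongrightarrow> I) (at_bot \<times>\<^sub>F at_top)"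
proof (rule tendstoI)
  fix e :: real assume "e > 0"
  then obtain B where B: "B > 0"
    "\<And>a b. ball 0 B \<subseteq> cbox a b \<Longrightarrow> norm (integral (cbox a b) h - I) < e"
    using assms unfolding has_integral_alt' by auto
  have "eventually (\<lambda>a. a \<le> - B) at_bot" "eventually (\<lambda>b. b \<ge> B) at_top"
    by (auto simp: eventually_le_at_bot eventually_ge_at_top)
  moreover have "dist (integral {a..b} h) I < e" if "a \<le> - B" "b \<ge> B" for a b
  proof -
    have "ball 0 B \<subseteq> cbox a b" using that by (auto simp: dist_real_def)
    from B(2)[OF this] show ?thesis by (simp add: dist_norm)
  qed
  ultimately show "\<forall>\<^sub>F x in at_bot \<times>\<^sub>F at_top. dist (case x of (a, b) \<Rightarrow> integral {a..b} h) I < e"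
    unfolding eventually_prod_filter by (intro exI[of _ "\<lambda>a. a \<le> - B"] exI[of _ "\<lambda>b. b \<ge> B"]) auto
qed

lemma has_improper_riemann_integralI:
  fixes h :: "real \<Rightarrow> 'b::banach"
  assumes "\<And>a b. \<exists>J. has_riemann_integral h J a b" "(h has_integral I) UNIV"
  shows "has_improper_riemann_integral h I"
proof -
  obtain J where J: "\<And>a b. has_riemann_integral h (J a b) a b" using assms(1) by metis
  then have "J = (\<lambda>a b. integral {a..b} h)"
    using integral_unique[OF has_riemann_integral_imp_has_integral[OF J]] by (simp add: fun_eq_iff)
  then show ?thesis
    unfolding has_improper_riemann_integral_def
    using J tendsto_integral_improper[OF assms(2)] by (intro exI[of _ J]) simp
qed

lemma has_riemann_integral_const: "has_riemann_integral (\<lambda>_. c :: real) (measure lborel {a..b} * c) a b"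
proof -
  have "(\<Sum>(x, K)\<in>p. measure lborel K *\<^sub>R c) = measure lborel {a..b} * c" if "p tagged_division_of {a..b}" for p
    using additive_content_tagged_division[of p a b] that
    by (simp add: case_prod_beta sum_distrib_right[symmetric])
  then have "\<forall>\<^sub>F p in riemann_filter a b. (\<Sum>(x, K)\<in>p. measure lborel K *\<^sub>R c) = measure lborel {a..b} * c"
    unfolding eventually_riemann_filter by (intro exI[of _ 1]) auto
  then show ?thesis unfolding has_riemann_integral_def by (rule tendsto_eventually)
qed

text \<open>This takes the place of Fubini: the inner product with V is linear, hence passes through
  each Riemann sum, and is continuous in mean square.\<close>

lemma ms_has_riemann_integral_inner:
  fixes Z :: "real \<Rightarrow> 'a \<Rightarrow> 'b::euclidean_space"
  assumes Z: "\<And>x. L2_rv M (Z x)" and V: "L2_rv M V" and I: "ms_has_riemann_integral M Z I a b"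
  shows "has_riemann_integral (\<lambda>x. \<integral>\<omega>. Z x \<omega> \<bullet> V \<omega> \<partial>M) (\<integral>\<omega>. I \<omega> \<bullet> V \<omega> \<partial>M) a b"
proof -
  have eq: "(\<lambda>p. \<integral>\<omega>. (\<Sum>(x, K)\<in>p. measure lborel K *\<^sub>R Z x \<omega>) \<bullet> V \<omega> \<partial>M) =
    (\<lambda>p. \<Sum>(x, K)\<in>p. measure lborel K *\<^sub>R (\<integral>\<omega>. Z x \<omega> \<bullet> V \<omega> \<partial>M))"
    by (simp add: fun_eq_iff inner_sum_left case_prod_beta L2_rv_integrable_inner[OF Z V])
  show ?thesis
    unfolding has_riemann_integral_def eq[symmetric]
    by (rule ms_tendsto_inner[OF I[unfolded ms_has_riemann_integral_def] V])
qed

lemma ms_has_improper_riemann_integral_inner: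
  fixes Z :: "real \<Rightarrow> 'a \<Rightarrow> 'b::euclidean_space"
  assumes Z: "\<And>x. L2_rv M (Z x)" and V: "L2_rv M V"
    and I: "ms_has_improper_riemann_integral M Z I"
  shows "has_improper_riemann_integral (\<lambda>x. \<integral>\<omega>. Z x \<omega> \<bullet> V \<omega> \<partial>M) (\<integral>\<omega>. I \<omega> \<bullet> V \<omega> \<partial>M)"
proof -
  obtain J where J: "\<And>a b. ms_has_riemann_integral M Z (J a b) a b"
    and lim: "ms_tendsto M (\<lambda>(a, b). J a b) I (at_bot \<times>\<^sub>F at_top)"
    using I by (auto simp: ms_has_improper_riemann_integral_def)
  have "((\<lambda>(a, b). \<integral>\<omega>. J a b \<omega> \<bullet> V \<omega> \<partial>M) \<longlongrightarrow> (\<integral>\<omega>. I \<omega> \<bullet> V \<omega> \<partial>M)) (at_bot \<times>\<^sub>F at_top)"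
    using ms_tendsto_inner[OF lim V] by (simp add: case_prod_beta')
  then show ?thesis
    unfolding has_improper_riemann_integral_def
    using ms_has_riemann_integral_inner[OF Z V J]
    by (intro exI[of _ "\<lambda>a b. \<integral>\<omega>. J a b \<omega> \<bullet> V \<omega> \<partial>M"]) auto
qed

subsection \<open>Riemann integrability of products\<close>

text \<open>A cell inside a ball of radius \<open>d / 2\<close> about its old tag lies inside the
  ball of radius d about any of its points, so tags may be moved freely at the cost of halving the
  mesh.\<close>

lemma tagged_division_retag:
  fixes a b :: real and h :: "real \<Rightarrow> 'b::real_normed_vector"
  assumes p: "p tagged_division_of {a..b}" and fine: "(\<lambda>x. ball x (d / 2)) fine p"
    and t: "\<And>i. i \<in> p \<Longrightarrow> t i \<in> snd i"
  defines "q \<equiv> (\<lambda>i. (t i, snd i)) ` p"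
  shows "q tagged_division_of {a..b}" "(\<lambda>x. ball x d) fine q"
    "(\<Sum>(x, K)\<in>q. measure lborel K *\<^sub>R h x) = (\<Sum>i\<in>p. measure lborel (snd i) *\<^sub>R h (t i))"
proof -
  note P = p[unfolded tagged_division_of]
  show "q tagged_division_of {a..b}"
    unfolding tagged_division_of
  proof (intro conjI allI impI)
    show "finite q" using P by (simp add: q_def)
  next
    fix x K assume "(x, K) \<in> q"
    then obtain i where "i \<in> p" "x = t i" "K = snd i" by (auto simp: q_def)
    then show "x \<in> K" "K \<subseteq> {a..b}" "\<exists>a b. K = cbox a b"
      using P t by (metis prod.collapse)+
  next
    fix x1 K1 x2 K2 assume "(x1, K1) \<in> q \<and> (x2, K2) \<in> q \<and> (x1, K1) \<noteq> (x2, K2)"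
    then obtain i j where ij: "i \<in> p" "j \<in> p" "K1 = snd i" "K2 = snd j" "i \<noteq> j"
      by (auto simp: q_def)
    then have "(fst i, snd i) \<in> p \<and> (fst j, snd j) \<in> p \<and> (fst i, snd i) \<noteq> (fst j, snd j)"
      by (simp add: prod_eq_iff)
    then show "interior K1 \<inter> interior K2 = {}" using P unfolding ij(3,4) by blast
  next
    have "{K. \<exists>x. (x, K) \<in> q} = {K. \<exists>x. (x, K) \<in> p}" by (force simp: q_def)
    then show "\<Union>{K. \<exists>x. (x, K) \<in> q} = {a..b}" using P by simp
  qed
  show "(\<lambda>x. ball x d) fine q"
  proof (rule fineI)
    fix x K assume "(x, K) \<in> q"
    then obtain i where i: "i \<in> p" "x = t i" "K = snd i" by (auto simp: q_def)
    have K: "K \<subseteq> ball (fst i) (d / 2)" using fine i unfolding fine_def by (cases i) auto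
    show "K \<subseteq> ball x d"
    proof
      fix y assume "y \<in> K"
      then show "y \<in> ball x d"
        using K t[OF i(1)] i(2,3) dist_triangle_half_r[of "fst i" x d y] by (auto simp: subset_iff)
    qed
  qed
  \<comment> \<open>Distinct members of p have cells with disjoint interiors. If they share a cell
    it is degenerate, so pairs merged by the image contribute nothing to the sum.\<close>
  have "i = j" if ij: "i \<in> p" "j \<in> p" "snd i = snd j" "measure lborel (snd i) \<noteq> 0" for i j
  proof (rule ccontr)
    assume "i \<noteq> j"
    then have "(fst i, snd i) \<in> p \<and> (fst j, snd j) \<in> p \<and> (fst i, snd i) \<noteq> (fst j, snd j)"
      using ij(1,2) \<open>i \<noteq> j\<close> by simp
    then have "interior (snd i) \<inter> interior (snd j) = {}" using P by blast
    moreover have "(fst i, snd i) \<in> p" using ij(1) by simp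
    then obtain u v where "snd i = cbox u v" using tagged_division_ofD(4)[OF p] by blast
    ultimately show False using ij(3,4) content_eq_0_interior[of u v] by simp
  qed
  then have "(\<lambda>(x, K). measure lborel K *\<^sub>R h x) (t i, snd i) = 0"
    if "i \<in> p" "j \<in> p" "i \<noteq> j" "(t i, snd i) = (t j, snd j)" for i j
    using that by (cases "measure lborel (snd i) = 0") auto
  then show "(\<Sum>(x, K)\<in>q. measure lborel K *\<^sub>R h x) = (\<Sum>i\<in>p. measure lborel (snd i) *\<^sub>R h (t i))"
    unfolding q_def using tagged_division_ofD(1)[OF p]
    by (subst sum.reindex_nontrivial) (simp_all only: o_def prod.case)
qed

text \<open>Tagging every cell by whichever of the two points has the larger value, and again by the
  other, gives two Riemann sums near I whose difference is the sum of absolute differences.\<close>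

lemma has_riemann_integral_oscillation:
  fixes h :: "real \<Rightarrow> real"
  assumes h: "has_riemann_integral h I a b" and e: "e > 0"
  obtains d where "d > 0"
    "\<And>p t. p tagged_division_of {a..b} \<Longrightarrow> (\<lambda>x. ball x d) fine p \<Longrightarrow> (\<And>i. i \<in> p \<Longrightarrow> t i \<in> snd i) \<Longrightarrow>
       (\<Sum>i\<in>p. measure lborel (snd i) * \<bar>h (fst i) - h (t i)\<bar>) < e"
proof -
  have "\<forall>\<^sub>F p in riemann_filter a b. dist (\<Sum>(x, K)\<in>p. measure lborel K *\<^sub>R h x) I < e / 2"
    using h tendstoD[of _ I _ "e/2"] e unfolding has_riemann_integral_def by simp
  then obtain d where "d > 0" and d: "\<And>p. p tagged_division_of {a..b} \<Longrightarrow> (\<lambda>x. ball x d) fine p \<Longrightarrow>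
      dist (\<Sum>(x, K)\<in>p. measure lborel K *\<^sub>R h x) I < e / 2"
    by (auto simp: eventually_riemann_filter)
  have "(\<Sum>i\<in>p. measure lborel (snd i) * \<bar>h (fst i) - h (t i)\<bar>) < e"
    if p: "p tagged_division_of {a..b}" and fine: "(\<lambda>x. ball x (d/2)) fine p"
      and t: "\<And>i. i \<in> p \<Longrightarrow> t i \<in> snd i" for p t
  proof -
    define s1 where "s1 i = (if h (fst i) \<ge> h (t i) then fst i else t i)" for i
    define s2 where "s2 i = (if h (fst i) \<ge> h (t i) then t i else fst i)" for i
    have "fst i \<in> snd i" if "i \<in> p" for i
      using p that by (metis prod.collapse tagged_division_of)
    then have s: "s1 i \<in> snd i" "s2 i \<in> snd i" if "i \<in> p" for i
      using that t by (auto simp: s1_def s2_def)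
    have "(\<Sum>i\<in>p. measure lborel (snd i) * \<bar>h (fst i) - h (t i)\<bar>) =
       (\<Sum>i\<in>p. measure lborel (snd i) *\<^sub>R h (s1 i)) - (\<Sum>i\<in>p. measure lborel (snd i) *\<^sub>R h (s2 i))"
      unfolding sum_subtractf[symmetric]
      by (rule sum.cong) (auto simp: s1_def s2_def algebra_simps)
    also have "\<dots> < e"
    proof -
      have "dist (\<Sum>i\<in>p. measure lborel (snd i) *\<^sub>R h (u i)) I < e / 2"
        if u: "\<And>i. i \<in> p \<Longrightarrow> u i \<in> snd i" for u
      proof -
        have "(\<Sum>i\<in>p. measure lborel (snd i) *\<^sub>R h (u i)) =
            (\<Sum>(x, K)\<in>(\<lambda>i. (u i, snd i)) ` p. measure lborel K *\<^sub>R h x)"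
          by (rule tagged_division_retag(3)[OF p fine, symmetric]) (rule u)
        moreover have "dist (\<Sum>(x, K)\<in>(\<lambda>i. (u i, snd i)) ` p. measure lborel K *\<^sub>R h x) I < e / 2"
          using u by (intro d tagged_division_retag(1,2)[OF p fine])
        ultimately show ?thesis by simp
      qed
      from this[of s1] this[of s2] s show ?thesis
        unfolding dist_real_def by (simp add: abs_if split: if_splits)
    qed
    finally show ?thesis .
  qed
  then show ?thesis using that[of "d / 2"] \<open>d > 0\<close> by simp
qed

text \<open>Moving the single tag of the cell around x to x changes the Riemann sum by the length of
  the cell times the change of h. The oscillation bound 1 therefore controls \<open>h x\<close> in
  terms of one fixed division.\<close>

lemma has_riemann_integral_bounded:
  fixes h :: "real \<Rightarrow> real"
  assumes h: "has_riemann_integral h I a b"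
  obtains G where "G \<ge> 0" "\<And>x. x \<in> {a..b} \<Longrightarrow> \<bar>h x\<bar> \<le> G"
proof (cases "a < b")
  case False
  then show ?thesis using that[of "\<bar>h a\<bar>"] by (cases "a = b") auto
next
  case True
  obtain d where "d > 0" and d: "\<And>p t. p tagged_division_of {a..b} \<Longrightarrow> (\<lambda>x. ball x d) fine p \<Longrightarrow>
      (\<And>i. i \<in> p \<Longrightarrow> t i \<in> snd i) \<Longrightarrow> (\<Sum>i\<in>p. measure lborel (snd i) * \<bar>h (fst i) - h (t i)\<bar>) < 1"
    using has_riemann_integral_oscillation[OF h zero_less_one] by blast
  obtain p where p: "p tagged_division_of {a..b}" "(\<lambda>x. ball x d) fine p"
    using fine_division_exists_real[of "\<lambda>x. ball x d" a b] \<open>d > 0\<close> by auto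
  note P = p(1)[unfolded tagged_division_of]
  \<comment> \<open>The sum over all cells serves as a common bound; degenerate cells contribute a
    nonnegative term since \<open>1 / 0 = 0\<close>.\<close>
  define G where "G = (\<Sum>i\<in>p. \<bar>h (fst i)\<bar> + 1 / measure lborel (snd i))"
  have "\<bar>h x\<bar> \<le> G" if x: "x \<in> {a..b}" for x
  proof -
    \<comment> \<open>The cell containing x must have positive length for the division by it below;
      for \<open>a < b\<close> such cells already cover the interval.\<close>
    have "{K \<in> snd ` p. measure lborel K \<noteq> 0} division_of cbox a b"
      using division_of_nontrivial[OF division_of_tagged_division[of p "cbox a b"]] p(1) True by simp
    then have "x \<in> \<Union>{K \<in> snd ` p. measure lborel K \<noteq> 0}"
      using x by (metis box_real(2) division_ofD(6))
    then obtain i where i: "i \<in> p" "x \<in> snd i" "measure lborel (snd i) \<noteq> 0" by auto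
    define w where "w = measure lborel (snd i)"
    have w: "w > 0" using i(3) by (simp add: w_def less_le measure_nonneg)
    define t where "t j = (if j = i then x else fst j)" for j
    have t: "t j \<in> snd j" if "j \<in> p" for j
      using that i P by (cases j) (auto simp: t_def)
    have "w * \<bar>h (fst i) - h x\<bar> = w * \<bar>h (fst i) - h (t i)\<bar>" by (simp add: t_def)
    also have "\<dots> \<le> (\<Sum>j\<in>p. measure lborel (snd j) * \<bar>h (fst j) - h (t j)\<bar>)"
      unfolding w_def using P i(1)
      by (intro member_le_sum[where f = "\<lambda>j. measure lborel (snd j) * \<bar>h (fst j) - h (t j)\<bar>"]) auto
    also have "\<dots> < 1" by (rule d[OF p t])
    finally have "\<bar>h (fst i) - h x\<bar> < 1 / w" using w by (simp add: field_simps)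
    then have "\<bar>h x\<bar> \<le> \<bar>h (fst i)\<bar> + 1 / w" by linarith
    also have "\<dots> \<le> G"
      unfolding w_def G_def using P i(1)
      by (intro member_le_sum[where f = "\<lambda>i. \<bar>h (fst i)\<bar> + 1 / measure lborel (snd i)"]) auto
    finally show ?thesis .
  qed
  moreover have "G \<ge> 0" unfolding G_def by (intro sum_nonneg) auto
  ultimately show ?thesis using that by blast
qed

text \<open>The indicator of L is integrated cell by cell, and the integral is additive over a
  tagged division.\<close>

lemma sum_content_Int_tagged_division:
  fixes a b :: real
  assumes p: "p tagged_division_of {a..b}" and L: "L = cbox c d" "L \<subseteq> {a..b}"
  shows "(\<Sum>i\<in>p. measure lborel (L \<inter> snd i)) = measure lborel L"
proof -
  let ?f = "\<lambda>x. if x \<in> L then 1 else 0 :: real"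
  have ind: "(?f has_integral measure lborel (L \<inter> K)) K" if K: "K = cbox u v" for K u v
  proof -
    obtain r s where LK: "L \<inter> K = cbox r s" unfolding L(1) K Int_interval by blast
    have "((\<lambda>_. 1 :: real) has_integral measure lborel (L \<inter> K)) (L \<inter> K)"
      unfolding LK using has_integral_const[of "1::real" r s] by simp
    then have "((\<lambda>x. if x \<in> L \<inter> K then 1 else 0 :: real) has_integral measure lborel (L \<inter> K)) K"
      by (simp only: has_integral_restrict[of "L \<inter> K" K] Int_lower2)
    then show ?thesis by (rule has_integral_eq[rotated]) simp
  qed
  have "(?f has_integral (\<Sum>(x,K)\<in>p. measure lborel (L \<inter> K))) {a..b}"
    using p by (intro has_integral_combine_tagged_division[OF p])
      (metis ind tagged_division_of)
  moreover have "(?f has_integral measure lborel (L \<inter> cbox a b)) {a..b}"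
    using ind[OF refl, of a b] by simp
  moreover have "L \<inter> cbox a b = L" using L by auto
  ultimately show ?thesis by (auto simp: case_prod_beta dest: has_integral_unique)
qed

text \<open>Cauchy-Schwarz with each weight split into two square roots.\<close>

lemma norm_square_weighted_sum_le:
  fixes D :: "'i \<Rightarrow> 'b::real_normed_vector"
  assumes "\<And>i. i \<in> A \<Longrightarrow> 0 \<le> w i"
  shows "(norm (\<Sum>i\<in>A. w i *\<^sub>R D i))\<^sup>2 \<le> sum w A * (\<Sum>i\<in>A. w i * (norm (D i))\<^sup>2)"
proof -
  have "norm (\<Sum>i\<in>A. w i *\<^sub>R D i) \<le> (\<Sum>i\<in>A. w i * norm (D i))"
    using assms by (intro sum_norm_le) auto
  then have "(norm (\<Sum>i\<in>A. w i *\<^sub>R D i))\<^sup>2 \<le> (\<Sum>i\<in>A. w i * norm (D i))\<^sup>2"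
    by (intro power_mono) auto
  also have "\<dots> = (\<Sum>i\<in>A. sqrt (w i) * (sqrt (w i) * norm (D i)))\<^sup>2"
    using assms by (intro arg_cong[where f = "\<lambda>x. x\<^sup>2"] sum.cong) (auto simp: mult.assoc[symmetric])
  also have "\<dots> \<le> (\<Sum>i\<in>A. (sqrt (w i))\<^sup>2) * (\<Sum>i\<in>A. (sqrt (w i) * norm (D i))\<^sup>2)"
    by (rule Cauchy_Schwarz_ineq_sum)
  also have "\<dots> = sum w A * (\<Sum>i\<in>A. w i * (norm (D i))\<^sup>2)"
    using assms by (intro arg_cong2[where f = "(*)"] sum.cong) (auto simp: power_mult_distrib)
  finally show ?thesis .
qed

text \<open>On the common refinement every piece has its own comparison point. Replacing all points
  within a cell of p by the worst one leaves a single tag per cell, and the lengths of the pieces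
  add up to that of the cell.\<close>

lemma oscillation_refinement:
  fixes h :: "real \<Rightarrow> real"
  assumes p: "p tagged_division_of {a..b}" and q: "q tagged_division_of {a..b}"
    and osc: "\<And>t. (\<And>i. i \<in> p \<Longrightarrow> t i \<in> snd i) \<Longrightarrow>
       (\<Sum>i\<in>p. measure lborel (snd i) * \<bar>h (fst i) - h (t i)\<bar>) < e"
    and z: "\<And>i j. i \<in> p \<Longrightarrow> j \<in> q \<Longrightarrow> measure lborel (snd i \<inter> snd j) \<noteq> 0 \<Longrightarrow> z i j \<in> snd i \<inter> snd j"
  shows "(\<Sum>i\<in>p. \<Sum>j\<in>q. measure lborel (snd i \<inter> snd j) * \<bar>h (fst i) - h (z i j)\<bar>) < e"
proof -
  note P = p[unfolded tagged_division_of] and Q = q[unfolded tagged_division_of]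
  have "\<exists>t\<in>snd i. \<forall>j\<in>q. measure lborel (snd i \<inter> snd j) \<noteq> 0 \<longrightarrow> \<bar>h (fst i) - h (z i j)\<bar> \<le> \<bar>h (fst i) - h t\<bar>"
    if i: "i \<in> p" for i
  proof -
    \<comment> \<open>Finitely many candidates, so the largest deviation is attained; the old tag
      makes the set nonempty.\<close>
    let ?C = "insert (fst i) (z i ` {j \<in> q. measure lborel (snd i \<inter> snd j) \<noteq> 0})"
    let ?f = "\<lambda>c. \<bar>h (fst i) - h c\<bar>"
    have fin: "finite (?f ` ?C)" using Q by simp
    then have "Max (?f ` ?C) \<in> ?f ` ?C" by (intro Max_in) auto
    then obtain t where t: "t \<in> ?C" "?f t = Max (?f ` ?C)" by (metis (no_types, lifting) imageE)
    have "?f c \<le> ?f t" if "c \<in> ?C" for c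
      unfolding t(2) using fin that by (intro Max_ge) auto
    moreover have "t \<in> snd i" using t(1) z[OF i] P i by (cases i) fastforce
    ultimately show ?thesis by blast
  qed
  then obtain t where t: "\<And>i. i \<in> p \<Longrightarrow> t i \<in> snd i"
    "\<And>i j. i \<in> p \<Longrightarrow> j \<in> q \<Longrightarrow> measure lborel (snd i \<inter> snd j) \<noteq> 0 \<Longrightarrow>
       \<bar>h (fst i) - h (z i j)\<bar> \<le> \<bar>h (fst i) - h (t i)\<bar>"
    by metis
  have "(\<Sum>i\<in>p. \<Sum>j\<in>q. measure lborel (snd i \<inter> snd j) * \<bar>h (fst i) - h (z i j)\<bar>) \<le>
     (\<Sum>i\<in>p. \<Sum>j\<in>q. measure lborel (snd i \<inter> snd j) * \<bar>h (fst i) - h (t i)\<bar>)"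
  proof (intro sum_mono)
    fix i j assume "i \<in> p" "j \<in> q"
    then show "measure lborel (snd i \<inter> snd j) * \<bar>h (fst i) - h (z i j)\<bar> \<le>
       measure lborel (snd i \<inter> snd j) * \<bar>h (fst i) - h (t i)\<bar>"
      using t(2)[of i j] by (cases "measure lborel (snd i \<inter> snd j) = 0") (auto intro: mult_left_mono)
  qed
  also have "\<dots> = (\<Sum>i\<in>p. measure lborel (snd i) * \<bar>h (fst i) - h (t i)\<bar>)"
  proof (rule sum.cong)
    fix i assume i: "i \<in> p"
    then obtain c d where "snd i = cbox c d" "snd i \<subseteq> {a..b}"
      using tagged_division_ofD(3,4)[OF p, of "fst i" "snd i"] by (metis prod.collapse)
    then show "(\<Sum>j\<in>q. measure lborel (snd i \<inter> snd j) * \<bar>h (fst i) - h (t i)\<bar>) =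
        measure lborel (snd i) * \<bar>h (fst i) - h (t i)\<bar>"
      using sum_content_Int_tagged_division[OF q] by (simp add: sum_distrib_right[symmetric])
  qed simp
  also have "\<dots> < e" by (rule osc[OF t(1)])
  finally show ?thesis .
qed

text \<open>Cauchy criterion. Both Riemann sums are rewritten over the intersections of the cells of
  p and q. There \<open>h x Z x - h y Z y\<close> splits into \<open>(h x - h y) Z x\<close>,
  controlled by the oscillation of h, and \<open>h y (Z x - Z y)\<close>, controlled by mean-square
  continuity.\<close>

lemma (in prob_space) ms_riemann_integrable:
  fixes h :: "real \<Rightarrow> real" and Z :: "real \<Rightarrow> 'a \<Rightarrow> 'b::euclidean_space"
  assumes h: "has_riemann_integral h I a b" and Z: "\<And>x. L2_rv M (Z x)"
    and B: "B \<ge> 0" "\<And>x. x \<in> {a..b} \<Longrightarrow> (\<integral>\<omega>. (norm (Z x \<omega>))\<^sup>2 \<partial>M) \<le> B"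
    and cont: "\<And>e. e > 0 \<Longrightarrow> \<exists>d>0. \<forall>x\<in>{a..b}. \<forall>y\<in>{a..b}. \<bar>x - y\<bar> < d \<longrightarrow>
       (\<integral>\<omega>. (norm (Z x \<omega> - Z y \<omega>))\<^sup>2 \<partial>M) < e"
  shows "\<exists>J. ms_has_riemann_integral M (\<lambda>x \<omega>. h x *\<^sub>R Z x \<omega>) J a b"
proof -
  define S where "S p \<omega> = (\<Sum>(x, K)\<in>p. measure lborel K *\<^sub>R (h x *\<^sub>R Z x \<omega>))"
    for p :: "(real \<times> real set) set" and \<omega>
  have L2S: "L2_rv M (S p)" for p
    unfolding S_def case_prod_beta by (intro L2_rv_sum L2_rv_scaleR Z)
  obtain G where G: "G \<ge> 0" "\<And>x. x \<in> {a..b} \<Longrightarrow> \<bar>h x\<bar> \<le> G"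
    using has_riemann_integral_bounded[OF h] by blast
  define L where "L = measure lborel {a..b}"
  have L0: "L \<ge> 0" by (simp add: L_def)
  have "\<exists>P. eventually P (riemann_filter a b) \<and>
      (\<forall>p q. P p \<longrightarrow> P q \<longrightarrow> (\<integral>\<omega>. (norm (S p \<omega> - S q \<omega>))\<^sup>2 \<partial>M) < e)" if e: "e > 0" for e
  proof -
    \<comment> \<open>C1 and C2 bound the coefficients of the oscillation of h and of
      \<open>e2\<close> in the final estimate; the summand 1 keeps them positive. The total is
      \<open>C1 * (2 * e1) + C2 * e2 = e / 2 + e / 4\<close>.\<close>
    define C1 where "C1 = L * (4 * B * G) + 1"
    define C2 where "C2 = L * (2 * G\<^sup>2) * L + 1"
    define e1 where "e1 = e / (4 * C1)"
    define e2 where "e2 = e / (4 * C2)"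
    have C: "C1 > 0" "C2 > 0" using L0 B(1) G(1) by (simp_all add: C1_def C2_def add_nonneg_pos)
    then have e12: "e1 > 0" "e2 > 0" using e by (simp_all add: e1_def e2_def)
    obtain d1 where d1: "d1 > 0"
      "\<And>p t. p tagged_division_of {a..b} \<Longrightarrow> (\<lambda>x. ball x d1) fine p \<Longrightarrow> (\<And>i. i \<in> p \<Longrightarrow> t i \<in> snd i) \<Longrightarrow>
        (\<Sum>i\<in>p. measure lborel (snd i) * \<bar>h (fst i) - h (t i)\<bar>) < e1"
      using has_riemann_integral_oscillation[OF h e12(1)] by blast
    obtain d2 where d2: "d2 > 0" "\<And>x y. x \<in> {a..b} \<Longrightarrow> y \<in> {a..b} \<Longrightarrow> \<bar>x - y\<bar> < d2 \<Longrightarrow>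
        (\<integral>\<omega>. (norm (Z x \<omega> - Z y \<omega>))\<^sup>2 \<partial>M) < e2"
      using cont[OF e12(2)] by blast
    \<comment> \<open>Tags of overlapping cells are both within d of a common point, hence within
      \<open>2 * d\<close> of each other.\<close>
    define d where "d = min d1 (d2 / 2)"
    have "(\<integral>\<omega>. (norm (S p \<omega> - S q \<omega>))\<^sup>2 \<partial>M) < e"
      if p: "p tagged_division_of {a..b}" "(\<lambda>x. ball x d) fine p"
        and q: "q tagged_division_of {a..b}" "(\<lambda>x. ball x d) fine q" for p q
    proof -
      note P = p(1)[unfolded tagged_division_of] and Q = q(1)[unfolded tagged_division_of]
      have fine1: "(\<lambda>x. ball x d1) fine p" "(\<lambda>x. ball x d1) fine q"
        using p(2) q(2) by (auto simp: d_def elim: fine_ball_mono)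
      define w where "w = (\<lambda>(i :: real \<times> real set, j :: real \<times> real set). measure lborel (snd i \<inter> snd j))"
      define D where "D = (\<lambda>(i :: real \<times> real set, j :: real \<times> real set) \<omega>.
         h (fst i) *\<^sub>R Z (fst i) \<omega> - h (fst j) *\<^sub>R Z (fst j) \<omega>)"
      have w0: "w ij \<ge> 0" for ij by (simp add: w_def case_prod_beta)
      have L2D: "L2_rv M (D ij)" for ij
        unfolding D_def case_prod_beta by (intro L2_rv_diff L2_rv_scaleR Z)
      have wp: "(\<Sum>j\<in>q. w (i, j)) = measure lborel (snd i)" if "i \<in> p" for i
      proof -
        have "(fst i, snd i) \<in> p" using that by simp
        then obtain u v where "snd i = cbox u v" "snd i \<subseteq> {a..b}"
          using tagged_division_ofD(3,4)[OF p(1)] by meson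
        then show ?thesis by (simp add: w_def sum_content_Int_tagged_division[OF q(1)])
      qed
      have wq: "(\<Sum>i\<in>p. w (i, j)) = measure lborel (snd j)" if "j \<in> q" for j
      proof -
        have "(fst j, snd j) \<in> q" using that by simp
        then obtain u v where "snd j = cbox u v" "snd j \<subseteq> {a..b}"
          using tagged_division_ofD(3,4)[OF q(1)] by meson
        then have "(\<Sum>i\<in>p. measure lborel (snd j \<inter> snd i)) = measure lborel (snd j)"
          by (rule sum_content_Int_tagged_division[OF p(1)])
        then show ?thesis by (simp add: w_def Int_commute)
      qed
      have wsum: "sum w (p \<times> q) = L"
      proof -
        have "sum w (p \<times> q) = (\<Sum>i\<in>p. \<Sum>j\<in>q. w (i, j))" by (simp add: sum.cartesian_product)
        also have "\<dots> = (\<Sum>i\<in>p. measure lborel (snd i))" by (simp add: wp)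
        also have "\<dots> = (\<Sum>i\<in>p. measure lborel ({a..b} \<inter> snd i))"
          using tagged_division_ofD(3)[OF p(1)]
          by (intro sum.cong refl arg_cong[where f = "measure lborel"]) (metis inf.absorb2 prod.collapse)
        also have "\<dots> = L"
          unfolding L_def by (rule sum_content_Int_tagged_division[OF p(1), of _ a b]) auto
        finally show ?thesis .
      qed
      have Sdiff: "S p \<omega> - S q \<omega> = (\<Sum>ij\<in>p\<times>q. w ij *\<^sub>R D ij \<omega>)" for \<omega>
      proof -
        have "S p \<omega> = (\<Sum>i\<in>p. \<Sum>j\<in>q. w (i, j) *\<^sub>R (h (fst i) *\<^sub>R Z (fst i) \<omega>))"
          unfolding S_def case_prod_beta
          by (intro sum.cong refl) (simp add: scaleR_sum_left[symmetric] wp sum_distrib_right[symmetric])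
        moreover have "S q \<omega> = (\<Sum>i\<in>p. \<Sum>j\<in>q. w (i, j) *\<^sub>R (h (fst j) *\<^sub>R Z (fst j) \<omega>))"
          unfolding S_def case_prod_beta
          by (subst sum.swap, intro sum.cong refl)
             (simp add: scaleR_sum_left[symmetric] wq sum_distrib_right[symmetric])
        ultimately show ?thesis
          by (simp add: sum_subtractf[symmetric] sum.cartesian_product scaleR_diff_right D_def
              case_prod_beta)
      qed
      have EDij: "w (i, j) * (\<integral>\<omega>. (norm (D (i, j) \<omega>))\<^sup>2 \<partial>M) \<le>
          w (i, j) * (4 * B * G * \<bar>h (fst i) - h (fst j)\<bar> + 2 * G\<^sup>2 * e2)"
        if ij: "i \<in> p" "j \<in> q" for i j
      proof (cases "w (i, j) = 0")
        case False
        define x where "x = fst i" define y where "y = fst j"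
        have mem: "(x, snd i) \<in> p" "(y, snd j) \<in> q" using ij by (simp_all add: x_def y_def)
        have xy: "x \<in> {a..b}" "y \<in> {a..b}"
          using tagged_division_ofD(2,3)[OF p(1) mem(1)] tagged_division_ofD(2,3)[OF q(1) mem(2)] by auto
        from False have "snd i \<inter> snd j \<noteq> {}" by (auto simp: w_def)
        then obtain z where z: "z \<in> snd i" "z \<in> snd j" by blast
        then have "dist x z < d" "dist y z < d"
          using fineD[OF p(2) mem(1)] fineD[OF q(2) mem(2)] by (auto simp: subset_iff)
        then have "\<bar>x - y\<bar> < d2" unfolding d_def dist_real_def by linarith
        from d2(2)[OF xy this] have Zxy: "(\<integral>\<omega>. (norm (Z x \<omega> - Z y \<omega>))\<^sup>2 \<partial>M) \<le> e2" by simp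
        have "(\<integral>\<omega>. (norm (D (i, j) \<omega>))\<^sup>2 \<partial>M) \<le>
           2 * (\<integral>\<omega>. (norm (h x *\<^sub>R Z x \<omega> - h y *\<^sub>R Z x \<omega>))\<^sup>2 \<partial>M) +
           2 * (\<integral>\<omega>. (norm (h y *\<^sub>R Z x \<omega> - h y *\<^sub>R Z y \<omega>))\<^sup>2 \<partial>M)"
          unfolding D_def x_def y_def prod.case by (intro L2_rv_square_triangle L2_rv_scaleR Z)
        also have "\<dots> = 2 * ((h x - h y)\<^sup>2 * (\<integral>\<omega>. (norm (Z x \<omega>))\<^sup>2 \<partial>M)) +
           2 * ((h y)\<^sup>2 * (\<integral>\<omega>. (norm (Z x \<omega> - Z y \<omega>))\<^sup>2 \<partial>M))"
          by (simp add: scaleR_diff_left[symmetric] scaleR_diff_right[symmetric] power_mult_distrib)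
        also have "\<dots> \<le> 2 * (2 * G * \<bar>h x - h y\<bar> * B) + 2 * (G\<^sup>2 * e2)"
        proof (intro add_mono mult_left_mono mult_mono B(2) xy Zxy)
          \<comment> \<open>Only the first power of the difference is controlled by the oscillation,
            so one factor is spent on the bound \<open>2 * G\<close>.\<close>
          have "\<bar>h x - h y\<bar> * \<bar>h x - h y\<bar> \<le> 2 * G * \<bar>h x - h y\<bar>"
            using G(2)[OF xy(1)] G(2)[OF xy(2)] by (intro mult_right_mono) auto
          then show "(h x - h y)\<^sup>2 \<le> 2 * G * \<bar>h x - h y\<bar>" by (simp add: power2_eq_square abs_mult[symmetric])
          show "(h y)\<^sup>2 \<le> G\<^sup>2" using power_mono[OF G(2)[OF xy(2)], of 2] by simp
        qed (use G e12 in auto)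
        finally show ?thesis
          using w0[of "(i, j)"] unfolding x_def y_def by (intro mult_left_mono) (auto simp: algebra_simps)
      qed simp
      \<comment> \<open>Tags of p and q lie in different cells; a point common to both cells links
        them, and the oscillation estimate is applied once on each side.\<close>
      have "\<exists>z. z \<in> snd i \<inter> snd j" if "w (i, j) \<noteq> 0" for i j
        using that by (cases "snd i \<inter> snd j = {}") (auto simp: w_def)
      then obtain z where z: "\<And>i j. w (i, j) \<noteq> 0 \<Longrightarrow> z i j \<in> snd i \<inter> snd j" by metis
      have o1: "(\<Sum>i\<in>p. \<Sum>j\<in>q. w (i, j) * \<bar>h (fst i) - h (z i j)\<bar>) < e1"
        unfolding w_def prod.case
        by (rule oscillation_refinement[OF p(1) q(1) d1(2)[OF p(1) fine1(1)]])
           (use z in \<open>auto simp: w_def\<close>)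
      have "(\<Sum>j\<in>q. \<Sum>i\<in>p. measure lborel (snd j \<inter> snd i) * \<bar>h (fst j) - h (z i j)\<bar>) < e1"
        by (rule oscillation_refinement[OF q(1) p(1) d1(2)[OF q(1) fine1(2)]])
           (use z in \<open>auto simp: w_def Int_commute\<close>)
      then have o2: "(\<Sum>i\<in>p. \<Sum>j\<in>q. w (i, j) * \<bar>h (fst j) - h (z i j)\<bar>) < e1"
        by (subst (asm) sum.swap) (simp add: w_def Int_commute)
      have osc: "(\<Sum>i\<in>p. \<Sum>j\<in>q. w (i, j) * \<bar>h (fst i) - h (fst j)\<bar>) \<le> 2 * e1"
      proof -
        have "(\<Sum>i\<in>p. \<Sum>j\<in>q. w (i, j) * \<bar>h (fst i) - h (fst j)\<bar>) \<le>
          (\<Sum>i\<in>p. \<Sum>j\<in>q. w (i, j) * \<bar>h (fst i) - h (z i j)\<bar> + w (i, j) * \<bar>h (fst j) - h (z i j)\<bar>)"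
          unfolding distrib_left[symmetric] by (intro sum_mono mult_left_mono w0) linarith
        also have "\<dots> \<le> 2 * e1" unfolding sum.distrib using o1 o2 by linarith
        finally show ?thesis .
      qed
      have "(\<integral>\<omega>. (norm (S p \<omega> - S q \<omega>))\<^sup>2 \<partial>M) \<le>
          (\<integral>\<omega>. sum w (p \<times> q) * (\<Sum>ij\<in>p\<times>q. w ij * (norm (D ij \<omega>))\<^sup>2) \<partial>M)"
        unfolding Sdiff[symmetric]
        by (intro integral_mono L2_rvD(2)[OF L2_rv_diff[OF L2S L2S]] integrable_mult_right
            Bochner_Integration.integrable_sum L2_rvD(2)[OF L2D])
           (unfold Sdiff, rule norm_square_weighted_sum_le[OF w0])
      also have "\<dots> = L * (\<Sum>i\<in>p. \<Sum>j\<in>q. w (i, j) * (\<integral>\<omega>. (norm (D (i, j) \<omega>))\<^sup>2 \<partial>M))"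
        by (simp add: wsum L2_rvD(2)[OF L2D] sum.cartesian_product case_prod_beta)
      also have "\<dots> \<le> L * (\<Sum>i\<in>p. \<Sum>j\<in>q. w (i, j) * (4 * B * G * \<bar>h (fst i) - h (fst j)\<bar> + 2 * G\<^sup>2 * e2))"
        by (intro mult_left_mono sum_mono EDij L0)
      also have "\<dots> = L * (4 * B * G) * (\<Sum>i\<in>p. \<Sum>j\<in>q. w (i, j) * \<bar>h (fst i) - h (fst j)\<bar>)
          + L * (2 * G\<^sup>2) * sum w (p \<times> q) * e2"
        by (simp add: sum.distrib sum_distrib_left sum_distrib_right algebra_simps sum.cartesian_product case_prod_beta)
      also have "\<dots> \<le> C1 * (2 * e1) + C2 * e2"
      proof (intro add_mono mult_mono osc)
        show "0 \<le> (\<Sum>i\<in>p. \<Sum>j\<in>q. w (i, j) * \<bar>h (fst i) - h (fst j)\<bar>)"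
          by (intro sum_nonneg mult_nonneg_nonneg w0) simp
      qed (use C e12 wsum in \<open>auto simp: C1_def C2_def\<close>)
      also have "\<dots> < e" using C e by (simp add: e1_def e2_def)
      finally show ?thesis .
    qed
    moreover have "d > 0" using d1 d2 by (simp add: d_def)
    ultimately show ?thesis
      by (intro exI[of _ "\<lambda>p. p tagged_division_of {a..b} \<and> (\<lambda>x. ball x d) fine p"])
         (auto simp: eventually_riemann_filter)
  qed
  from L2_complete[OF riemann_filter_nontrivial L2S this]
  show ?thesis by (simp add: ms_has_riemann_integral_def S_def[abs_def])
qed

text \<open>The deterministic statement is the mean-square one over a one-point probability space.\<close>

lemma riemann_integrable_mult_continuous:
  fixes h c :: "real \<Rightarrow> real"
  assumes h: "has_riemann_integral h I a b" and c: "continuous_on {a..b} c"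
  shows "\<exists>J. has_riemann_integral (\<lambda>x. h x * c x) J a b"
proof -
  define M :: "unit measure" where "M = return (count_space UNIV) ()"
  interpret prob_space M unfolding M_def by (rule prob_space_return) simp
  have "compact (c ` {a..b})" using c by (intro compact_continuous_image) auto
  then obtain B where B: "\<And>x. x \<in> {a..b} \<Longrightarrow> \<bar>c x\<bar> \<le> B"
    using compact_imp_bounded[of "c ` {a..b}"] unfolding bounded_iff by (metis imageI real_norm_def)
  have uc: "uniformly_continuous_on {a..b} c"
    using c by (intro compact_uniformly_continuous) auto
  have "\<exists>J. ms_has_riemann_integral M (\<lambda>x \<omega>. h x *\<^sub>R c x) J a b"
  proof (rule ms_riemann_integrable[OF h, where B = "B\<^sup>2"])
    show "(\<integral>\<omega>. (norm (c x))\<^sup>2 \<partial>M) \<le> B\<^sup>2" if "x \<in> {a..b}" for x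
      using power_mono[OF B[OF that], of 2] by (simp add: prob_space)
    fix e :: real assume "e > 0"
    then obtain d where d: "d > 0"
      "\<And>x y. x \<in> {a..b} \<Longrightarrow> y \<in> {a..b} \<Longrightarrow> dist y x < d \<Longrightarrow> dist (c y) (c x) < sqrt e"
      using uc unfolding uniformly_continuous_on_def by (metis real_sqrt_gt_zero)
    have "(\<integral>\<omega>. (norm (c x - c y))\<^sup>2 \<partial>M) < e" if "x \<in> {a..b}" "y \<in> {a..b}" "\<bar>x - y\<bar> < d" for x y
    proof -
      have "\<bar>c x - c y\<bar> < sqrt e" using d(2)[of y x] that by (simp add: dist_real_def)
      then have "(c x - c y)\<^sup>2 < e"
        using \<open>e > 0\<close> real_less_rsqrt[of "\<bar>c x - c y\<bar>" e] real_sqrt_less_iff[of "(c x - c y)\<^sup>2" e] by simp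
      then show ?thesis by (simp add: prob_space)
    qed
    then show "\<exists>d>0. \<forall>x\<in>{a..b}. \<forall>y\<in>{a..b}. \<bar>x - y\<bar> < d \<longrightarrow> (\<integral>\<omega>. (norm (c x - c y))\<^sup>2 \<partial>M) < e"
      using d(1) by blast
  qed (auto simp: L2_rv_const)
  then obtain J where J: "ms_has_riemann_integral M (\<lambda>x \<omega>. h x *\<^sub>R c x) J a b" by blast
  have "has_riemann_integral (\<lambda>x. \<integral>\<omega>. (h x *\<^sub>R c x) \<bullet> 1 \<partial>M) (\<integral>\<omega>. J \<omega> \<bullet> 1 \<partial>M) a b"
    by (rule ms_has_riemann_integral_inner[OF L2_rv_const L2_rv_const J])
  then show ?thesis by (auto simp: prob_space)
qed

text \<open>Nonnegativity of h makes convergence absolute, so that \<open>h x * B\<close> dominates;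
  a conditionally convergent integral can be destroyed by a bounded continuous factor.\<close>

lemma improper_riemann_integrable_mult_continuous:
  fixes h c :: "real \<Rightarrow> real"
  assumes h: "has_improper_riemann_integral h I" "\<And>x. h x \<ge> 0"
    and c: "continuous_on UNIV c" "\<And>x. \<bar>c x\<bar> \<le> B"
  shows "\<exists>J. has_improper_riemann_integral (\<lambda>x. h x * c x) J"
proof -
  have ri: "\<exists>J. has_riemann_integral (\<lambda>x. h x * c x) J a b" for a b
    using h(1) riemann_integrable_mult_continuous[OF _ continuous_on_subset[OF c(1)]]
    unfolding has_improper_riemann_integral_def by blast
  have "(\<lambda>x. h x * c x) integrable_on UNIV"
  proof (rule integrable_on_all_intervals_integrable_bound[where g = "\<lambda>x. h x * B"])
    show "(\<lambda>x. if x \<in> UNIV then h x * c x else 0) integrable_on cbox a b" for a b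
      using ri[of a b] has_riemann_integral_imp_has_integral[of "\<lambda>x. h x * c x" _ a b]
      by (auto simp: integrable_on_def)
    show "norm (h x * c x) \<le> h x * B" for x
      using h(2)[of x] c(2)[of x] by (simp add: abs_mult mult_left_mono)
    show "(\<lambda>x. h x * B) integrable_on UNIV"
      using has_improper_riemann_integral_imp_has_integral[OF h(1)]
      by (intro integrable_on_mult_left) (auto simp: integrable_on_def)
  qed
  then obtain J where "((\<lambda>x. h x * c x) has_integral J) UNIV" by (auto simp: integrable_on_def)
  from has_improper_riemann_integralI[OF ri this] show ?thesis by blast
qed

subsection \<open>Circularly symmetric Gaussian variables\<close>

text \<open>One formula covers both kinds of Gaussian variable: a constant with mean 0 vanishes
  almost surely and has variance 0.\<close>

lemma (in prob_space) gaussian_rv_centered: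
  assumes Z: "gaussian_rv M Z" and mean: "expectation Z = 0"
  shows "L2_rv M Z"
    and "(\<integral>\<omega>. iexp (t * Z \<omega>) \<partial>M) = complex_of_real (exp (- t\<^sup>2 * (\<integral>\<omega>. (Z \<omega>)\<^sup>2 \<partial>M) / 2))"
proof -
  have [measurable]: "Z \<in> borel_measurable M" using Z by (simp add: gaussian_rv_def)
  consider (normal) m s where "0 < s" "distributed M lborel Z (normal_density m s)"
    | (const) m where "AE \<omega> in M. Z \<omega> = m"
    using Z by (auto simp: gaussian_rv_def)
  then have "L2_rv M Z \<and> (\<integral>\<omega>. iexp (t * Z \<omega>) \<partial>M) =
      complex_of_real (exp (- t\<^sup>2 * (\<integral>\<omega>. (Z \<omega>)\<^sup>2 \<partial>M) / 2))"
  proof cases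
    case normal
    have m: "m = 0" using normal_distributed_expectation[OF normal] mean by simp
    have var: "(\<integral>\<omega>. (Z \<omega>)\<^sup>2 \<partial>M) = s\<^sup>2"
      using normal_distributed_variance[OF normal] mean by simp
    have "integrable lborel (\<lambda>x. normal_density m s x * (x - m) ^ 2)"
      by (rule integrable_normal_moment[OF normal(1)])
    then have "integrable M (\<lambda>\<omega>. (Z \<omega>)\<^sup>2)"
      using distributed_integrable[OF normal(2), of "\<lambda>x. x\<^sup>2"] m by simp
    moreover have "(\<integral>\<omega>. iexp (t * Z \<omega>) \<partial>M) = complex_of_real (exp (- t\<^sup>2 * s\<^sup>2 / 2))"
    proof -
      \<comment> \<open>The characteristic function of \<open>Z / s\<close>, a standard normal
        variable, taken at \<open>t * s\<close> is that of Z at t.\<close>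
      have D: "distributed M lborel (\<lambda>\<omega>. Z \<omega> / s) std_normal_density"
        using normal_standard_normal_convert[OF normal(1), of Z m] normal(2) m by simp
      have "distr M borel (\<lambda>\<omega>. Z \<omega> / s) = std_normal_distribution"
        using distributed_distr_eq_density[OF D] by (simp cong: distr_cong)
      then have "char (distr M borel (\<lambda>\<omega>. Z \<omega> / s)) (t * s) = complex_of_real (exp (- (t * s)\<^sup>2 / 2))"
        by (simp add: char_std_normal_distribution)
      then show ?thesis
        using normal(1) by (simp add: char_def integral_distr power_mult_distrib mult.assoc)
    qed
    ultimately show ?thesis by (simp add: L2_rv_def var)
  next
    case const
    have "expectation Z = m" using integral_cong_AE[of Z M "\<lambda>_. m"] const by (simp add: prob_space)
    then have ae: "AE \<omega> in M. Z \<omega> = 0" using const mean by simp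
    have "(\<integral>\<omega>. (Z \<omega>)\<^sup>2 \<partial>M) = (\<integral>\<omega>. 0 \<partial>M)"
      by (rule integral_cong_AE) (use ae in auto)
    moreover have "(\<integral>\<omega>. iexp (t * Z \<omega>) \<partial>M) = (\<integral>\<omega>. 1 \<partial>M)"
      by (rule integral_cong_AE) (use ae in auto)
    moreover have "integrable M (\<lambda>\<omega>. (Z \<omega>)\<^sup>2)"
    proof -
      have "integrable M (\<lambda>\<omega>. 0 :: real) = integrable M (\<lambda>\<omega>. (Z \<omega>)\<^sup>2)"
        using ae by (intro integrable_cong_AE) auto
      then show ?thesis by simp
    qed
    ultimately show ?thesis by (simp add: L2_rv_def prob_space)
  qed
  then show "L2_rv M Z" "(\<integral>\<omega>. iexp (t * Z \<omega>) \<partial>M) =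
      complex_of_real (exp (- t\<^sup>2 * (\<integral>\<omega>. (Z \<omega>)\<^sup>2 \<partial>M) / 2))"
    by auto
qed

text \<open>Stated through the characteristic function so that the zero variable is included and
  limits are easy. Real and imaginary part each carry half of the second moment, whence the 4 in
  place of 2.\<close>

definition circular_gaussian :: "'a measure \<Rightarrow> ('a \<Rightarrow> complex) \<Rightarrow> bool" where
  "circular_gaussian M Z \<longleftrightarrow> L2_rv M Z \<and>
     (\<forall>a b. (\<integral>\<omega>. iexp (a * Re (Z \<omega>) + b * Im (Z \<omega>)) \<partial>M) =
        complex_of_real (exp (- (a\<^sup>2 + b\<^sup>2) * (\<integral>\<omega>. (cmod (Z \<omega>))\<^sup>2 \<partial>M) / 4)))"

lemma norm_iexp_diff_le: "cmod (iexp x - iexp y) \<le> \<bar>x - y\<bar>"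
proof -
  have "iexp x - iexp y = iexp y * (iexp (x - y) - 1)"
    by (simp add: algebra_simps exp_add[symmetric] flip: of_real_add)
  then have "cmod (iexp x - iexp y) = cmod (iexp (x - y) - 1)" by (simp add: norm_mult)
  also have "\<dots> \<le> \<bar>x - y\<bar>" using iexp_approx1[of "x - y" 0] by simp
  finally show ?thesis .
qed

text \<open>Both sides of the defining identity are continuous in mean square: the exponential is
  Lipschitz in Z, and second moments converge.\<close>

lemma (in prob_space) circular_gaussian_limit:
  assumes F: "F \<noteq> bot" and lim: "ms_tendsto M Z L F"
    and circ: "\<forall>\<^sub>F i in F. circular_gaussian M (Z i)"
  shows "circular_gaussian M L"
  unfolding circular_gaussian_def
proof (intro conjI allI)
  show L: "L2_rv M L" using lim by (simp add: ms_tendsto_def)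
  fix a b :: real
  define e where "e z = iexp (a * Re z + b * Im z)" for z
  have [measurable]: "e \<in> borel_measurable borel" unfolding e_def by measurable
  have int: "integrable M (\<lambda>\<omega>. e (V \<omega>))" if "L2_rv M V" for V
    using that unfolding L2_rv_def by (intro integrable_const_bound[where B = 1]) (auto simp: e_def)
  have "((\<lambda>i. (\<bar>a\<bar> + \<bar>b\<bar>) * sqrt (\<integral>\<omega>. (norm (Z i \<omega> - L \<omega>))\<^sup>2 \<partial>M)) \<longlongrightarrow> (\<bar>a\<bar> + \<bar>b\<bar>) * sqrt 0) F"
    using lim unfolding ms_tendsto_def by (intro tendsto_intros) auto
  then have lim0: "((\<lambda>i. (\<bar>a\<bar> + \<bar>b\<bar>) * sqrt (\<integral>\<omega>. (norm (Z i \<omega> - L \<omega>))\<^sup>2 \<partial>M)) \<longlongrightarrow> 0) F" by simp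
  have "((\<lambda>i. (\<integral>\<omega>. e (Z i \<omega>) \<partial>M) - (\<integral>\<omega>. e (L \<omega>) \<partial>M)) \<longlongrightarrow> 0) F"
  proof (rule Lim_null_comparison[OF _ lim0])
    show "\<forall>\<^sub>F i in F. norm ((\<integral>\<omega>. e (Z i \<omega>) \<partial>M) - (\<integral>\<omega>. e (L \<omega>) \<partial>M)) \<le>
       (\<bar>a\<bar> + \<bar>b\<bar>) * sqrt (\<integral>\<omega>. (norm (Z i \<omega> - L \<omega>))\<^sup>2 \<partial>M)"
      using circ
    proof eventually_elim
      case (elim i)
      then have Zi: "L2_rv M (Z i)" by (simp add: circular_gaussian_def)
      note D = L2_rv_diff[OF Zi L]
      have le: "cmod (e x - e y) \<le> (\<bar>a\<bar> + \<bar>b\<bar>) * cmod (x - y)" for x y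
      proof -
        have "cmod (e x - e y) \<le> \<bar>a * Re (x - y) + b * Im (x - y)\<bar>"
          unfolding e_def by (rule order_trans[OF norm_iexp_diff_le]) (simp add: algebra_simps)
        also have "\<dots> \<le> \<bar>a\<bar> * \<bar>Re (x - y)\<bar> + \<bar>b\<bar> * \<bar>Im (x - y)\<bar>"
          by (rule order_trans[OF abs_triangle_ineq]) (simp add: abs_mult)
        also have "\<dots> \<le> \<bar>a\<bar> * cmod (x - y) + \<bar>b\<bar> * cmod (x - y)"
          by (intro add_mono mult_left_mono abs_Re_le_cmod abs_Im_le_cmod) auto
        finally show ?thesis by (simp add: distrib_right)
      qed
      have "norm ((\<integral>\<omega>. e (Z i \<omega>) \<partial>M) - (\<integral>\<omega>. e (L \<omega>) \<partial>M)) = norm (\<integral>\<omega>. e (Z i \<omega>) - e (L \<omega>) \<partial>M)"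
        using int[OF Zi] int[OF L] by simp
      also have "\<dots> \<le> (\<integral>\<omega>. (\<bar>a\<bar> + \<bar>b\<bar>) * norm (Z i \<omega> - L \<omega>) \<partial>M)"
        using int[OF Zi] int[OF L] L2_rv_integrable[OF D]
        by (intro order_trans[OF integral_norm_bound] integral_mono le) auto
      also have "\<dots> \<le> (\<bar>a\<bar> + \<bar>b\<bar>) * sqrt (\<integral>\<omega>. (norm (Z i \<omega> - L \<omega>))\<^sup>2 \<partial>M)"
        using L2_rv_integral_norm_le[OF D] by (auto intro: mult_left_mono)
      finally show ?case .
    qed
  qed
  then have "((\<lambda>i. \<integral>\<omega>. e (Z i \<omega>) \<partial>M) \<longlongrightarrow> (\<integral>\<omega>. e (L \<omega>) \<partial>M)) F" by (simp add: LIM_zero_iff)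
  moreover have "((\<lambda>i. complex_of_real (exp (- (a\<^sup>2 + b\<^sup>2) * (\<integral>\<omega>. (cmod (Z i \<omega>))\<^sup>2 \<partial>M) / 4))) \<longlongrightarrow>
      complex_of_real (exp (- (a\<^sup>2 + b\<^sup>2) * (\<integral>\<omega>. (cmod (L \<omega>))\<^sup>2 \<partial>M) / 4))) F"
    by (intro tendsto_intros ms_tendsto_integral_square[OF lim]) simp
  then have "((\<lambda>i. \<integral>\<omega>. e (Z i \<omega>) \<partial>M) \<longlongrightarrow>
      complex_of_real (exp (- (a\<^sup>2 + b\<^sup>2) * (\<integral>\<omega>. (cmod (L \<omega>))\<^sup>2 \<partial>M) / 4))) F"
    by (rule Lim_transform_eventually)
       (use circ in eventually_elim, simp add: circular_gaussian_def e_def)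
  ultimately show "(\<integral>\<omega>. iexp (a * Re (L \<omega>) + b * Im (L \<omega>)) \<partial>M) =
      complex_of_real (exp (- (a\<^sup>2 + b\<^sup>2) * (\<integral>\<omega>. (cmod (L \<omega>))\<^sup>2 \<partial>M) / 4))"
    unfolding e_def using tendsto_unique[OF F] by blast
qed

text \<open>Averaging \<open>iexp (s * (A * Re Z + B * Im Z))\<close> over independent standard normal \<open>A\<close> and
  \<open>B\<close> gives \<open>exp (- s\<^sup>2 * (cmod Z)\<^sup>2 / 2)\<close>, so that the characteristic function determines the
  Laplace transform of \<open>(cmod Z)\<^sup>2\<close> without inversion.\<close>

lemma (in prob_space) circular_gaussian_Laplace:
  assumes Z: "circular_gaussian M Z" and t: "t \<ge> 0"
  shows "(\<integral>\<omega>. exp (- t * (cmod (Z \<omega>))\<^sup>2) \<partial>M) = 1 / (1 + t * (\<integral>\<omega>. (cmod (Z \<omega>))\<^sup>2 \<partial>M))"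
proof -
  define v where "v = (\<integral>\<omega>. (cmod (Z \<omega>))\<^sup>2 \<partial>M)"
  \<comment> \<open>Chosen so that averaging \<open>iexp (s * A * x)\<close> over a standard normal
    A yields the exponential of \<open>- t\<close> times the square of x.\<close>
  define s where "s = sqrt (2 * t)"
  let ?N = std_normal_distribution
  have v0: "v \<ge> 0" by (simp add: v_def)
  have s2: "s\<^sup>2 = 2 * t" using t by (simp add: s_def)
  have [measurable]: "Z \<in> borel_measurable M" using Z by (simp add: circular_gaussian_def L2_rv_def)
  interpret N: prob_space ?N by (rule prob_space_normal_density) simp
  interpret MN: pair_prob_space M ?N ..
  have char: "(\<integral>A. iexp (s * A * x) \<partial>?N) = complex_of_real (exp (- t * x\<^sup>2))" for x
  proof -
    have "(\<integral>A. iexp (s * A * x) \<partial>?N) = char ?N (s * x)"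
      by (simp add: char_def mult.assoc mult.commute mult.left_commute)
    then show ?thesis by (simp add: char_std_normal_distribution power_mult_distrib s2)
  qed
  have gauss: "(\<integral>A. exp (- t * v * A\<^sup>2 / 2) \<partial>?N) = 1 / sqrt (1 + t * v)"
  proof -
    \<comment> \<open>The standard normal density times the Gaussian factor is r times the centred
      normal density of standard deviation r, which integrates to 1.\<close>
    define r where "r = 1 / sqrt (1 + t * v)"
    have r: "r > 0" "r\<^sup>2 = 1 / (1 + t * v)"
      using t v0 by (simp_all add: r_def add_pos_nonneg power_divide)
    have "std_normal_density A * exp (- t * v * A\<^sup>2 / 2) = r * normal_density 0 r A" for A
    proof -
      have "r * normal_density 0 r A = 1 / sqrt (2 * pi) * exp (- (A\<^sup>2 * (1 + t * v)) / 2)"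
      proof -
        have "sqrt (2 * pi * r\<^sup>2) = sqrt (2 * pi) * r" using r(1) by (simp add: real_sqrt_mult)
        then show ?thesis using r(1) by (simp add: normal_density_def r(2))
      qed
      then show ?thesis
        by (simp add: std_normal_density_def exp_add[symmetric] algebra_simps add_divide_distrib)
    qed
    then show ?thesis
      using r(1) by (simp add: integral_density normal_density_nonneg r_def[symmetric])
  qed
  have "complex_of_real (\<integral>\<omega>. exp (- t * (cmod (Z \<omega>))\<^sup>2) \<partial>M) =
     (\<integral>\<omega>. complex_of_real (exp (- t * (cmod (Z \<omega>))\<^sup>2)) \<partial>M)"
    by simp
  also have "\<dots> = (\<integral>\<omega>. (\<integral>A. iexp (s * A * Re (Z \<omega>)) \<partial>?N) * (\<integral>B. iexp (s * B * Im (Z \<omega>)) \<partial>?N) \<partial>M)"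
    unfolding char by (simp add: cmod_power2 exp_add[symmetric] algebra_simps flip: of_real_mult)
  also have "\<dots> = (\<integral>\<omega>. (\<integral>A. iexp (s * A * Re (Z \<omega>)) * (\<integral>B. iexp (s * B * Im (Z \<omega>)) \<partial>?N) \<partial>?N) \<partial>M)"
    by simp
  \<comment> \<open>The integrations over A and B are moved outside one at a time; the integrands
    have modulus at most 1.\<close>
  also have "\<dots> = (\<integral>A. (\<integral>\<omega>. iexp (s * A * Re (Z \<omega>)) * (\<integral>B. iexp (s * B * Im (Z \<omega>)) \<partial>?N) \<partial>M) \<partial>?N)"
  proof (rule MN.Fubini_integral[symmetric])
    show "integrable (M \<Otimes>\<^sub>M ?N) (\<lambda>(\<omega>, A). iexp (s * A * Re (Z \<omega>)) * (\<integral>B. iexp (s * B * Im (Z \<omega>)) \<partial>?N))"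
      unfolding char
      by (rule MN.P.integrable_const_bound[where B = 1])
         (auto simp: norm_mult t split_beta intro!: mult_nonneg_nonneg)
  qed
  also have "\<dots> = (\<integral>A. (\<integral>\<omega>. (\<integral>B. iexp (s * A * Re (Z \<omega>) + s * B * Im (Z \<omega>)) \<partial>?N) \<partial>M) \<partial>?N)"
    by (simp add: exp_add distrib_left)
  also have "\<dots> = (\<integral>A. (\<integral>B. (\<integral>\<omega>. iexp (s * A * Re (Z \<omega>) + s * B * Im (Z \<omega>)) \<partial>M) \<partial>?N) \<partial>?N)"
  proof (intro Bochner_Integration.integral_cong refl MN.Fubini_integral[symmetric])
    fix A
    show "integrable (M \<Otimes>\<^sub>M ?N) (\<lambda>(\<omega>, B). iexp (s * A * Re (Z \<omega>) + s * B * Im (Z \<omega>)))"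
      by (rule MN.P.integrable_const_bound[where B = 1]) (auto simp: split_beta)
  qed
  also have "\<dots> = (\<integral>A. (\<integral>B. complex_of_real (exp (- t * v * A\<^sup>2 / 2) * exp (- t * v * B\<^sup>2 / 2)) \<partial>?N) \<partial>?N)"
  proof (intro Bochner_Integration.integral_cong refl)
    fix A B
    have "- ((s * A)\<^sup>2 + (s * B)\<^sup>2) * v / 4 = - t * v * A\<^sup>2 / 2 + - t * v * B\<^sup>2 / 2"
      by (simp add: power_mult_distrib s2 field_simps)
    then show "(\<integral>\<omega>. iexp (s * A * Re (Z \<omega>) + s * B * Im (Z \<omega>)) \<partial>M) =
       complex_of_real (exp (- t * v * A\<^sup>2 / 2) * exp (- t * v * B\<^sup>2 / 2))"
      using Z unfolding circular_gaussian_def v_def[symmetric] by (simp only: exp_add[symmetric])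
  qed
  also have "\<dots> = complex_of_real ((\<integral>A. exp (- t * v * A\<^sup>2 / 2) \<partial>?N) * (\<integral>B. exp (- t * v * B\<^sup>2 / 2) \<partial>?N))"
    by simp
  also have "\<dots> = complex_of_real (1 / (1 + t * v))"
    unfolding gauss using t v0 by (simp add: add_nonneg_nonneg)
  finally show ?thesis unfolding v_def[symmetric] by (simp only: of_real_eq_iff)
qed

subsection \<open>The expected logarithm\<close>

text \<open>\<open>ln (1 + y)\<close> is the integral of \<open>1 / (1 + u)\<close> over u from 0 to
  y, and \<open>1 / (1 + u)\<close> that of \<open>exp (- s * (1 + u))\<close> over s; Tonelli
  exchanges the two.\<close>

lemma ln_eq_Frullani:
  assumes "y \<ge> 0"
  shows "ennreal (ln (1 + y)) =
    (\<integral>\<^sup>+s. ennreal ((1 - exp (- s * y)) * exp (- s) / s) * indicator {0..} s \<partial>lborel)"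
proof -
  let ?f = "\<lambda>u s. ennreal (exp (- s * (1 + u))) * indicator {0..y} u * indicator {0..} s"
  have "ennreal (ln (1 + y)) = (\<integral>\<^sup>+u. ennreal (1 / (1 + u)) * indicator {0..y} u \<partial>lborel)"
    using assms
    by (subst nn_integral_FTC_Icc[where F = "\<lambda>u. ln (1 + u)"])
       (auto intro!: derivative_eq_intros)
  also have "\<dots> = (\<integral>\<^sup>+u. (\<integral>\<^sup>+s. ?f u s \<partial>lborel) \<partial>lborel)"
  proof (rule nn_integral_cong)
    fix u :: real
    show "ennreal (1 / (1 + u)) * indicator {0..y} u = (\<integral>\<^sup>+s. ?f u s \<partial>lborel)"
    proof (cases "u \<in> {0..y}")
      case True
      define k where "k = 1 + u"
      have k: "k > 0" using True by (simp add: k_def)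
      then have lim: "((\<lambda>s. - exp (- s * k) / k) \<longlongrightarrow> 0) at_top" by real_asymp
      have "(\<integral>\<^sup>+s. ennreal (exp (- s * k)) * indicator {0..} s \<partial>lborel) =
          ennreal (0 - (- exp (- 0 * k) / k))"
        using k lim
        by (intro nn_integral_FTC_atLeast[where F = "\<lambda>s. - exp (- s * k) / k"])
           (auto intro!: derivative_eq_intros)
      then show ?thesis using True by (simp add: k_def)
    qed simp
  qed
  also have "\<dots> = (\<integral>\<^sup>+s. (\<integral>\<^sup>+u. ?f u s \<partial>lborel) \<partial>lborel)"
    by (rule lborel_pair.Fubini') measurable
  also have "\<dots> = (\<integral>\<^sup>+s. ennreal ((1 - exp (- s * y)) * exp (- s) / s) * indicator {0..} s \<partial>lborel)"
  proof (rule nn_integral_cong_AE)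
    show "AE s in lborel. (\<integral>\<^sup>+u. ?f u s \<partial>lborel) =
        ennreal ((1 - exp (- s * y)) * exp (- s) / s) * indicator {0..} s"
      \<comment> \<open>At \<open>s = 0\<close> the inner integral is y, whereas division by zero
        makes the other side 0.\<close>
      using AE_lborel_singleton[of 0]
    proof eventually_elim
      case (elim s)
      show ?case
      proof (cases "s \<ge> 0")
        case True
        then have s: "s > 0" using elim by simp
        have "(\<integral>\<^sup>+u. ennreal (exp (- s * (1 + u))) * indicator {0..y} u \<partial>lborel) =
            ennreal (- exp (- s * (1 + y)) / s - (- exp (- s * (1 + 0)) / s))"
          using s assms
          by (intro nn_integral_FTC_Icc[where F = "\<lambda>u. - exp (- s * (1 + u)) / s"])
             (auto intro!: derivative_eq_intros)
        also have "- exp (- s * (1 + y)) / s - (- exp (- s * (1 + 0)) / s) = (1 - exp (- s * y)) * exp (- s) / s"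
          using s by (simp add: field_simps exp_add[symmetric])
        finally show ?thesis using True by simp
      qed simp
    qed
  qed
  finally show ?thesis .
qed

text \<open>The logarithm tames the square: it is Lipschitz in the modulus itself, so second moments
  of the transform control second moments of the capacity integrand.\<close>

lemma ln_one_plus_square_Lipschitz:
  fixes x y \<alpha> :: real
  assumes "\<alpha> > 0"
  shows "\<bar>ln (1 + \<alpha> * x\<^sup>2) - ln (1 + \<alpha> * y\<^sup>2)\<bar> \<le> sqrt \<alpha> * \<bar>x - y\<bar>"
proof -
  have pos: "1 + \<alpha> * z\<^sup>2 > 0" for z using assms by (simp add: add_pos_nonneg)
  have "norm (ln (1 + \<alpha> * x\<^sup>2) - ln (1 + \<alpha> * y\<^sup>2)) \<le> sqrt \<alpha> * norm (x - y)"
  proof (rule field_differentiable_bound[where S = UNIV and f' = "\<lambda>z. 2 * \<alpha> * z / (1 + \<alpha> * z\<^sup>2)"])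
    fix z :: real
    show "((\<lambda>z. ln (1 + \<alpha> * z\<^sup>2)) has_field_derivative 2 * \<alpha> * z / (1 + \<alpha> * z\<^sup>2)) (at z within UNIV)"
      using pos[of z] by (auto intro!: derivative_eq_intros)
    \<comment> \<open>The arithmetic-geometric mean inequality for 1 and
      \<open>sqrt \<alpha> * \<bar>z\<bar>\<close> bounds the derivative.\<close>
    have "0 \<le> sqrt \<alpha> * (1 - sqrt \<alpha> * \<bar>z\<bar>)\<^sup>2" using assms by simp
    also have "\<dots> = sqrt \<alpha> * (1 + (sqrt \<alpha>)\<^sup>2 * \<bar>z\<bar>\<^sup>2) - 2 * (sqrt \<alpha>)\<^sup>2 * \<bar>z\<bar>"
      by (simp add: power2_eq_square algebra_simps)
    finally have "2 * \<alpha> * \<bar>z\<bar> \<le> sqrt \<alpha> * (1 + \<alpha> * z\<^sup>2)" using assms by simp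
    then show "norm (2 * \<alpha> * z / (1 + \<alpha> * z\<^sup>2)) \<le> sqrt \<alpha>"
      using pos[of z] assms by (simp add: abs_mult divide_le_eq)
  qed auto
  then show ?thesis by simp
qed

lemma L2_rv_log_one_plus_square:
  fixes Z :: "'a \<Rightarrow> complex"
  assumes Z: "L2_rv M Z" and \<alpha>: "\<alpha> > 0"
  shows "L2_rv M (\<lambda>\<omega>. log 2 (1 + \<alpha> * (cmod (Z \<omega>))\<^sup>2))"
proof (rule L2_rv_bound[OF Z, where K = "sqrt \<alpha> / ln 2"])
  show "(\<lambda>\<omega>. log 2 (1 + \<alpha> * (cmod (Z \<omega>))\<^sup>2)) \<in> borel_measurable M"
    using Z by (auto simp: L2_rv_def log_def)
  show "norm (log 2 (1 + \<alpha> * (cmod (Z \<omega>))\<^sup>2)) \<le> sqrt \<alpha> / ln 2 * norm (Z \<omega>)" for \<omega>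
    using ln_one_plus_square_Lipschitz[OF \<alpha>, of "cmod (Z \<omega>)" 0]
    by (simp add: log_def divide_right_mono)
qed

lemma integral_square_log_diff_le:
  fixes Z Z' :: "'a \<Rightarrow> complex"
  assumes Z: "L2_rv M Z" "L2_rv M Z'" and \<alpha>: "\<alpha> > 0"
  shows "(\<integral>\<omega>. (norm (log 2 (1 + \<alpha> * (cmod (Z \<omega>))\<^sup>2) - log 2 (1 + \<alpha> * (cmod (Z' \<omega>))\<^sup>2)))\<^sup>2 \<partial>M) \<le>
    \<alpha> / (ln 2)\<^sup>2 * (\<integral>\<omega>. (norm (Z \<omega> - Z' \<omega>))\<^sup>2 \<partial>M)"
proof -
  have "(norm (log 2 (1 + \<alpha> * (cmod x)\<^sup>2) - log 2 (1 + \<alpha> * (cmod y)\<^sup>2)))\<^sup>2 \<le>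
      \<alpha> / (ln 2)\<^sup>2 * (norm (x - y))\<^sup>2" for x y
  proof -
    have "norm (log 2 (1 + \<alpha> * (cmod x)\<^sup>2) - log 2 (1 + \<alpha> * (cmod y)\<^sup>2)) \<le> sqrt \<alpha> / ln 2 * norm (x - y)"
    proof -
      have "\<bar>ln (1 + \<alpha> * (cmod x)\<^sup>2) - ln (1 + \<alpha> * (cmod y)\<^sup>2)\<bar> \<le> sqrt \<alpha> * norm (x - y)"
        by (rule order_trans[OF ln_one_plus_square_Lipschitz[OF \<alpha>]])
           (use \<alpha> norm_triangle_ineq3[of x y] in \<open>auto intro: mult_left_mono\<close>)
      then show ?thesis
        by (simp add: log_def diff_divide_distrib[symmetric] divide_right_mono)
    qed
    from power_mono[OF this, of 2] show ?thesis
      using \<alpha> by (simp add: power_mult_distrib power_divide)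
  qed
  then have "(\<integral>\<omega>. (norm (log 2 (1 + \<alpha> * (cmod (Z \<omega>))\<^sup>2) - log 2 (1 + \<alpha> * (cmod (Z' \<omega>))\<^sup>2)))\<^sup>2 \<partial>M) \<le>
     (\<integral>\<omega>. \<alpha> / (ln 2)\<^sup>2 * (norm (Z \<omega> - Z' \<omega>))\<^sup>2 \<partial>M)"
    by (intro integral_mono L2_rvD(2)[OF L2_rv_diff] L2_rv_log_one_plus_square Z \<alpha>
        integrable_mult_right) auto
  then show ?thesis by simp
qed

lemma Ei_gen_1_0: "Ei_gen 1 0 = 0"
proof -
  have "\<not> (\<lambda>t :: real. 1 / t) integrable_on {1..}"
  proof
    assume int: "(\<lambda>t :: real. 1 / t) integrable_on {1..}"
    define I where "I = integral {1..} (\<lambda>t :: real. 1 / t)"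
    \<comment> \<open>Makes \<open>ln b = max I 0 + 1\<close> exceed the supposed value I of the
      whole integral.\<close>
    define b where "b = exp (max I 0 + 1)"
    have b: "b > 1" by (simp add: b_def)
    have "((\<lambda>t. 1 / t) has_integral ln b - ln 1) {1..b}"
      using b by (intro fundamental_theorem_of_calculus)
        (auto intro!: derivative_eq_intros simp: has_real_derivative_iff_has_vector_derivative[symmetric])
    moreover have "integral {1..b} (\<lambda>t. 1 / t) \<le> I"
      unfolding I_def using int calculation
      by (intro integral_subset_le) (auto simp: integrable_on_def)
    ultimately have "ln b \<le> I" by (simp add: integral_unique)
    then show False by (simp add: b_def)
  qed
  then show ?thesis by (simp add: Ei_gen_def not_integrable_integral)
qed

text \<open>The computation is done in \<open>ennreal\<close>, where Tonelli asks only for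
  measurability; integrability of the logarithm ties the result to the real-valued
  expectation.\<close>

lemma (in prob_space) circular_gaussian_expected_log:
  assumes Z: "circular_gaussian M Z" and \<alpha>: "\<alpha> > 0"
  shows "(\<integral>\<omega>. log 2 (1 + \<alpha> * (cmod (Z \<omega>))\<^sup>2) \<partial>M) =
    1 / ln 2 * (exp (1 / (\<alpha> * (\<integral>\<omega>. (cmod (Z \<omega>))\<^sup>2 \<partial>M))) *
      Ei_gen 1 (1 / (\<alpha> * (\<integral>\<omega>. (cmod (Z \<omega>))\<^sup>2 \<partial>M))))"
proof -
  define w where "w = \<alpha> * (\<integral>\<omega>. (cmod (Z \<omega>))\<^sup>2 \<partial>M)"
  define Y where "Y \<omega> = \<alpha> * (cmod (Z \<omega>))\<^sup>2" for \<omega>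
  define E where "E = (\<integral>\<omega>. ln (1 + Y \<omega>) \<partial>M)"
  have L2: "L2_rv M Z" using Z by (simp add: circular_gaussian_def)
  then have [measurable]: "Z \<in> borel_measurable M" by (simp add: L2_rv_def)
  have [measurable]: "Y \<in> borel_measurable M" unfolding Y_def by measurable
  have Y0: "Y \<omega> \<ge> 0" for \<omega> using \<alpha> by (simp add: Y_def)
  have w0: "w \<ge> 0" using \<alpha> by (simp add: w_def)
  have E0: "E \<ge> 0" unfolding E_def using Y0 by (intro integral_nonneg_AE) (auto intro: ln_ge_zero)
  have int: "integrable M (\<lambda>\<omega>. ln (1 + Y \<omega>))"
    using integrable_mult_right[OF L2_rv_integrable[OF L2_rv_log_one_plus_square[OF L2 \<alpha>]], of "ln 2"]
    by (simp add: log_def Y_def)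
  have Laplace: "(\<integral>\<^sup>+\<omega>. ennreal ((1 - exp (- s * Y \<omega>)) * exp (- s) / s) \<partial>M) =
      ennreal (w * exp (- s) / (1 + s * w))" if s: "s > 0" for s
  proof -
    have i: "integrable M (\<lambda>\<omega>. exp (- s * Y \<omega>))"
      using s Y0 by (intro integrable_const_bound[where B = 1]) auto
    have e: "(\<integral>\<omega>. exp (- s * Y \<omega>) \<partial>M) = 1 / (1 + s * w)"
      using circular_gaussian_Laplace[OF Z, of "s * \<alpha>"] s \<alpha> by (simp add: Y_def w_def mult.assoc)
    have "(\<integral>\<^sup>+\<omega>. ennreal ((1 - exp (- s * Y \<omega>)) * exp (- s) / s) \<partial>M) =
        ennreal (\<integral>\<omega>. (1 - exp (- s * Y \<omega>)) * exp (- s) / s \<partial>M)"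
      using s Y0 i by (intro nn_integral_eq_integral) auto
    also have "(\<integral>\<omega>. (1 - exp (- s * Y \<omega>)) * exp (- s) / s \<partial>M) = (1 - 1 / (1 + s * w)) * exp (- s) / s"
      using i by (simp add: e[simplified] prob_space)
    also have "\<dots> = w * exp (- s) / (1 + s * w)"
      using s w0 by (simp add: field_simps add_nonneg_eq_0_iff)
    finally show ?thesis .
  qed
  have "ennreal E = (\<integral>\<^sup>+\<omega>. ennreal (ln (1 + Y \<omega>)) \<partial>M)"
    unfolding E_def using int Y0 by (intro nn_integral_eq_integral[symmetric]) (auto intro: ln_ge_zero)
  also have "\<dots> = (\<integral>\<^sup>+\<omega>. (\<integral>\<^sup>+s. ennreal ((1 - exp (- s * Y \<omega>)) * exp (- s) / s) * indicator {0..} s \<partial>lborel) \<partial>M)"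
    by (simp add: ln_eq_Frullani[OF Y0])
  also have "\<dots> = (\<integral>\<^sup>+s. (\<integral>\<^sup>+\<omega>. ennreal ((1 - exp (- s * Y \<omega>)) * exp (- s) / s) * indicator {0..} s \<partial>M) \<partial>lborel)"
  proof -
    interpret pair_sigma_finite M lborel ..
    show ?thesis by (rule Fubini'[symmetric]) measurable
  qed
  also have "\<dots> = (\<integral>\<^sup>+s. ennreal (w * exp (- s) / (1 + s * w)) * indicator {0..} s \<partial>lborel)"
  proof (rule nn_integral_cong_AE)
    show "AE s in lborel. (\<integral>\<^sup>+\<omega>. ennreal ((1 - exp (- s * Y \<omega>)) * exp (- s) / s) * indicator {0..} s \<partial>M) =
        ennreal (w * exp (- s) / (1 + s * w)) * indicator {0..} s"
      using AE_lborel_singleton[of 0]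
    proof eventually_elim
      case (elim s)
      then show ?case
        using Laplace[of s] by (cases "s \<ge> 0") (auto simp: nn_integral_multc)
    qed
  qed
  finally have EI: "ennreal E = (\<integral>\<^sup>+s. ennreal (w * exp (- s) / (1 + s * w)) * indicator {0..} s \<partial>lborel)" .
  have "E = exp (1 / w) * Ei_gen 1 (1 / w)"
  proof (cases "w = 0")
    case True
    then have "E = 0" using EI E0 by simp
    \<comment> \<open>Since \<open>1 / 0 = 0\<close>, the product equals the value
      \<open>Ei_gen 1 0 = 0\<close>.\<close>
    then show ?thesis using True by (simp add: Ei_gen_1_0 [simplified])
  next
    case False
    \<comment> \<open>The substitution \<open>s = z * (t - 1)\<close> turns \<open>1 + s * w\<close>
      into t and the half-line from 0 into the one from 1.\<close>
    define z where "z = 1 / w"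
    have z: "z > 0" using False w0 by (simp add: z_def)
    let ?g = "\<lambda>t. if t \<in> {1..} then exp z * (exp (- t * z) / t ^ 1) else 0"
    have "ennreal E = \<bar>z\<bar> * (\<integral>\<^sup>+t. ennreal (w * exp (- (- z + z * t)) / (1 + (- z + z * t) * w)) *
        indicator {0..} (- z + z * t) \<partial>lborel)"
      unfolding EI using z by (intro nn_integral_real_affine) auto
    also have "\<dots> = (\<integral>\<^sup>+t. \<bar>z\<bar> * (ennreal (w * exp (- (- z + z * t)) / (1 + (- z + z * t) * w)) *
        indicator {0..} (- z + z * t)) \<partial>lborel)"
      by (rule nn_integral_cmult[symmetric]) measurable
    also have "\<dots> = (\<integral>\<^sup>+t. ennreal (?g t) \<partial>lborel)"
    proof (rule nn_integral_cong)
      fix t :: real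
      show "\<bar>z\<bar> * (ennreal (w * exp (- (- z + z * t)) / (1 + (- z + z * t) * w)) *
        indicator {0..} (- z + z * t)) = ennreal (?g t)"
      proof (cases "t \<ge> 1")
        case True
        have "z * w = 1" using False by (simp add: z_def)
        then have "1 + (- z + z * t) * w = t" by (simp add: algebra_simps)
        then have "z * (w * exp (- (- z + z * t)) / (1 + (- z + z * t) * w)) = exp (z - z * t) / t"
          using \<open>z * w = 1\<close> by (simp add: mult.assoc[symmetric])
        then have "ennreal z * ennreal (w * exp (- (- z + z * t)) / (1 + (- z + z * t) * w)) =
            ennreal (exp (z - z * t) / t)"
          using z by (simp add: ennreal_mult'[symmetric])
        moreover have "- z + z * t \<in> {0..}" using True z by simp
        ultimately show ?thesis
          using True z by (simp add: exp_diff exp_minus field_simps)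
      next
        case False
        then have "z * t < z" using z by simp
        then show ?thesis using False by simp
      qed
    qed
    finally have "(\<integral>\<^sup>+t. ennreal (?g t) \<partial>lborel) = ennreal E" ..
    then have "(?g has_integral E) UNIV"
      using E0 by (intro nn_integral_has_integral) auto
    then have "((\<lambda>t. exp z * (exp (- t * z) / t ^ 1)) has_integral E) {1..}"
      by (simp only: has_integral_restrict_UNIV)
    then have "E = integral {1..} (\<lambda>t. exp z * (exp (- t * z) / t ^ 1))" by (simp only: integral_unique)
    then show ?thesis by (simp only: integral_mult_right Ei_gen_def z_def)
  qed
  then show ?thesis
    by (simp add: log_def E_def Y_def w_def)
qed

subsection \<open>Pairs of independent Gaussian processes with the same covariance\<close>

text \<open>The index set is abstract so that one computation serves processes indexed by time and
  generalized processes indexed by test functions.\<close>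

locale gaussian_pair = prob_space M for M :: "'a measure" +
  fixes T :: "'i set" and \<kappa> :: "'i \<Rightarrow> 'i \<Rightarrow> real" and X Y :: "'i \<Rightarrow> 'a \<Rightarrow> real"
  assumes gaussian: "gaussian_process M T X" "gaussian_process M T Y"
    and mean: "\<And>t. t \<in> T \<Longrightarrow> expectation (X t) = 0" "\<And>t. t \<in> T \<Longrightarrow> expectation (Y t) = 0"
    and cov: "\<And>s t. s \<in> T \<Longrightarrow> t \<in> T \<Longrightarrow> (\<integral>\<omega>. X s \<omega> * X t \<omega> \<partial>M) = \<kappa> s t"
      "\<And>s t. s \<in> T \<Longrightarrow> t \<in> T \<Longrightarrow> (\<integral>\<omega>. Y s \<omega> * Y t \<omega> \<partial>M) = \<kappa> s t"
    and indep: "indep_var (Pi\<^sub>M T (\<lambda>_. borel)) (\<lambda>\<omega>. \<lambda>t\<in>T. X t \<omega>)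
      (Pi\<^sub>M T (\<lambda>_. borel)) (\<lambda>\<omega>. \<lambda>t\<in>T. Y t \<omega>)"

text \<open>\<open>gaussian_process\<close> sums over a set of distinct indices, but cells of a
  division may share a tag; coefficients of equal indices are collected.\<close>

lemma gaussian_process_sum:
  assumes "gaussian_process M T X" "finite A" "t ` A \<subseteq> T"
  shows "gaussian_rv M (\<lambda>\<omega>. \<Sum>i\<in>A. c i * X (t i) \<omega>)"
proof -
  have "(\<Sum>i\<in>A. c i * X (t i) \<omega>) = (\<Sum>s\<in>t ` A. (\<Sum>i | i \<in> A \<and> t i = s. c i) * X s \<omega>)" for \<omega>
    unfolding sum.image_gen[OF assms(2), of "\<lambda>i. c i * X (t i) \<omega>" t] sum_distrib_right
    by (intro sum.cong) auto
  then show ?thesis using assms by (simp add: gaussian_process_def)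
qed

context gaussian_pair begin

lemma L2: "t \<in> T \<Longrightarrow> L2_rv M (X t)" "t \<in> T \<Longrightarrow> L2_rv M (Y t)"
  using gaussian_rv_centered(1)[OF gaussian_process_sum[OF gaussian(1), of "{t}" id "\<lambda>_. 1"]]
    gaussian_rv_centered(1)[OF gaussian_process_sum[OF gaussian(2), of "{t}" id "\<lambda>_. 1"]] mean
  by (auto simp: id_def)

lemma indep_sum:
  assumes t: "t ` A \<subseteq> T"
  shows "indep_var borel (\<lambda>\<omega>. \<Sum>i\<in>A. c i * X (t i) \<omega>) borel (\<lambda>\<omega>. \<Sum>i\<in>A. d i * Y (t i) \<omega>)"
proof -
  have m: "(\<lambda>x. \<Sum>i\<in>A. c i * x (t i)) \<in> borel_measurable (Pi\<^sub>M T (\<lambda>_. borel))" for c :: "_ \<Rightarrow> real"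
    using t by (intro borel_measurable_sum borel_measurable_times measurable_component_singleton) auto
  have "(\<Sum>i\<in>A. c i * (\<lambda>t\<in>T. Z t \<omega>) (t i)) = (\<Sum>i\<in>A. c i * Z (t i) \<omega>)"
    for c and Z :: "'i \<Rightarrow> 'a \<Rightarrow> real" and \<omega>
    using t by (intro sum.cong) auto
  then show ?thesis
    using indep_var_compose[OF indep m m, of c d] by (simp add: comp_def)
qed

lemma cross_moment:
  assumes "s \<in> T" "t \<in> T"
  shows "(\<integral>\<omega>. X s \<omega> * Y t \<omega> \<partial>M) = 0"
proof -
  \<comment> \<open>Zero-one coefficients single out one variable on each side, since
    \<open>indep_sum\<close> uses the same index set for both sums.\<close>
  have "indep_var borel (\<lambda>\<omega>. \<Sum>i\<in>{s, t}. of_bool (i = s) * X (id i) \<omega>) borel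
      (\<lambda>\<omega>. \<Sum>i\<in>{s, t}. of_bool (i = t) * Y (id i) \<omega>)"
    using assms by (intro indep_sum) auto
  then have "indep_var borel (X s) borel (Y t)"
    by (cases "s = t") auto
  from indep_var_lebesgue_integral[OF this L2_rv_integrable[OF L2(1)] L2_rv_integrable[OF L2(2)]]
  show ?thesis using assms mean by simp
qed

lemma second_moment_sum:
  assumes A: "finite A" "t ` A \<subseteq> T"
  shows "(\<integral>\<omega>. (\<Sum>i\<in>A. c i * X (t i) \<omega>)\<^sup>2 \<partial>M) = (\<Sum>i\<in>A. \<Sum>j\<in>A. c i * c j * \<kappa> (t i) (t j))"
    "(\<integral>\<omega>. (\<Sum>i\<in>A. c i * Y (t i) \<omega>)\<^sup>2 \<partial>M) = (\<Sum>i\<in>A. \<Sum>j\<in>A. c i * c j * \<kappa> (t i) (t j))"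
proof -
  have *: "(\<integral>\<omega>. (\<Sum>i\<in>A. c i * Z (t i) \<omega>)\<^sup>2 \<partial>M) =
      (\<Sum>i\<in>A. \<Sum>j\<in>A. c i * c j * (\<integral>\<omega>. Z (t i) \<omega> * Z (t j) \<omega> \<partial>M))"
    if Z: "\<And>s. s \<in> T \<Longrightarrow> L2_rv M (Z s)" for Z :: "'i \<Rightarrow> 'a \<Rightarrow> real"
  proof -
    have i: "integrable M (\<lambda>\<omega>. Z (t i) \<omega> * Z (t j) \<omega>)" if "i \<in> A" "j \<in> A" for i j
      using L2_rv_integrable_inner[OF Z Z, of "t i" "t j"] A(2) that by auto
    have "(\<Sum>i\<in>A. c i * Z (t i) \<omega>)\<^sup>2 = (\<Sum>i\<in>A. \<Sum>j\<in>A. (c i * c j) * (Z (t i) \<omega> * Z (t j) \<omega>))" for \<omega>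
      by (simp add: power2_eq_square sum_product mult_ac)
    then show ?thesis using i by simp
  qed
  have "t i \<in> T" if "i \<in> A" for i using A that by auto
  then show "(\<integral>\<omega>. (\<Sum>i\<in>A. c i * X (t i) \<omega>)\<^sup>2 \<partial>M) = (\<Sum>i\<in>A. \<Sum>j\<in>A. c i * c j * \<kappa> (t i) (t j))"
    "(\<integral>\<omega>. (\<Sum>i\<in>A. c i * Y (t i) \<omega>)\<^sup>2 \<partial>M) = (\<Sum>i\<in>A. \<Sum>j\<in>A. c i * c j * \<kappa> (t i) (t j))"
    using *[OF L2(1)] *[OF L2(2)] cov by simp_all
qed

text \<open>Z is the complex linear combination of the \<open>X + \<i> Y\<close> with coefficients
  \<open>\<alpha> - \<i> \<beta>\<close>. The shape covers Riemann sums of the Fourier integrand as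
  well as the transform of a generalized process.\<close>

lemma circular_gaussian_sum:
  fixes \<alpha> \<beta> :: "'j \<Rightarrow> real"
  assumes A: "finite A" "t ` A \<subseteq> T"
  defines "Z \<equiv> (\<lambda>\<omega>. Complex (\<Sum>i\<in>A. \<alpha> i * X (t i) \<omega> + \<beta> i * Y (t i) \<omega>)
    (\<Sum>i\<in>A. \<alpha> i * Y (t i) \<omega> - \<beta> i * X (t i) \<omega>))"
  shows "circular_gaussian M Z"
    and "(\<integral>\<omega>. (cmod (Z \<omega>))\<^sup>2 \<partial>M) = 2 * (\<Sum>i\<in>A. \<Sum>j\<in>A. (\<alpha> i * \<alpha> j + \<beta> i * \<beta> j) * \<kappa> (t i) (t j))"
proof -
  define SX where "SX c \<omega> = (\<Sum>i\<in>A. c i * X (t i) \<omega>)" for c \<omega>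
  define SY where "SY c \<omega> = (\<Sum>i\<in>A. c i * Y (t i) \<omega>)" for c \<omega>
  define q where "q c = (\<Sum>i\<in>A. \<Sum>j\<in>A. c i * c j * \<kappa> (t i) (t j))" for c
  have tT: "t i \<in> T" if "i \<in> A" for i using A that by auto
  have g: "gaussian_rv M (SX c)" "gaussian_rv M (SY c)" for c
    using gaussian_process_sum[OF gaussian(1) A, of c] gaussian_process_sum[OF gaussian(2) A, of c]
    by (simp_all add: SX_def[abs_def] SY_def[abs_def])
  have m: "expectation (SX c) = 0" "expectation (SY c) = 0" for c
    using mean tT L2_rv_integrable[OF L2(1)[OF tT]] L2_rv_integrable[OF L2(2)[OF tT]]
    by (simp_all add: SX_def[abs_def] SY_def[abs_def])
  have v: "(\<integral>\<omega>. (SX c \<omega>)\<^sup>2 \<partial>M) = q c" "(\<integral>\<omega>. (SY c \<omega>)\<^sup>2 \<partial>M) = q c" for c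
    unfolding SX_def SY_def q_def by (rule second_moment_sum[OF A])+
  have L2S: "L2_rv M (SX c)" "L2_rv M (SY c)" for c
    by (rule gaussian_rv_centered(1)[OF g(1) m(1)], rule gaussian_rv_centered(1)[OF g(2) m(2)])
  then have [measurable]: "SX c \<in> borel_measurable M" "SY c \<in> borel_measurable M" for c
    by (auto simp: L2_rv_def)
  have ind: "indep_var borel (SX c) borel (SY d)" for c d
    using indep_sum[OF A(2), of c d] by (simp add: SX_def[abs_def] SY_def[abs_def])
  have Z: "Z \<omega> = Complex (SX \<alpha> \<omega> + SY \<beta> \<omega>) (SY \<alpha> \<omega> - SX \<beta> \<omega>)" for \<omega>
    by (simp add: Z_def SX_def SY_def sum.distrib sum_subtractf)
  have meas: "Z \<in> borel_measurable M"
    unfolding Z[abs_def] Complex_eq by measurable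
  have sq: "(cmod (Z \<omega>))\<^sup>2 = ((SX \<alpha> \<omega>)\<^sup>2 + (SY \<beta> \<omega>)\<^sup>2 + (SY \<alpha> \<omega>)\<^sup>2 + (SX \<beta> \<omega>)\<^sup>2) +
      2 * (SX \<alpha> \<omega> * SY \<beta> \<omega>) - 2 * (SX \<beta> \<omega> * SY \<alpha> \<omega>)" for \<omega>
    by (simp add: Z cmod_power2 power2_sum power2_diff)
  have cross: "integrable M (\<lambda>\<omega>. SX c \<omega> * SY d \<omega>)" "(\<integral>\<omega>. SX c \<omega> * SY d \<omega> \<partial>M) = 0" for c d
    using indep_var_integrable[OF ind[of c d]] indep_var_lebesgue_integral[OF ind[of c d]]
      L2_rv_integrable[OF L2S(1)] L2_rv_integrable[OF L2S(2)] m by auto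
  have sqi: "integrable M (\<lambda>\<omega>. (SX c \<omega>)\<^sup>2)" "integrable M (\<lambda>\<omega>. (SY c \<omega>)\<^sup>2)" for c
    using L2S[of c] by (auto simp: L2_rv_def)
  have EZ: "(\<integral>\<omega>. (cmod (Z \<omega>))\<^sup>2 \<partial>M) = 2 * (q \<alpha> + q \<beta>)"
    unfolding sq using cross sqi by (simp add: v)
  then show "(\<integral>\<omega>. (cmod (Z \<omega>))\<^sup>2 \<partial>M) = 2 * (\<Sum>i\<in>A. \<Sum>j\<in>A. (\<alpha> i * \<alpha> j + \<beta> i * \<beta> j) * \<kappa> (t i) (t j))"
    by (simp add: q_def sum.distrib distrib_right)
  show "circular_gaussian M Z"
    unfolding circular_gaussian_def
  proof (intro conjI allI)
    show "L2_rv M Z" unfolding L2_rv_def sq using cross sqi meas by simp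
    fix a b :: real
    \<comment> \<open>\<open>c + \<i> d\<close> is the product of \<open>a + \<i> b\<close> and
      \<open>\<alpha> + \<i> \<beta>\<close>, so the quadratic form is scaled by the squared modulus
      of \<open>a + \<i> b\<close>; this is circular symmetry.\<close>
    define c where "c i = a * \<alpha> i - b * \<beta> i" for i
    define d where "d i = a * \<beta> i + b * \<alpha> i" for i
    have qq: "q c + q d = (a\<^sup>2 + b\<^sup>2) * (q \<alpha> + q \<beta>)"
      unfolding q_def sum.distrib[symmetric] sum_distrib_left c_def d_def
      by (intro sum.cong refl) (simp add: power2_eq_square algebra_simps)
    have lin: "a * Re (Z \<omega>) + b * Im (Z \<omega>) = SX c \<omega> + SY d \<omega>" for \<omega>
      unfolding Z_def SX_def SY_def c_def d_def complex.sel sum_distrib_left sum.distrib[symmetric]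
      by (intro sum.cong refl) (simp add: algebra_simps)
    have ind': "indep_var borel (iexp \<circ> SX c) borel (iexp \<circ> SY d)"
      by (rule indep_var_compose[OF ind]) measurable
    have "(\<integral>\<omega>. iexp (a * Re (Z \<omega>) + b * Im (Z \<omega>)) \<partial>M) = (\<integral>\<omega>. iexp (SX c \<omega>) * iexp (SY d \<omega>) \<partial>M)"
      unfolding lin by (simp add: exp_add distrib_left)
    also have "\<dots> = (\<integral>\<omega>. iexp (SX c \<omega>) \<partial>M) * (\<integral>\<omega>. iexp (SY d \<omega>) \<partial>M)"
      using indep_var_lebesgue_integral[OF ind'] by (simp add: comp_def integrable_iexp)
    also have "\<dots> = complex_of_real (exp (- q c / 2) * exp (- q d / 2))"
      using gaussian_rv_centered(2)[OF g(1) m(1), of 1 c] gaussian_rv_centered(2)[OF g(2) m(2), of 1 d]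
      by (simp add: v)
    also have "exp (- q c / 2) * exp (- q d / 2) = exp (- (a\<^sup>2 + b\<^sup>2) * (\<integral>\<omega>. (cmod (Z \<omega>))\<^sup>2 \<partial>M) / 4)"
    proof -
      have "- q c / 2 + - q d / 2 = - (q c + q d) / 2" by simp
      also have "\<dots> = - (a\<^sup>2 + b\<^sup>2) * (\<integral>\<omega>. (cmod (Z \<omega>))\<^sup>2 \<partial>M) / 4"
        unfolding qq EZ by (simp add: field_simps)
      finally show ?thesis by (simp only: exp_add[symmetric])
    qed
    finally show "(\<integral>\<omega>. iexp (a * Re (Z \<omega>) + b * Im (Z \<omega>)) \<partial>M) =
        complex_of_real (exp (- (a\<^sup>2 + b\<^sup>2) * (\<integral>\<omega>. (cmod (Z \<omega>))\<^sup>2 \<partial>M) / 4))" .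
  qed
qed

end

subsection \<open>Capacities\<close>

context prob_space begin

text \<open>Testing the mean-square integral over f against the constant 1 moves the expectation
  inside.\<close>

lemma ergodic_capacity_circular_gaussian:
  assumes H: "\<And>f. circular_gaussian M (H f)" and \<alpha>: "\<alpha> > 0"
    and C: "has_ergodic_capacity M W \<alpha> H C"
  shows "C = 1 / ln 2 * integral {- W / 2..W / 2} (\<lambda>f.
    exp (1 / (\<alpha> * (\<integral>\<omega>. (cmod (H f \<omega>))\<^sup>2 \<partial>M))) *
    Ei_gen 1 (1 / (\<alpha> * (\<integral>\<omega>. (cmod (H f \<omega>))\<^sup>2 \<partial>M))))"
proof -
  obtain I where I: "ms_has_riemann_integral M
      (\<lambda>f \<omega>. log 2 (1 + \<alpha> * (cmod (H f \<omega>))\<^sup>2)) I (- W / 2) (W / 2)" and CI: "C = (\<integral>\<omega>. I \<omega> \<partial>M)"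
    using C by (auto simp: has_ergodic_capacity_def)
  have "L2_rv M (\<lambda>\<omega>. log 2 (1 + \<alpha> * (cmod (H f \<omega>))\<^sup>2))" for f
    using H[of f] \<alpha> by (intro L2_rv_log_one_plus_square) (simp_all add: circular_gaussian_def)
  from ms_has_riemann_integral_inner[OF this L2_rv_const[of 1] I]
  have "has_riemann_integral (\<lambda>f. \<integral>\<omega>. log 2 (1 + \<alpha> * (cmod (H f \<omega>))\<^sup>2) \<partial>M) C (- W / 2) (W / 2)"
    by (simp add: CI)
  from integral_unique[OF has_riemann_integral_imp_has_integral[OF this]] show ?thesis
    unfolding circular_gaussian_expected_log[OF H \<alpha>] integral_mult_right by simp
qed

text \<open>The integrand inherits mean-square continuity in f from H by the Lipschitz bound, with K
  the square of the Lipschitz constant; the weight in \<open>ms_riemann_integrable\<close> is the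
  constant 1.\<close>

lemma ergodic_capacity_exists:
  assumes H: "\<And>f. L2_rv M (H f)" and B: "\<And>f. (\<integral>\<omega>. (cmod (H f \<omega>))\<^sup>2 \<partial>M) \<le> B" and \<alpha>: "\<alpha> > 0"
    and cont: "\<And>e. e > 0 \<Longrightarrow> \<exists>d>0. \<forall>f f'. \<bar>f - f'\<bar> < d \<longrightarrow>
       (\<integral>\<omega>. (cmod (H f \<omega> - H f' \<omega>))\<^sup>2 \<partial>M) < e"
  shows "\<exists>C. has_ergodic_capacity M W \<alpha> H C"
proof -
  define K where "K = \<alpha> / (ln 2)\<^sup>2"
  have K: "K > 0" using \<alpha> by (simp add: K_def)
  let ?L = "\<lambda>f \<omega>. log 2 (1 + \<alpha> * (cmod (H f \<omega>))\<^sup>2)"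
  have B0: "B \<ge> 0" by (rule order_trans[OF _ B[of 0]]) simp
  have "\<exists>J. ms_has_riemann_integral M (\<lambda>f \<omega>. 1 *\<^sub>R ?L f \<omega>) J (- W / 2) (W / 2)"
  proof (rule ms_riemann_integrable[OF has_riemann_integral_const, where B = "K * B"])
    show "L2_rv M (?L f)" for f by (rule L2_rv_log_one_plus_square[OF H \<alpha>])
    show "0 \<le> K * B" using K B0 by simp
    show "(\<integral>\<omega>. (norm (?L f \<omega>))\<^sup>2 \<partial>M) \<le> K * B" for f
    proof -
      have "(\<integral>\<omega>. (norm (?L f \<omega>))\<^sup>2 \<partial>M) \<le> K * (\<integral>\<omega>. (cmod (H f \<omega>))\<^sup>2 \<partial>M)"
        using integral_square_log_diff_le[OF H L2_rv_const[of 0] \<alpha>, of f] by (simp add: K_def)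
      also have "\<dots> \<le> K * B" using K B by simp
      finally show ?thesis .
    qed
    fix e :: real assume "e > 0"
    then obtain d where d: "d > 0" "\<And>f f'. \<bar>f - f'\<bar> < d \<Longrightarrow> (\<integral>\<omega>. (cmod (H f \<omega> - H f' \<omega>))\<^sup>2 \<partial>M) < e / K"
      using cont[of "e / K"] K by auto
    have "(\<integral>\<omega>. (norm (?L x \<omega> - ?L y \<omega>))\<^sup>2 \<partial>M) < e" if "\<bar>x - y\<bar> < d" for x y
    proof -
      have "(\<integral>\<omega>. (norm (?L x \<omega> - ?L y \<omega>))\<^sup>2 \<partial>M) \<le> K * (\<integral>\<omega>. (cmod (H x \<omega> - H y \<omega>))\<^sup>2 \<partial>M)"
        using integral_square_log_diff_le[OF H H \<alpha>, of x y] by (simp add: K_def)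
      also have "\<dots> < e" using d(2)[OF that] K by (simp add: field_simps)
      finally show ?thesis .
    qed
    then show "\<exists>d>0. \<forall>x\<in>{- W / 2..W / 2}. \<forall>y\<in>{- W / 2..W / 2}. \<bar>x - y\<bar> < d \<longrightarrow>
       (\<integral>\<omega>. (norm (?L x \<omega> - ?L y \<omega>))\<^sup>2 \<partial>M) < e"
      using d(1) by blast
  qed
  then show ?thesis by (auto simp: has_ergodic_capacity_def)
qed

end

text \<open>Yields mean-square continuity of the transform in the frequency, where h is a multiple
  of the frequency difference. Dominated convergence concerns sequences, hence the argument by
  contradiction with a null sequence.\<close>

lemma integral_oscillating_tendsto_0:
  fixes q \<rho> :: "real \<Rightarrow> real"
  assumes q: "has_improper_riemann_integral q I" "\<And>x. q x \<ge> 0"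
    and \<rho>: "continuous_on UNIV \<rho>" "\<rho> 0 = 0" "\<And>x. \<bar>\<rho> x\<bar> \<le> B" and e: "e > 0"
  shows "\<exists>d>0. \<forall>h. \<bar>h\<bar> < d \<longrightarrow> integral UNIV (\<lambda>x. q x * \<rho> (h * x)) < e"
proof (rule ccontr)
  assume "\<not> ?thesis"
  then have "\<exists>h. \<bar>h\<bar> < d \<and> e \<le> integral UNIV (\<lambda>x. q x * \<rho> (h * x))" if "d > 0" for d
    using that by (meson not_le)
  then have "\<exists>h. \<bar>h\<bar> < inverse (real (Suc n)) \<and> e \<le> integral UNIV (\<lambda>x. q x * \<rho> (h * x))" for n
    by simp
  then obtain h where h: "\<And>n. \<bar>h n\<bar> < inverse (real (Suc n))"
    "\<And>n. e \<le> integral UNIV (\<lambda>x. q x * \<rho> (h n * x))"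
    by metis
  have h0: "h \<longlonglongrightarrow> 0"
    by (rule Lim_null_comparison[OF _ LIMSEQ_inverse_real_of_nat])
       (use h(1) in \<open>auto intro: always_eventually less_imp_le\<close>)
  have "(\<lambda>n. integral UNIV (\<lambda>x. q x * \<rho> (h n * x))) \<longlonglongrightarrow> integral UNIV (\<lambda>x. q x * \<rho> 0)"
  proof (rule dominated_convergence(2)[where h = "\<lambda>x. q x * B"])
    fix n
    have "continuous_on UNIV (\<lambda>x. \<rho> (h n * x))"
      by (rule continuous_on_compose2[OF \<rho>(1)]) (auto intro: continuous_intros)
    from improper_riemann_integrable_mult_continuous[OF q this \<rho>(3)]
    show "(\<lambda>x. q x * \<rho> (h n * x)) integrable_on UNIV"
      using has_improper_riemann_integral_imp_has_integral by (auto simp: integrable_on_def)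
  next
    show "(\<lambda>x. q x * B) integrable_on UNIV"
      using has_improper_riemann_integral_imp_has_integral[OF q(1)]
      by (intro integrable_on_mult_left) (auto simp: integrable_on_def)
    show "norm (q x * \<rho> (h n * x)) \<le> q x * B" for n x
      using q(2)[of x] \<rho>(3)[of "h n * x"] by (simp add: abs_mult mult_left_mono)
    show "(\<lambda>n. q x * \<rho> (h n * x)) \<longlonglongrightarrow> q x * \<rho> 0" for x
    proof (intro tendsto_intros)
      have "(\<lambda>n. h n * x) \<longlonglongrightarrow> 0" using tendsto_mult_right[OF h0, of x] by simp
      moreover have "isCont \<rho> 0" using \<rho>(1) by (simp add: continuous_on_eq_continuous_at)
      ultimately show "(\<lambda>n. \<rho> (h n * x)) \<longlonglongrightarrow> \<rho> 0"
        by (rule isCont_tendsto_compose[rotated])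
    qed
  qed
  then have "(\<lambda>n. integral UNIV (\<lambda>x. q x * \<rho> (h n * x))) \<longlonglongrightarrow> 0" by (simp add: \<rho>(2))
  from LIMSEQ_le_const[OF this] h(2) have "e \<le> 0" by blast
  then show False using e by simp
qed

subsection \<open>The fading channel\<close>

locale fading_channel = gaussian_pair M UNIV "\<lambda>s t. Rt (s - t)" X Y
  for M :: "'a measure" and Rt and X Y :: "real \<Rightarrow> 'a \<Rightarrow> real" +
  fixes g :: "real \<Rightarrow> real"
  assumes Rt: "continuous_on UNIV Rt" and g: "decay_function g"

lemma rayleigh_channel_fading_channel:
  assumes "prob_space M" "rayleigh_channel M Rt X Y" "decay_function g"
  shows "fading_channel M Rt X Y g"
  using assms
  unfolding fading_channel_def gaussian_pair_def gaussian_pair_axioms_def fading_channel_axioms_def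
    rayleigh_channel_def stationary_gaussian_def iid_processes_def
  by (auto simp: Let_def)

context fading_channel begin

text \<open>The Fourier integrand without its factor g: U is mean-square continuous in \<tau> and g
  only Riemann integrable, the splitting that \<open>ms_riemann_integrable\<close> asks for.\<close>

definition U :: "real \<Rightarrow> real \<Rightarrow> 'a \<Rightarrow> complex" where
  "U f \<tau> \<omega> = exp (- \<i> * complex_of_real (2 * pi * f * \<tau>)) * Complex (X \<tau> \<omega>) (Y \<tau> \<omega>)"

lemma U_eq: "U f \<tau> \<omega> = Complex (cos (2 * pi * f * \<tau>) * X \<tau> \<omega> + sin (2 * pi * f * \<tau>) * Y \<tau> \<omega>)
    (cos (2 * pi * f * \<tau>) * Y \<tau> \<omega> - sin (2 * pi * f * \<tau>) * X \<tau> \<omega>)"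
  by (simp add: U_def complex_eq_iff Re_exp Im_exp)

lemma impulse_response_eq:
  "exp (- \<i> * complex_of_real (2 * pi * f * \<tau>)) * impulse_response X Y g \<tau> \<omega> = g \<tau> *\<^sub>R U f \<tau> \<omega>"
  by (simp add: U_def impulse_response_def complex_eq_iff algebra_simps)

lemma is_fourier_transform_eq:
  "is_fourier_transform M (impulse_response X Y g) H \<longleftrightarrow>
     (\<forall>f. ms_has_improper_riemann_integral M (\<lambda>\<tau> \<omega>. g \<tau> *\<^sub>R U f \<tau> \<omega>) (H f))"
  unfolding is_fourier_transform_def impulse_response_eq ..

lemma L2_U: "L2_rv M (U f \<tau>)"
  using circular_gaussian_sum(1)[of "{()}" "\<lambda>_. \<tau>" "\<lambda>_. cos (2 * pi * f * \<tau>)" "\<lambda>_. sin (2 * pi * f * \<tau>)"]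
  by (simp add: circular_gaussian_def U_eq[abs_def])

lemma L2_gU: "L2_rv M (\<lambda>\<omega>. g \<tau> *\<^sub>R U f \<tau> \<omega>)"
  by (rule L2_rv_scaleR[OF L2_U])

lemma U_inner:
  "(\<integral>\<omega>. U f \<tau> \<omega> \<bullet> U f' \<tau>' \<omega> \<partial>M) = 2 * Rt (\<tau> - \<tau>') * cos (2 * pi * (f * \<tau> - f' * \<tau>'))"
proof -
  define c s c' s' where "c = cos (2 * pi * f * \<tau>)" and "s = sin (2 * pi * f * \<tau>)"
    and "c' = cos (2 * pi * f' * \<tau>')" and "s' = sin (2 * pi * f' * \<tau>')"
  note defs = c_def s_def c'_def s'_def
  have ints: "integrable M (\<lambda>\<omega>. X \<tau> \<omega> * X \<tau>' \<omega>)" "integrable M (\<lambda>\<omega>. Y \<tau> \<omega> * Y \<tau>' \<omega>)"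
    "integrable M (\<lambda>\<omega>. X \<tau> \<omega> * Y \<tau>' \<omega>)" "integrable M (\<lambda>\<omega>. Y \<tau> \<omega> * X \<tau>' \<omega>)"
    using L2_rv_integrable_inner[OF L2(1) L2(1), of \<tau> \<tau>'] L2_rv_integrable_inner[OF L2(2) L2(2), of \<tau> \<tau>']
      L2_rv_integrable_inner[OF L2(1) L2(2), of \<tau> \<tau>'] L2_rv_integrable_inner[OF L2(2) L2(1), of \<tau> \<tau>']
    by simp_all
  have "U f \<tau> \<omega> \<bullet> U f' \<tau>' \<omega> = (c * c' + s * s') * (X \<tau> \<omega> * X \<tau>' \<omega> + Y \<tau> \<omega> * Y \<tau>' \<omega>) +
      (c * s' - s * c') * (X \<tau> \<omega> * Y \<tau>' \<omega> - Y \<tau> \<omega> * X \<tau>' \<omega>)" for \<omega>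
    unfolding U_eq inner_complex_def complex.sel defs[symmetric] by (simp add: algebra_simps)
  moreover have "(\<integral>\<omega>. Y \<tau> \<omega> * X \<tau>' \<omega> \<partial>M) = 0"
    using cross_moment[of \<tau>' \<tau>] by (simp add: mult.commute)
  ultimately have "(\<integral>\<omega>. U f \<tau> \<omega> \<bullet> U f' \<tau>' \<omega> \<partial>M) = (c * c' + s * s') * (2 * Rt (\<tau> - \<tau>'))"
    using ints by (simp add: cov cross_moment)
  also have "c * c' + s * s' = cos (2 * pi * (f * \<tau> - f' * \<tau>'))"
    by (simp add: defs cos_diff right_diff_distrib mult.assoc)
  finally show ?thesis by simp
qed

lemma U_second_moment: "(\<integral>\<omega>. (cmod (U f \<tau> \<omega>))\<^sup>2 \<partial>M) = 2 * Rt 0"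
  using U_inner[of f \<tau> f \<tau>] by (simp add: power2_norm_eq_inner)

lemma Rt_0_nonneg: "Rt 0 \<ge> 0"
proof -
  have "0 \<le> (\<integral>\<omega>. (cmod (U 0 0 \<omega>))\<^sup>2 \<partial>M)" by simp
  then show ?thesis by (simp add: U_second_moment)
qed

lemma U_inner_bound:
  assumes V: "L2_rv M V"
  shows "\<bar>\<integral>\<omega>. (g \<tau> *\<^sub>R U f \<tau> \<omega>) \<bullet> V \<omega> \<partial>M\<bar> \<le>
    \<bar>g \<tau>\<bar> * (sqrt (2 * Rt 0) * sqrt (\<integral>\<omega>. (cmod (V \<omega>))\<^sup>2 \<partial>M))"
  using mult_left_mono[OF L2_rv_Cauchy_Schwarz[OF L2_U V, of f \<tau>] abs_ge_zero[of "g \<tau>"]]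
  by (simp add: abs_mult U_second_moment)

text \<open>Changing the frequency multiplies U by a phase, so the difference is U scaled by the
  distance of that phase from 1.\<close>

lemma U_diff_inner_bound:
  assumes V: "L2_rv M V"
  shows "\<bar>\<integral>\<omega>. (g \<tau> *\<^sub>R (U f \<tau> \<omega> - U f' \<tau> \<omega>)) \<bullet> V \<omega> \<partial>M\<bar> \<le>
    \<bar>g \<tau>\<bar> * cmod (iexp (2 * pi * (f - f') * \<tau>) - 1) *
      (sqrt (2 * Rt 0) * sqrt (\<integral>\<omega>. (cmod (V \<omega>))\<^sup>2 \<partial>M))"
proof -
  define k where "k = cmod (iexp (2 * pi * (f - f') * \<tau>) - 1)"
  have "U f' \<tau> \<omega> = iexp (2 * pi * (f - f') * \<tau>) * U f \<tau> \<omega>" for \<omega>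
    unfolding U_def mult.assoc[symmetric] exp_add[symmetric] by (simp add: algebra_simps)
  then have "cmod (U f \<tau> \<omega> - U f' \<tau> \<omega>) = k * cmod (U f \<tau> \<omega>)" for \<omega>
    unfolding k_def norm_mult[symmetric] by (subst norm_minus_commute) (simp add: algebra_simps)
  then have "(\<integral>\<omega>. (cmod (U f \<tau> \<omega> - U f' \<tau> \<omega>))\<^sup>2 \<partial>M) = k\<^sup>2 * (2 * Rt 0)"
    by (simp add: power_mult_distrib U_second_moment)
  then have "sqrt (\<integral>\<omega>. (cmod (U f \<tau> \<omega> - U f' \<tau> \<omega>))\<^sup>2 \<partial>M) = k * sqrt (2 * Rt 0)"
    by (simp add: real_sqrt_mult k_def)
  then show ?thesis
    using mult_left_mono[OF L2_rv_Cauchy_Schwarz[OF L2_rv_diff[OF L2_U L2_U] V, of f \<tau> f' \<tau>] abs_ge_zero[of "g \<tau>"]]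
    unfolding k_def[symmetric] by (simp add: abs_mult mult.assoc)
qed

section \<open>Distribution and second moment of the Fourier transform\<close>

lemma circular_gaussian_integral:
  assumes "ms_has_riemann_integral M (\<lambda>\<tau> \<omega>. g \<tau> *\<^sub>R U f \<tau> \<omega>) J a b"
  shows "circular_gaussian M J"
proof (rule circular_gaussian_limit[OF riemann_filter_nontrivial assms[unfolded ms_has_riemann_integral_def]])
  have "circular_gaussian M (\<lambda>\<omega>. \<Sum>(x, K)\<in>p. measure lborel K *\<^sub>R g x *\<^sub>R U f x \<omega>)"
    if "p tagged_division_of {a..b}" for p
  proof -
    define \<alpha> where "\<alpha> i = measure lborel (snd i) * g (fst i) * cos (2 * pi * f * fst i)" for i :: "real \<times> real set"
    define \<beta> where "\<beta> i = measure lborel (snd i) * g (fst i) * sin (2 * pi * f * fst i)" for i :: "real \<times> real set"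
    have "(\<Sum>(x, K)\<in>p. measure lborel K *\<^sub>R g x *\<^sub>R U f x \<omega>) =
      Complex (\<Sum>i\<in>p. \<alpha> i * X (fst i) \<omega> + \<beta> i * Y (fst i) \<omega>) (\<Sum>i\<in>p. \<alpha> i * Y (fst i) \<omega> - \<beta> i * X (fst i) \<omega>)" for \<omega>
      by (simp add: complex_eq_iff U_eq case_prod_beta \<alpha>_def \<beta>_def algebra_simps)
    then show ?thesis
      using circular_gaussian_sum(1)[of p fst \<alpha> \<beta>] tagged_division_of_finite[OF that] by simp
  qed
  then show "\<forall>\<^sub>F p in riemann_filter a b.
      circular_gaussian M (\<lambda>\<omega>. \<Sum>(x, K)\<in>p. measure lborel K *\<^sub>R g x *\<^sub>R U f x \<omega>)"
    unfolding eventually_riemann_filter by (intro exI[of _ 1]) auto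
qed

lemma circular_gaussian_improper_integral:
  assumes "ms_has_improper_riemann_integral M (\<lambda>\<tau> \<omega>. g \<tau> *\<^sub>R U f \<tau> \<omega>) H"
  shows "circular_gaussian M H"
proof -
  obtain J where J: "\<And>a b. ms_has_riemann_integral M (\<lambda>\<tau> \<omega>. g \<tau> *\<^sub>R U f \<tau> \<omega>) (J a b) a b"
    and lim: "ms_tendsto M (\<lambda>(a, b). J a b) H (at_bot \<times>\<^sub>F at_top)"
    using assms by (auto simp: ms_has_improper_riemann_integral_def)
  show ?thesis
    by (rule circular_gaussian_limit[OF improper_filter_nontrivial lim])
       (use circular_gaussian_integral[OF J] in \<open>auto simp: case_prod_beta\<close>)
qed

lemma decay_function_eq_0: "x < 0 \<Longrightarrow> g x = 0"
  using g by (auto simp: decay_function_def)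

lemma sigma2_hat_eq:
  assumes H: "ms_has_improper_riemann_integral M (\<lambda>\<tau> \<omega>. g \<tau> *\<^sub>R U f \<tau> \<omega>) H"
  shows "2 * sigma2_hat Rt g f = (\<integral>\<omega>. (cmod (H \<omega>))\<^sup>2 \<partial>M)"
proof -
  have L2H: "L2_rv M H" using circular_gaussian_improper_integral[OF H] by (simp add: circular_gaussian_def)
  define F where "F \<tau> \<tau>' = channel_cov Rt g \<tau> \<tau>' * cos (2 * pi * (\<tau> - \<tau>') * f)" for \<tau> \<tau>'
  \<comment> \<open>Testing gives integrals over the whole line; they agree with those over the
    half-line because g vanishes on the negative numbers.\<close>
  have double: "2 * integral {0..} h = I"
    if "((\<lambda>x. 2 * h x) has_integral I) UNIV" "\<And>x. x < 0 \<Longrightarrow> h x = 0" for h :: "real \<Rightarrow> real" and I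
  proof -
    have "(\<lambda>x. if x \<in> {0..} then h x else 0) = h" using that(2) by (auto simp: fun_eq_iff)
    then have "integral {0..} h = integral UNIV h" using integral_restrict_UNIV[of "{0..}" h] by (simp only:)
    then show ?thesis using integral_unique[OF that(1)] by simp
  qed
  have EF: "(\<integral>\<omega>. (g \<tau> *\<^sub>R U f \<tau> \<omega>) \<bullet> (g \<tau>' *\<^sub>R U f \<tau>' \<omega>) \<partial>M) = 2 * F \<tau> \<tau>'" for \<tau> \<tau>'
    by (simp add: U_inner F_def channel_cov_def algebra_simps)
  \<comment> \<open>For each fixed \<tau>' the integral defining H is tested against the integrand
    at \<tau>'.\<close>
  have "((\<lambda>\<tau>. 2 * F \<tau> \<tau>') has_integral (\<integral>\<omega>. H \<omega> \<bullet> (g \<tau>' *\<^sub>R U f \<tau>' \<omega>) \<partial>M)) UNIV" for \<tau>'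
    using has_improper_riemann_integral_imp_has_integral[OF
        ms_has_improper_riemann_integral_inner[OF L2_gU L2_gU[where f = f and \<tau> = \<tau>'] H]]
    by (simp only: EF)
  then have inner: "2 * integral {0..} (\<lambda>\<tau>. F \<tau> \<tau>') = (\<integral>\<omega>. (g \<tau>' *\<^sub>R U f \<tau>' \<omega>) \<bullet> H \<omega> \<partial>M)" for \<tau>'
    unfolding inner_commute[of _ "H _"]
    by (rule double) (simp add: F_def channel_cov_def decay_function_eq_0)
  \<comment> \<open>The inner integral has become an inner product with H, so the outer integration
    is again a test, now of H against itself.\<close>
  have "((\<lambda>\<tau>'. 2 * integral {0..} (\<lambda>\<tau>. F \<tau> \<tau>')) has_integral (\<integral>\<omega>. H \<omega> \<bullet> H \<omega> \<partial>M)) UNIV"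
    unfolding inner
    by (rule has_improper_riemann_integral_imp_has_integral[OF
        ms_has_improper_riemann_integral_inner[OF L2_gU L2H H]])
  then have "2 * integral {0..} (\<lambda>\<tau>'. integral {0..} (\<lambda>\<tau>. F \<tau> \<tau>')) = (\<integral>\<omega>. H \<omega> \<bullet> H \<omega> \<partial>M)"
    by (rule double) (simp add: F_def channel_cov_def decay_function_eq_0)
  then show ?thesis by (simp add: sigma2_hat_def F_def power2_norm_eq_inner)
qed

lemma ms_integrable: "\<exists>J. ms_has_riemann_integral M (\<lambda>\<tau> \<omega>. g \<tau> *\<^sub>R U f \<tau> \<omega>) J a b"
proof -
  obtain I where I: "has_riemann_integral g I a b"
    using g by (auto simp: decay_function_def has_improper_riemann_integral_def)
  show ?thesis
  proof (rule ms_riemann_integrable[OF I L2_U, where B = "2 * Rt 0"])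
    show "0 \<le> 2 * Rt 0" using Rt_0_nonneg by simp
    show "(\<integral>\<omega>. (norm (U f x \<omega>))\<^sup>2 \<partial>M) \<le> 2 * Rt 0" for x by (simp add: U_second_moment)
    fix e :: real assume e: "e > 0"
    \<comment> \<open>By stationarity the mean-square distance of U at two times depends only on
      their difference, so continuity of Rt at 0 gives uniform mean-square continuity.\<close>
    define \<phi> where "\<phi> h = 4 * Rt 0 - 4 * Rt h * cos (2 * pi * f * h)" for h
    have D: "(\<integral>\<omega>. (norm (U f x \<omega> - U f y \<omega>))\<^sup>2 \<partial>M) = \<phi> (x - y)" for x y
    proof -
      have "2 * pi * (f * x - f * y) = 2 * pi * f * (x - y)" by (simp add: algebra_simps)
      then show ?thesis
        unfolding L2_rv_integral_square_diff[OF L2_U L2_U] U_second_moment U_inner \<phi>_def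
        by (simp only:)
    qed
    have "isCont Rt 0" using Rt by (simp add: continuous_on_eq_continuous_at)
    then have "isCont \<phi> 0" unfolding \<phi>_def by (intro continuous_intros)
    then obtain d where d: "d > 0" "\<And>h. \<bar>h\<bar> < d \<Longrightarrow> \<bar>\<phi> h\<bar> < e"
      using e unfolding continuous_at_eps_delta by (auto simp: \<phi>_def dist_real_def)
    show "\<exists>d>0. \<forall>x\<in>{a..b}. \<forall>y\<in>{a..b}. \<bar>x - y\<bar> < d \<longrightarrow> (\<integral>\<omega>. (norm (U f x \<omega> - U f y \<omega>))\<^sup>2 \<partial>M) < e"
      unfolding D using d by (intro exI[of _ d]) force
  qed
qed

end

section \<open>Existence of the transform and the capacity for absolutely integrable decay
  functions\<close>

lemma integral_diff_subset_le:
  fixes h q :: "real \<Rightarrow> real"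
  assumes S: "S \<subseteq> S'" and h: "h integrable_on S" "h integrable_on S'"
    and q: "q integrable_on S" "q integrable_on S'" and le: "\<And>x. \<bar>h x\<bar> \<le> q x"
  shows "\<bar>integral S' h - integral S h\<bar> \<le> integral S' q - integral S q"
proof -
  have "q x - h x \<ge> 0" "q x + h x \<ge> 0" for x using le[of x] by auto
  then have "integral S (\<lambda>x. q x - h x) \<le> integral S' (\<lambda>x. q x - h x)"
    "integral S (\<lambda>x. q x + h x) \<le> integral S' (\<lambda>x. q x + h x)"
    using S h q by (intro integral_subset_le integrable_diff integrable_add; simp)+
  then show ?thesis using h q by (simp add: integral_diff integral_add)
qed

context fading_channel begin

context
  fixes I assumes abs_g: "has_improper_riemann_integral (\<lambda>\<tau>. \<bar>g \<tau>\<bar>) I"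
begin

lemma abs_g_integral: "((\<lambda>\<tau>. \<bar>g \<tau>\<bar>) has_integral I) UNIV"
  by (rule has_improper_riemann_integral_imp_has_integral[OF abs_g])

lemma abs_g_integrable: "(\<lambda>\<tau>. \<bar>g \<tau>\<bar>) integrable_on {a..b}"
  using abs_g_integral by (meson has_integral_integrable integrable_on_subinterval subset_UNIV)

text \<open>A bound for \<open>V\<close> in mean square follows by testing \<open>V\<close> against itself.\<close>

lemma ms_integral_diff_bound:
  assumes J: "ms_has_riemann_integral M (\<lambda>\<tau> \<omega>. g \<tau> *\<^sub>R U f \<tau> \<omega>) J a b"
    and J': "ms_has_riemann_integral M (\<lambda>\<tau> \<omega>. g \<tau> *\<^sub>R U f \<tau> \<omega>) J' a' b'"
    and sub: "{a..b} \<subseteq> {a'..b'}"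
  shows "(\<integral>\<omega>. (cmod (J' \<omega> - J \<omega>))\<^sup>2 \<partial>M) \<le>
    (sqrt (2 * Rt 0) * (I - integral {a..b} (\<lambda>\<tau>. \<bar>g \<tau>\<bar>)))\<^sup>2"
proof -
  have L2J: "L2_rv M J" "L2_rv M J'"
    using J J' by (auto simp: ms_has_riemann_integral_def ms_tendsto_def)
  define V where "V \<omega> = J' \<omega> - J \<omega>" for \<omega>
  define N where "N = sqrt (\<integral>\<omega>. (cmod (V \<omega>))\<^sup>2 \<partial>M)"
  define h where "h \<tau> = (\<integral>\<omega>. (g \<tau> *\<^sub>R U f \<tau> \<omega>) \<bullet> V \<omega> \<partial>M)" for \<tau>
  have V: "L2_rv M V" unfolding V_def by (rule L2_rv_diff[OF L2J(2,1)])
  have N0: "N \<ge> 0" by (simp add: N_def)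
  let ?k = "sqrt (2 * Rt 0)"
  have hJ: "(h has_integral (\<integral>\<omega>. J \<omega> \<bullet> V \<omega> \<partial>M)) {a..b}"
    unfolding h_def
    by (intro has_riemann_integral_imp_has_integral ms_has_riemann_integral_inner L2_gU V J)
  have hJ': "(h has_integral (\<integral>\<omega>. J' \<omega> \<bullet> V \<omega> \<partial>M)) {a'..b'}"
    unfolding h_def
    by (intro has_riemann_integral_imp_has_integral ms_has_riemann_integral_inner L2_gU V J')
  have "N\<^sup>2 = (\<integral>\<omega>. (J' \<omega> - J \<omega>) \<bullet> V \<omega> \<partial>M)"
    by (simp add: N_def power2_norm_eq_inner V_def)
  also have "\<dots> = integral {a'..b'} h - integral {a..b} h"
    using L2J V by (simp add: inner_diff_left L2_rv_integrable_inner integral_unique[OF hJ] integral_unique[OF hJ'])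
  also have "\<dots> \<le> \<bar>integral {a'..b'} h - integral {a..b} h\<bar>" by simp
  also have "\<dots> \<le> integral {a'..b'} (\<lambda>\<tau>. \<bar>g \<tau>\<bar> * (?k * N)) - integral {a..b} (\<lambda>\<tau>. \<bar>g \<tau>\<bar> * (?k * N))"
  proof (intro integral_diff_subset_le integrable_on_mult_left abs_g_integrable sub)
    show "\<bar>h x\<bar> \<le> \<bar>g x\<bar> * (?k * N)" for x
      unfolding h_def N_def by (rule U_inner_bound[OF V])
  qed (use hJ hJ' in \<open>auto simp: integrable_on_def\<close>)
  also have "\<dots> = (integral {a'..b'} (\<lambda>\<tau>. \<bar>g \<tau>\<bar>) - integral {a..b} (\<lambda>\<tau>. \<bar>g \<tau>\<bar>)) * (?k * N)"
    by (simp add: left_diff_distrib)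
  also have "\<dots> \<le> (I - integral {a..b} (\<lambda>\<tau>. \<bar>g \<tau>\<bar>)) * (?k * N)"
  proof (intro mult_right_mono diff_right_mono)
    have "integral {a'..b'} (\<lambda>\<tau>. \<bar>g \<tau>\<bar>) \<le> integral UNIV (\<lambda>\<tau>. \<bar>g \<tau>\<bar>)"
      using abs_g_integral abs_g_integrable by (intro integral_subset_le) (auto simp: integrable_on_def)
    then show "integral {a'..b'} (\<lambda>\<tau>. \<bar>g \<tau>\<bar>) \<le> I" by (simp add: integral_unique[OF abs_g_integral])
  qed (use N0 Rt_0_nonneg in auto)
  finally have "N * N \<le> ?k * (I - integral {a..b} (\<lambda>\<tau>. \<bar>g \<tau>\<bar>)) * N"
    by (simp add: power2_eq_square mult_ac)
  \<comment> \<open>Both sides contain N because V is tested against itself; cancelling it leaves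
    the bound on the norm.\<close>
  then have "N \<le> ?k * (I - integral {a..b} (\<lambda>\<tau>. \<bar>g \<tau>\<bar>)) \<or> N = 0"
    using N0 by (auto simp: mult_le_cancel_right)
  then have "N\<^sup>2 \<le> (?k * (I - integral {a..b} (\<lambda>\<tau>. \<bar>g \<tau>\<bar>)))\<^sup>2"
    using N0 by (auto intro: power_mono)
  then show ?thesis by (simp add: N_def V_def)
qed

lemma ms_improper_integrable: "\<exists>H. ms_has_improper_riemann_integral M (\<lambda>\<tau> \<omega>. g \<tau> *\<^sub>R U f \<tau> \<omega>) H"
proof -
  obtain J where J: "\<And>a b. ms_has_riemann_integral M (\<lambda>\<tau> \<omega>. g \<tau> *\<^sub>R U f \<tau> \<omega>) (J a b) a b"
    using ms_integrable by metis
  then have L2J: "L2_rv M (J a b)" for a b by (auto simp: ms_has_riemann_integral_def ms_tendsto_def)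
  have "\<exists>H. ms_tendsto M (\<lambda>(a, b). J a b) H (at_bot \<times>\<^sub>F at_top)"
  proof (rule L2_complete[OF improper_filter_nontrivial])
    show "L2_rv M (case x of (a, b) \<Rightarrow> J a b)" for x using L2J by (simp add: case_prod_beta)
    fix e :: real assume e: "e > 0"
    have "((\<lambda>(a, b). integral {a..b} (\<lambda>\<tau>. \<bar>g \<tau>\<bar>)) \<longlongrightarrow> I) (at_bot \<times>\<^sub>F at_top)"
      by (rule tendsto_integral_improper[OF abs_g_integral])
    then have "((\<lambda>x. (sqrt (2 * Rt 0) * (I - (case x of (a, b) \<Rightarrow> integral {a..b} (\<lambda>\<tau>. \<bar>g \<tau>\<bar>))))\<^sup>2) \<longlongrightarrow>
        (sqrt (2 * Rt 0) * (I - I))\<^sup>2) (at_bot \<times>\<^sub>F at_top)"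
      by (intro tendsto_intros)
    \<comment> \<open>One interval with a small tail serves as reference: larger intervals are
      compared through it, and the factors 2 of the squared triangle inequality turn quarters into
      e.\<close>
    then have "\<forall>\<^sub>F x in at_bot \<times>\<^sub>F at_top.
        (sqrt (2 * Rt 0) * (I - (case x of (a, b) \<Rightarrow> integral {a..b} (\<lambda>\<tau>. \<bar>g \<tau>\<bar>))))\<^sup>2 < e / 4"
      using e by (intro order_tendstoD(2)[of _ "0"]) simp_all
    from eventually_happens'[OF improper_filter_nontrivial this]
    obtain a b where ab: "(sqrt (2 * Rt 0) * (I - integral {a..b} (\<lambda>\<tau>. \<bar>g \<tau>\<bar>)))\<^sup>2 < e / 4" by auto
    define P where "P x \<longleftrightarrow> fst x \<le> a \<and> b \<le> snd x" for x :: "real \<times> real"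
    have "eventually P (at_bot \<times>\<^sub>F at_top)"
      unfolding P_def eventually_prod_filter
      by (intro exI[of _ "\<lambda>x. x \<le> a"] exI[of _ "\<lambda>x. b \<le> x"])
         (auto simp: eventually_le_at_bot eventually_ge_at_top)
    moreover have "(\<integral>\<omega>. (norm ((case x of (a, b) \<Rightarrow> J a b) \<omega> - (case y of (a, b) \<Rightarrow> J a b) \<omega>))\<^sup>2 \<partial>M) < e"
      if "P x" "P y" for x y
    proof -
      have *: "(\<integral>\<omega>. (cmod (J (fst z) (snd z) \<omega> - J a b \<omega>))\<^sup>2 \<partial>M) < e / 4" if "P z" for z
        using ms_integral_diff_bound[OF J J, of a b "fst z" "snd z"] ab that
        by (auto simp: P_def)
      have "(\<integral>\<omega>. (cmod (J (fst x) (snd x) \<omega> - J (fst y) (snd y) \<omega>))\<^sup>2 \<partial>M) < e"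
        using L2_rv_square_triangle[OF L2J L2J L2J, of "fst x" "snd x" "fst y" "snd y" a b]
          *[OF that(1)] *[OF that(2)]
        by (simp add: norm_minus_commute[of "J a b _"])
      then show ?thesis by (simp add: case_prod_beta)
    qed
    ultimately show "\<exists>P. eventually P (at_bot \<times>\<^sub>F at_top) \<and> (\<forall>x y. P x \<longrightarrow> P y \<longrightarrow>
        (\<integral>\<omega>. (norm ((case x of (a, b) \<Rightarrow> J a b) \<omega> - (case y of (a, b) \<Rightarrow> J a b) \<omega>))\<^sup>2 \<partial>M) < e)"
      by blast
  qed
  then show ?thesis
    unfolding ms_has_improper_riemann_integral_def using J by blast
qed

text \<open>A norm bound by duality: h is the integrand tested against V, its integral is the
  squared norm of V, and its bound is linear in that norm, so one factor cancels. The absolute value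
  keeps the right side nonnegative when V vanishes.\<close>

lemma L2_norm_le_integral:
  assumes V: "L2_rv M V" and h: "(h has_integral (\<integral>\<omega>. (cmod (V \<omega>))\<^sup>2 \<partial>M)) UNIV"
    and q: "q integrable_on UNIV"
    and le: "\<And>\<tau>. \<bar>h \<tau>\<bar> \<le> q \<tau> * (sqrt (2 * Rt 0) * sqrt (\<integral>\<omega>. (cmod (V \<omega>))\<^sup>2 \<partial>M))"
  shows "sqrt (\<integral>\<omega>. (cmod (V \<omega>))\<^sup>2 \<partial>M) \<le> sqrt (2 * Rt 0) * \<bar>integral UNIV q\<bar>"
proof -
  define N where "N = sqrt (\<integral>\<omega>. (cmod (V \<omega>))\<^sup>2 \<partial>M)"
  let ?k = "sqrt (2 * Rt 0)"
  have N0: "N \<ge> 0" by (simp add: N_def)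
  have "N\<^sup>2 = integral UNIV h" using integral_unique[OF h] by (simp add: N_def)
  also have "\<dots> \<le> integral UNIV (\<lambda>\<tau>. q \<tau> * (?k * N))"
  proof (rule integral_le)
    show "h \<tau> \<le> q \<tau> * (?k * N)" for \<tau> using le[of \<tau>] by (simp add: N_def)
    show "h integrable_on UNIV" using h by (auto simp: integrable_on_def)
    show "(\<lambda>\<tau>. q \<tau> * (?k * N)) integrable_on UNIV" by (rule integrable_on_mult_left[OF q])
  qed
  also have "\<dots> = integral UNIV q * (?k * N)" by simp
  also have "\<dots> \<le> \<bar>integral UNIV q\<bar> * (?k * N)"
    using N0 Rt_0_nonneg by (intro mult_right_mono) auto
  finally have "N * N \<le> ?k * \<bar>integral UNIV q\<bar> * N" by (simp add: power2_eq_square mult_ac)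
  then show ?thesis
    using N0 Rt_0_nonneg unfolding N_def[symmetric] by (cases "N = 0") (auto simp: mult_le_cancel_right)
qed

text \<open>Boundedness and mean-square continuity of H in f are both instances of
  \<open>L2_norm_le_integral\<close>, with V the transform itself and the difference of two
  transforms.\<close>

lemma ergodic_capacity_fading_exists:
  assumes H: "\<And>f. ms_has_improper_riemann_integral M (\<lambda>\<tau> \<omega>. g \<tau> *\<^sub>R U f \<tau> \<omega>) (H f)" and \<alpha>: "\<alpha> > 0"
  shows "\<exists>C. has_ergodic_capacity M W \<alpha> H C"
proof (rule ergodic_capacity_exists[OF _ _ \<alpha>])
  show L2H: "L2_rv M (H f)" for f
    using circular_gaussian_improper_integral[OF H] by (simp add: circular_gaussian_def)
  let ?k = "sqrt (2 * Rt 0)"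
  have hi: "((\<lambda>\<tau>. \<integral>\<omega>. (g \<tau> *\<^sub>R U f \<tau> \<omega>) \<bullet> V \<omega> \<partial>M) has_integral (\<integral>\<omega>. H f \<omega> \<bullet> V \<omega> \<partial>M)) UNIV"
    if "L2_rv M V" for f V
    by (rule has_improper_riemann_integral_imp_has_integral[OF
        ms_has_improper_riemann_integral_inner[OF L2_gU that H]])
  have sq: "x \<le> y\<^sup>2" if "sqrt x \<le> y" for x y :: real
    using that by (rule sqrt_le_D)
  show "(\<integral>\<omega>. (cmod (H f \<omega>))\<^sup>2 \<partial>M) \<le> (?k * \<bar>integral UNIV (\<lambda>\<tau>. \<bar>g \<tau>\<bar>)\<bar>)\<^sup>2" for f
    using hi[OF L2H, of f f] U_inner_bound[OF L2H] abs_g_integral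
    by (intro sq L2_norm_le_integral[OF L2H]) (auto simp: power2_norm_eq_inner integrable_on_def)
  fix e :: real assume e: "e > 0"
  \<comment> \<open>The factor by which a change of frequency alters U; it is bounded by 2 and
    vanishes at 0.\<close>
  define \<rho> where "\<rho> x = cmod (iexp x - 1)" for x :: real
  have \<rho>: "continuous_on UNIV \<rho>" "\<rho> 0 = 0" "\<bar>\<rho> x\<bar> \<le> 2" for x
    using norm_triangle_ineq4[of "iexp x" 1] by (auto simp: \<rho>_def intro!: continuous_intros)
  have q: "(\<lambda>\<tau>. \<bar>g \<tau>\<bar> * \<rho> (2 * pi * h * \<tau>)) integrable_on UNIV" for h
  proof -
    have "continuous_on UNIV (\<lambda>\<tau>. \<rho> (2 * pi * h * \<tau>))"
      by (rule continuous_on_compose2[OF \<rho>(1)]) (auto intro: continuous_intros)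
    from improper_riemann_integrable_mult_continuous[OF abs_g _ this \<rho>(3)]
    show ?thesis using has_improper_riemann_integral_imp_has_integral by (auto simp: integrable_on_def)
  qed
  have diff: "sqrt (\<integral>\<omega>. (cmod (H f \<omega> - H f' \<omega>))\<^sup>2 \<partial>M) \<le>
      ?k * \<bar>integral UNIV (\<lambda>\<tau>. \<bar>g \<tau>\<bar> * \<rho> (2 * pi * (f - f') * \<tau>))\<bar>" for f f'
  proof -
    define V where "V \<omega> = H f \<omega> - H f' \<omega>" for \<omega>
    have V: "L2_rv M V" unfolding V_def by (rule L2_rv_diff[OF L2H L2H])
    have "((\<lambda>\<tau>. (\<integral>\<omega>. (g \<tau> *\<^sub>R U f \<tau> \<omega>) \<bullet> V \<omega> \<partial>M) - (\<integral>\<omega>. (g \<tau> *\<^sub>R U f' \<tau> \<omega>) \<bullet> V \<omega> \<partial>M)) has_integral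
        (\<integral>\<omega>. H f \<omega> \<bullet> V \<omega> \<partial>M) - (\<integral>\<omega>. H f' \<omega> \<bullet> V \<omega> \<partial>M)) UNIV"
      by (intro has_integral_diff hi V)
    moreover have "(\<integral>\<omega>. (g \<tau> *\<^sub>R U f \<tau> \<omega>) \<bullet> V \<omega> \<partial>M) - (\<integral>\<omega>. (g \<tau> *\<^sub>R U f' \<tau> \<omega>) \<bullet> V \<omega> \<partial>M) =
        (\<integral>\<omega>. (g \<tau> *\<^sub>R (U f \<tau> \<omega> - U f' \<tau> \<omega>)) \<bullet> V \<omega> \<partial>M)" for \<tau>
      by (simp add: inner_diff_left right_diff_distrib L2_rv_integrable_inner[OF L2_U V])
    moreover have "(\<integral>\<omega>. H f \<omega> \<bullet> V \<omega> \<partial>M) - (\<integral>\<omega>. H f' \<omega> \<bullet> V \<omega> \<partial>M) = (\<integral>\<omega>. (cmod (V \<omega>))\<^sup>2 \<partial>M)"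
    proof -
      have "(cmod (V \<omega>))\<^sup>2 = H f \<omega> \<bullet> V \<omega> - H f' \<omega> \<bullet> V \<omega>" for \<omega>
        unfolding power2_norm_eq_inner inner_diff_left[symmetric] V_def ..
      then show ?thesis by (simp add: L2_rv_integrable_inner[OF L2H V])
    qed
    ultimately have "((\<lambda>\<tau>. \<integral>\<omega>. (g \<tau> *\<^sub>R (U f \<tau> \<omega> - U f' \<tau> \<omega>)) \<bullet> V \<omega> \<partial>M) has_integral
        (\<integral>\<omega>. (cmod (V \<omega>))\<^sup>2 \<partial>M)) UNIV"
      by (simp only:)
    from L2_norm_le_integral[OF V this q[of "f - f'"]]
    show ?thesis
      unfolding V_def[symmetric] using U_diff_inner_bound[OF V, of _ f f', folded \<rho>_def] by blast
  qed
  \<comment> \<open>The summand 1 avoids division by zero when \<open>Rt 0 = 0\<close>.\<close>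
  define e' where "e' = sqrt e / (?k + 1)"
  have k1: "?k + 1 > 0" using Rt_0_nonneg by (simp add: add_nonneg_pos)
  then have "e' > 0" using e by (simp add: e'_def)
  then obtain d where d: "d > 0" "\<And>h. \<bar>h\<bar> < d \<Longrightarrow> integral UNIV (\<lambda>\<tau>. \<bar>g \<tau>\<bar> * \<rho> (h * \<tau>)) < e'"
    using integral_oscillating_tendsto_0[OF abs_g _ \<rho>] by auto
  \<comment> \<open>The phase depends on \<open>2 * pi * (f - f')\<close>, hence the division of d
    by \<open>2 * pi\<close>.\<close>
  have "(\<integral>\<omega>. (cmod (H f \<omega> - H f' \<omega>))\<^sup>2 \<partial>M) < e" if "\<bar>f - f'\<bar> < d / (2 * pi)" for f f'
  proof -
    let ?i = "integral UNIV (\<lambda>\<tau>. \<bar>g \<tau>\<bar> * \<rho> (2 * pi * (f - f') * \<tau>))"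
    have "?i \<ge> 0" by (rule integral_nonneg[OF q]) (simp add: \<rho>_def)
    moreover have "?i < e'"
      proof (rule d(2))
        have "\<bar>2 * pi * (f - f')\<bar> = 2 * pi * \<bar>f - f'\<bar>" by (simp add: abs_mult)
        also have "\<dots> < d" using that by (simp add: pos_less_divide_eq mult.commute)
        finally show "\<bar>2 * pi * (f - f')\<bar> < d" .
      qed
    ultimately have "?k * \<bar>?i\<bar> \<le> ?k * e'" using Rt_0_nonneg by (intro mult_left_mono) auto
    also have "\<dots> < (?k + 1) * e'" using \<open>e' > 0\<close> by simp
    also have "\<dots> = sqrt e" using k1 by (simp add: e'_def)
    finally have "sqrt (\<integral>\<omega>. (cmod (H f \<omega> - H f' \<omega>))\<^sup>2 \<partial>M) < sqrt e"
      by (rule le_less_trans[OF diff])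
    then show ?thesis by simp
  qed
  then show "\<exists>d>0. \<forall>f f'. \<bar>f - f'\<bar> < d \<longrightarrow> (\<integral>\<omega>. (cmod (H f \<omega> - H f' \<omega>))\<^sup>2 \<partial>M) < e"
    using d(1) by (intro exI[of _ "d / (2 * pi)"]) auto
qed

end

end

subsection \<open>Uncorrelated scattering\<close>

locale white_channel = gaussian_pair M test_functions
    "\<lambda>\<phi> \<psi>. double_integral (\<lambda>\<phi>. ct * dirac_delta \<phi>) (\<lambda>\<tau> \<tau>'. \<phi> \<tau> * \<psi> \<tau>')" X Y
  for M :: "'a measure" and ct :: real and X Y :: "(real \<Rightarrow> real) \<Rightarrow> 'a \<Rightarrow> real" +
  fixes g :: "real \<Rightarrow> real"
  assumes ct: "ct > 0" and g: "decay_function g"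

lemma gen_rayleigh_channel_white_channel:
  assumes "prob_space M" "gen_rayleigh_channel M (\<lambda>\<phi>. ct * dirac_delta \<phi>) X Y" "decay_function g" "ct > 0"
  shows "white_channel M ct X Y g"
  using assms
  unfolding white_channel_def gaussian_pair_def gaussian_pair_axioms_def white_channel_axioms_def
    gen_rayleigh_channel_def gen_stationary_gaussian_def iid_processes_def
  by (auto simp: Let_def)

lemma double_integral_dirac:
  "double_integral (\<lambda>\<phi>. ct * dirac_delta \<phi>) F = ct * integral UNIV (\<lambda>\<tau>. F \<tau> \<tau>)"
  by (simp add: double_integral_def dirac_delta_def)

lemma test_functionsI:
  assumes g: "decay_function g" and c: "continuous_on UNIV c" "\<And>x. \<bar>c x\<bar> \<le> 1"
  shows "(\<lambda>\<tau>. c \<tau> * g \<tau>) \<in> test_functions"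
proof -
  have "\<exists>I. has_riemann_integral (\<lambda>\<tau>. c \<tau> * g \<tau>) I a b" for a b
    using g riemann_integrable_mult_continuous[OF _ continuous_on_subset[OF c(1)], of g _ a b]
    unfolding decay_function_def has_improper_riemann_integral_def by (auto simp: mult.commute)
  moreover obtain I where "has_improper_riemann_integral (\<lambda>\<tau>. (g \<tau>)\<^sup>2) I"
    using g by (auto simp: decay_function_def)
  \<comment> \<open>The square of g is the nonnegative weight here; g itself may change
    sign.\<close>
  then have "\<exists>I. has_improper_riemann_integral (\<lambda>\<tau>. (g \<tau>)\<^sup>2 * (c \<tau>)\<^sup>2) I"
    using c by (intro improper_riemann_integrable_mult_continuous[where B = 1])
      (auto intro!: continuous_intros simp: power_le_one_iff abs_square_le_1)
  ultimately show ?thesis by (simp add: test_functions_def power_mult_distrib mult.commute)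
qed

context white_channel begin

definition cs :: "real \<Rightarrow> real \<Rightarrow> real" where "cs f = (\<lambda>\<tau>. cos (2 * pi * f * \<tau>) * g \<tau>)"
definition sn :: "real \<Rightarrow> real \<Rightarrow> real" where "sn f = (\<lambda>\<tau>. sin (2 * pi * f * \<tau>) * g \<tau>)"

lemma cs_sn_test_functions: "cs f \<in> test_functions" "sn f \<in> test_functions"
  unfolding cs_def sn_def by (intro test_functionsI[OF g] continuous_intros; simp)+

lemma g_square_mult_integrable:
  assumes "continuous_on UNIV c" "\<And>x. \<bar>c x\<bar> \<le> B"
  shows "(\<lambda>\<tau>. (g \<tau>)\<^sup>2 * c \<tau>) integrable_on UNIV"
proof -
  obtain I where "has_improper_riemann_integral (\<lambda>\<tau>. (g \<tau>)\<^sup>2) I"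
    using g by (auto simp: decay_function_def)
  from improper_riemann_integrable_mult_continuous[OF this _ assms] show ?thesis
    using has_improper_riemann_integral_imp_has_integral by (auto simp: integrable_on_def)
qed

abbreviation "H \<equiv> gen_fourier_transform X Y g"

lemma H_eq: "H f \<omega> = Complex (X (cs f) \<omega> + Y (sn f) \<omega>) (Y (cs f) \<omega> - X (sn f) \<omega>)"
  by (simp add: gen_fourier_transform_def Let_def cs_def sn_def)

lemma circular_gaussian_H: "circular_gaussian M (H f)"
  and H_second_moment: "(\<integral>\<omega>. (cmod (H f \<omega>))\<^sup>2 \<partial>M) = 2 * ct * integral UNIV (\<lambda>\<tau>. (g \<tau>)\<^sup>2)"
proof -
  \<comment> \<open>The coefficients are 1 for the cosine and \<open>- \<i>\<close> for the sine
    function. Their coefficient matrix in the second moment is the identity, so only the diagonal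
    terms remain.\<close>
  define t where "t i = (if i = (0::nat) then cs f else sn f)" for i
  define \<alpha> \<beta> :: "nat \<Rightarrow> real" where "\<alpha> i = of_bool (i = 0)" and "\<beta> i = of_bool (i = 1)" for i
  have A: "finite {0, 1 :: nat}" "t ` {0, 1} \<subseteq> test_functions"
    using cs_sn_test_functions by (auto simp: t_def)
  have Z: "Complex (\<Sum>i\<in>{0, 1}. \<alpha> i * X (t i) \<omega> + \<beta> i * Y (t i) \<omega>)
      (\<Sum>i\<in>{0, 1}. \<alpha> i * Y (t i) \<omega> - \<beta> i * X (t i) \<omega>) = H f \<omega>" for \<omega>
    by (simp add: H_eq t_def \<alpha>_def \<beta>_def)
  note circ = circular_gaussian_sum[OF A, of \<alpha> \<beta>, unfolded Z]
  show "circular_gaussian M (H f)" by (rule circ(1))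
  have "(\<integral>\<omega>. (cmod (H f \<omega>))\<^sup>2 \<partial>M) =
      2 * (ct * integral UNIV (\<lambda>\<tau>. cs f \<tau> * cs f \<tau>) + ct * integral UNIV (\<lambda>\<tau>. sn f \<tau> * sn f \<tau>))"
    unfolding circ(2) double_integral_dirac by (simp add: t_def \<alpha>_def \<beta>_def)
  also have "\<dots> = 2 * ct * (integral UNIV (\<lambda>\<tau>. cs f \<tau> * cs f \<tau>) + integral UNIV (\<lambda>\<tau>. sn f \<tau> * sn f \<tau>))"
    by (simp add: distrib_left)
  also have "integral UNIV (\<lambda>\<tau>. cs f \<tau> * cs f \<tau>) + integral UNIV (\<lambda>\<tau>. sn f \<tau> * sn f \<tau>) =
      integral UNIV (\<lambda>\<tau>. cs f \<tau> * cs f \<tau> + sn f \<tau> * sn f \<tau>)"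
  proof (rule integral_add[symmetric])
    have "(\<lambda>\<tau>. (g \<tau>)\<^sup>2 * (cos (2 * pi * f * \<tau>))\<^sup>2) integrable_on UNIV"
      "(\<lambda>\<tau>. (g \<tau>)\<^sup>2 * (sin (2 * pi * f * \<tau>))\<^sup>2) integrable_on UNIV"
      by (rule g_square_mult_integrable[where B = 1];
          auto intro!: continuous_intros simp: abs_square_le_1)+
    then show "(\<lambda>\<tau>. cs f \<tau> * cs f \<tau>) integrable_on UNIV" "(\<lambda>\<tau>. sn f \<tau> * sn f \<tau>) integrable_on UNIV"
      by (simp_all add: cs_def sn_def power2_eq_square mult_ac)
  qed
  \<comment> \<open>Here the frequency drops out: the spectrum is flat.\<close>
  also have "(\<lambda>\<tau>. cs f \<tau> * cs f \<tau> + sn f \<tau> * sn f \<tau>) = (\<lambda>\<tau>. (g \<tau>)\<^sup>2)"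
  proof
    fix \<tau>
    have "cs f \<tau> * cs f \<tau> + sn f \<tau> * sn f \<tau> = ((cos (2 * pi * f * \<tau>))\<^sup>2 + (sin (2 * pi * f * \<tau>))\<^sup>2) * (g \<tau>)\<^sup>2"
      unfolding cs_def sn_def by (simp only: power2_eq_square algebra_simps)
    then show "cs f \<tau> * cs f \<tau> + sn f \<tau> * sn f \<tau> = (g \<tau>)\<^sup>2" by simp
  qed
  finally show "(\<integral>\<omega>. (cmod (H f \<omega>))\<^sup>2 \<partial>M) = 2 * ct * integral UNIV (\<lambda>\<tau>. (g \<tau>)\<^sup>2)" .
qed

text \<open>The weight is the squared modulus of the difference of two phases. A generalized process
  is not linear in its test function by definition, so the difference is treated as a combination of
  four variables with coefficients 1, \<open>- \<i>\<close>, -1, \<open>\<i>\<close>.\<close>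

lemma H_diff_second_moment:
  "(\<integral>\<omega>. (cmod (H f \<omega> - H f' \<omega>))\<^sup>2 \<partial>M) =
     2 * ct * integral UNIV (\<lambda>\<tau>. (g \<tau>)\<^sup>2 * (2 - 2 * cos (2 * pi * (f - f') * \<tau>)))"
proof -
  define t where "t = (!) [cs f, sn f, cs f', sn f']"
  define \<alpha> where "\<alpha> = (!) [1, 0, - 1, 0 :: real]"
  define \<beta> where "\<beta> = (!) [0, 1, 0, - 1 :: real]"
  define A where "A = {..<4 :: nat}"
  note expand = A_def t_def \<alpha>_def \<beta>_def numeral_eq_Suc lessThan_Suc
  have A: "finite A" "t ` A \<subseteq> test_functions"
    using cs_sn_test_functions by (auto simp: expand)
  have Z: "Complex (\<Sum>i\<in>A. \<alpha> i * X (t i) \<omega> + \<beta> i * Y (t i) \<omega>)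
      (\<Sum>i\<in>A. \<alpha> i * Y (t i) \<omega> - \<beta> i * X (t i) \<omega>) = H f \<omega> - H f' \<omega>" for \<omega>
    by (simp add: H_eq expand complex_eq_iff)
  define J where "J \<phi> \<psi> = integral UNIV (\<lambda>\<tau> :: real. \<phi> \<tau> * \<psi> \<tau> :: real)" for \<phi> \<psi>
  have int: "(\<lambda>\<tau>. p \<tau> * q \<tau>) integrable_on UNIV"
    if "p \<in> {cs f, sn f, cs f', sn f'}" "q \<in> {cs f, sn f, cs f', sn f'}" for p q
  proof -
    \<comment> \<open>All four test functions are g times a continuous factor bounded by 1, so every
      product is the square of g times such a factor.\<close>
    define K where "K = {c :: real \<Rightarrow> real. continuous_on UNIV c \<and> (\<forall>x. \<bar>c x\<bar> \<le> 1)}"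
    have "(\<lambda>\<tau>. cos (2 * pi * k * \<tau>)) \<in> K" "(\<lambda>\<tau>. sin (2 * pi * k * \<tau>)) \<in> K" for k
      by (auto simp: K_def intro!: continuous_intros)
    then have "\<exists>c\<in>K. cs k = (\<lambda>\<tau>. c \<tau> * g \<tau>)" "\<exists>c\<in>K. sn k = (\<lambda>\<tau>. c \<tau> * g \<tau>)" for k
      unfolding cs_def sn_def by (metis (no_types))+
    then have "\<exists>c\<in>K. r = (\<lambda>\<tau>. c \<tau> * g \<tau>)" if "r \<in> {cs f, sn f, cs f', sn f'}" for r
      using that by auto
    from this[OF that(1)] this[OF that(2)] obtain c d where cd: "continuous_on UNIV c" "\<And>x. \<bar>c x\<bar> \<le> 1" "p = (\<lambda>\<tau>. c \<tau> * g \<tau>)"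
      "continuous_on UNIV d" "\<And>x. \<bar>d x\<bar> \<le> 1" "q = (\<lambda>\<tau>. d \<tau> * g \<tau>)"
      unfolding K_def by blast
    have "\<bar>c x * d x\<bar> \<le> 1" for x
      unfolding abs_mult by (rule mult_le_one) (use cd in auto)
    with cd(1,4) have "(\<lambda>\<tau>. (g \<tau>)\<^sup>2 * (c \<tau> * d \<tau>)) integrable_on UNIV"
      by (intro g_square_mult_integrable continuous_intros)
    then show ?thesis unfolding cd by (simp add: power2_eq_square mult_ac)
  qed
  have "(\<integral>\<omega>. (cmod (H f \<omega> - H f' \<omega>))\<^sup>2 \<partial>M) =
      2 * (\<Sum>i\<in>A. \<Sum>j\<in>A. (\<alpha> i * \<alpha> j + \<beta> i * \<beta> j) * (ct * J (t i) (t j)))"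
    unfolding circular_gaussian_sum(2)[OF A, of \<alpha> \<beta>, unfolded Z] double_integral_dirac J_def ..
  also have "\<dots> = 2 * ct *
      (J (cs f) (cs f) - J (cs f) (cs f') - J (cs f') (cs f) + J (cs f') (cs f') +
      (J (sn f) (sn f) - J (sn f) (sn f') - J (sn f') (sn f) + J (sn f') (sn f')))"
    by (simp add: expand algebra_simps)
  also have "\<dots> = 2 * ct * integral UNIV (\<lambda>\<tau>.
      cs f \<tau> * cs f \<tau> - cs f \<tau> * cs f' \<tau> - cs f' \<tau> * cs f \<tau> + cs f' \<tau> * cs f' \<tau> +
      (sn f \<tau> * sn f \<tau> - sn f \<tau> * sn f' \<tau> - sn f' \<tau> * sn f \<tau> + sn f' \<tau> * sn f' \<tau>))"
    unfolding J_def
    by (simp only: integral_add integral_diff integrable_add integrable_diff int insert_iff simp_thms)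
  also have "(\<lambda>\<tau>. cs f \<tau> * cs f \<tau> - cs f \<tau> * cs f' \<tau> - cs f' \<tau> * cs f \<tau> + cs f' \<tau> * cs f' \<tau> +
      (sn f \<tau> * sn f \<tau> - sn f \<tau> * sn f' \<tau> - sn f' \<tau> * sn f \<tau> + sn f' \<tau> * sn f' \<tau>)) =
      (\<lambda>\<tau>. (g \<tau>)\<^sup>2 * (2 - 2 * cos (2 * pi * (f - f') * \<tau>)))"
  proof
    fix \<tau>
    define c s c' s' where "c = cos (2 * pi * f * \<tau>)" and "s = sin (2 * pi * f * \<tau>)"
      and "c' = cos (2 * pi * f' * \<tau>)" and "s' = sin (2 * pi * f' * \<tau>)"
    have "2 * pi * (f - f') * \<tau> = 2 * pi * f * \<tau> - 2 * pi * f' * \<tau>" by (simp add: algebra_simps)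
    then have cd: "cos (2 * pi * (f - f') * \<tau>) = c * c' + s * s'"
      by (simp only: cos_diff c_def s_def c'_def s'_def)
    have "c\<^sup>2 + s\<^sup>2 = 1" "c'\<^sup>2 + s'\<^sup>2 = 1" by (simp_all add: c_def s_def c'_def s'_def)
    then have "c * c - c * c' - c' * c + c' * c' + (s * s - s * s' - s' * s + s' * s') = 2 - 2 * (c * c' + s * s')"
      unfolding power2_eq_square by (simp add: mult.commute)
    then have "(g \<tau> * g \<tau>) * (c * c - c * c' - c' * c + c' * c' + (s * s - s * s' - s' * s + s' * s')) =
        (g \<tau> * g \<tau>) * (2 - 2 * (c * c' + s * s'))"
      by simp
    then show "cs f \<tau> * cs f \<tau> - cs f \<tau> * cs f' \<tau> - cs f' \<tau> * cs f \<tau> + cs f' \<tau> * cs f' \<tau> +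
      (sn f \<tau> * sn f \<tau> - sn f \<tau> * sn f' \<tau> - sn f' \<tau> * sn f \<tau> + sn f' \<tau> * sn f' \<tau>) =
      (g \<tau>)\<^sup>2 * (2 - 2 * cos (2 * pi * (f - f') * \<tau>))"
      unfolding cd cs_def sn_def c_def[symmetric] s_def[symmetric] c'_def[symmetric] s'_def[symmetric]
        power2_eq_square
      by (simp add: algebra_simps)
  qed
  finally show ?thesis .
qed

text \<open>The second moment does not depend on f, so the frequency integral only contributes the
  length W. Existence of some capacity together with its forced value gives the equivalence.\<close>

lemma ergodic_capacity_white:
  assumes \<alpha>: "\<alpha> > 0" and W: "W > 0"
  defines "c \<equiv> 2 * ct * integral UNIV (\<lambda>\<tau>. (g \<tau>)\<^sup>2)"
  shows "has_ergodic_capacity M W \<alpha> H C \<longleftrightarrow>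
    C = W / ln 2 * exp (1 / (c * \<alpha>)) * Ei_gen 1 (1 / (c * \<alpha>))"
proof -
  have unique: "C = W / ln 2 * exp (1 / (c * \<alpha>)) * Ei_gen 1 (1 / (c * \<alpha>))"
    if "has_ergodic_capacity M W \<alpha> H C" for C
    using ergodic_capacity_circular_gaussian[OF circular_gaussian_H \<alpha> that] W
    unfolding H_second_moment c_def[symmetric] by (simp add: mult.commute)
  obtain I where I: "has_improper_riemann_integral (\<lambda>\<tau>. (g \<tau>)\<^sup>2) I"
    using g by (auto simp: decay_function_def)
  have "\<exists>C. has_ergodic_capacity M W \<alpha> H C"
  proof (rule ergodic_capacity_exists[OF _ _ \<alpha>])
    show "L2_rv M (H f)" for f using circular_gaussian_H by (simp add: circular_gaussian_def)
    show "(\<integral>\<omega>. (cmod (H f \<omega>))\<^sup>2 \<partial>M) \<le> c" for f by (simp add: H_second_moment c_def)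
    fix e :: real assume e: "e > 0"
    define \<rho> where "\<rho> x = 2 - 2 * cos x" for x :: real
    have \<rho>: "continuous_on UNIV \<rho>" "\<rho> 0 = 0"
      by (auto simp: \<rho>_def intro!: continuous_intros)
    have \<rho>4: "\<bar>\<rho> x\<bar> \<le> 4" for x
      using cos_ge_minus_one[of x] cos_le_one[of x] unfolding \<rho>_def by linarith
    \<comment> \<open>The bound compensates the factor \<open>2 * ct\<close> of the second
      moment.\<close>
    obtain d where d: "d > 0" "\<And>h. \<bar>h\<bar> < d \<Longrightarrow> integral UNIV (\<lambda>\<tau>. (g \<tau>)\<^sup>2 * \<rho> (h * \<tau>)) < e / (2 * ct)"
      using integral_oscillating_tendsto_0[OF I _ \<rho> \<rho>4, of "e / (2 * ct)"] e ct by auto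
    have "(\<integral>\<omega>. (cmod (H f \<omega> - H f' \<omega>))\<^sup>2 \<partial>M) < e" if "\<bar>f - f'\<bar> < d / (2 * pi)" for f f'
    proof -
      have "integral UNIV (\<lambda>\<tau>. (g \<tau>)\<^sup>2 * \<rho> (2 * pi * (f - f') * \<tau>)) < e / (2 * ct)"
        proof (rule d(2))
        have "\<bar>2 * pi * (f - f')\<bar> = 2 * pi * \<bar>f - f'\<bar>" by (simp add: abs_mult)
        also have "\<dots> < d" using that by (simp add: pos_less_divide_eq mult.commute)
        finally show "\<bar>2 * pi * (f - f')\<bar> < d" .
      qed
      then show ?thesis
        unfolding H_diff_second_moment \<rho>_def using ct by (simp add: field_simps)
    qed
    then show "\<exists>d>0. \<forall>f f'. \<bar>f - f'\<bar> < d \<longrightarrow> (\<integral>\<omega>. (cmod (H f \<omega> - H f' \<omega>))\<^sup>2 \<partial>M) < e"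
      using d(1) by (intro exI[of _ "d / (2 * pi)"]) auto
  qed
  with unique show ?thesis by metis
qed

end

text \<open>Mean-square integrals are relations that may have no solution, so the first part speaks
  of any transform and capacity that exist, and the second supplies them when g is absolutely
  integrable. In the Dirac case existence holds throughout, hence an equivalence. The last part,
  with channels on possibly different probability spaces, expresses that only c influences the
  capacity.\<close>

theorem theorem1:
  fixes M :: "'a measure" and M' :: "'b measure"
    and W \<alpha> :: real and g :: "real \<Rightarrow> real"
  assumes "prob_space M" and "W > 0" and "\<alpha> > 0" and "decay_function g"
  shows
    "(\<forall>Rt Xt Yt Hhat C.
        rayleigh_channel M Rt Xt Yt \<longrightarrow>
        is_fourier_transform M (impulse_response Xt Yt g) Hhat \<longrightarrow>
        has_ergodic_capacity M W \<alpha> Hhat C \<longrightarrow>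
        C = 1 / ln 2 * integral {- W / 2..W / 2} (\<lambda>f.
              exp (1 / (2 * \<alpha> * sigma2_hat Rt g f)) *
              Ei_gen 1 (1 / (2 * \<alpha> * sigma2_hat Rt g f))))
   \<and> (\<forall>Rt Xt Yt.
        rayleigh_channel M Rt Xt Yt \<longrightarrow>
        (\<exists>I. has_improper_riemann_integral (\<lambda>\<tau>. \<bar>g \<tau>\<bar>) I) \<longrightarrow>
        (\<exists>Hhat. is_fourier_transform M (impulse_response Xt Yt g) Hhat) \<and>
        (\<forall>Hhat. is_fourier_transform M (impulse_response Xt Yt g) Hhat \<longrightarrow>
           (\<exists>C. has_ergodic_capacity M W \<alpha> Hhat C)))
   \<and> (\<forall>ct > 0. \<forall>Xt Yt.
        gen_rayleigh_channel M (\<lambda>\<phi>. ct * dirac_delta \<phi>) Xt Yt \<longrightarrow>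
        (let c = 2 * ct * integral UNIV (\<lambda>\<tau>. (g \<tau>)\<^sup>2);
             Hhat = gen_fourier_transform Xt Yt g
         in (\<forall>f. 2 * sigma2_hat_dist (\<lambda>\<phi>. ct * dirac_delta \<phi>) g f = c) \<and>
            (\<forall>C. has_ergodic_capacity M W \<alpha> Hhat C \<longleftrightarrow>
                 C = W / ln 2 * exp (1 / (c * \<alpha>)) * Ei_gen 1 (1 / (c * \<alpha>)))))
   \<and> (\<forall>ct > 0. \<forall>Xt Yt C. \<forall>ct' > 0. \<forall>Xt' Yt' C' g'.
        gen_rayleigh_channel M (\<lambda>\<phi>. ct * dirac_delta \<phi>) Xt Yt \<longrightarrow>
        has_ergodic_capacity M W \<alpha> (gen_fourier_transform Xt Yt g) C \<longrightarrow>
        prob_space M' \<longrightarrow> decay_function g' \<longrightarrow>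
        gen_rayleigh_channel M' (\<lambda>\<phi>. ct' * dirac_delta \<phi>) Xt' Yt' \<longrightarrow>
        has_ergodic_capacity M' W \<alpha> (gen_fourier_transform Xt' Yt' g') C' \<longrightarrow>
        2 * ct * integral UNIV (\<lambda>\<tau>. (g \<tau>)\<^sup>2) = 2 * ct' * integral UNIV (\<lambda>\<tau>. (g' \<tau>)\<^sup>2) \<longrightarrow>
        C = C')"
proof (intro conjI allI impI)
  fix Rt Xt Yt Hhat C
  assume ch: "rayleigh_channel M Rt Xt Yt"
    and F: "is_fourier_transform M (impulse_response Xt Yt g) Hhat"
    and C: "has_ergodic_capacity M W \<alpha> Hhat C"
  interpret fading_channel M Rt Xt Yt g
    using assms ch by (intro rayleigh_channel_fading_channel)
  have F': "ms_has_improper_riemann_integral M (\<lambda>\<tau> \<omega>. g \<tau> *\<^sub>R U f \<tau> \<omega>) (Hhat f)" for f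
    using F by (simp add: is_fourier_transform_eq)
  \<comment> \<open>The 2 arises because real and imaginary part each contribute
    \<open>sigma2_hat\<close> to the second moment.\<close>
  have "2 * \<alpha> * sigma2_hat Rt g f = \<alpha> * (\<integral>\<omega>. (cmod (Hhat f \<omega>))\<^sup>2 \<partial>M)" for f
    using sigma2_hat_eq[OF F', of f] by simp
  then show "C = 1 / ln 2 * integral {- W / 2..W / 2} (\<lambda>f.
              exp (1 / (2 * \<alpha> * sigma2_hat Rt g f)) *
              Ei_gen 1 (1 / (2 * \<alpha> * sigma2_hat Rt g f)))"
    using ergodic_capacity_circular_gaussian[OF circular_gaussian_improper_integral[OF F'] assms(3) C]
    by (simp only:)
next
  fix Rt Xt Yt
  assume ch: "rayleigh_channel M Rt Xt Yt"
    and "\<exists>I. has_improper_riemann_integral (\<lambda>\<tau>. \<bar>g \<tau>\<bar>) I"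
  then obtain I where I: "has_improper_riemann_integral (\<lambda>\<tau>. \<bar>g \<tau>\<bar>) I" by blast
  interpret fading_channel M Rt Xt Yt g
    using assms ch by (intro rayleigh_channel_fading_channel)
  show "\<exists>Hhat. is_fourier_transform M (impulse_response Xt Yt g) Hhat"
    unfolding is_fourier_transform_eq using ms_improper_integrable[OF I] by (intro choice allI)
  show "\<exists>C. has_ergodic_capacity M W \<alpha> Hhat C"
    if "is_fourier_transform M (impulse_response Xt Yt g) Hhat" for Hhat
    using that ergodic_capacity_fading_exists[OF I _ assms(3)] by (simp add: is_fourier_transform_eq)
next
  fix ct :: real and Xt Yt
  assume ct: "ct > 0" and ch: "gen_rayleigh_channel M (\<lambda>\<phi>. ct * dirac_delta \<phi>) Xt Yt"
  interpret white_channel M ct Xt Yt g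
    using assms ch ct by (intro gen_rayleigh_channel_white_channel)
  \<comment> \<open>Sifting sets both times equal, where the cosine is 1.\<close>
  have "2 * sigma2_hat_dist (\<lambda>\<phi>. ct * dirac_delta \<phi>) g f = 2 * ct * integral UNIV (\<lambda>\<tau>. (g \<tau>)\<^sup>2)" for f
    by (simp add: sigma2_hat_dist_def double_integral_dirac power2_eq_square)
  then show "let c = 2 * ct * integral UNIV (\<lambda>\<tau>. (g \<tau>)\<^sup>2);
             Hhat = gen_fourier_transform Xt Yt g
         in (\<forall>f. 2 * sigma2_hat_dist (\<lambda>\<phi>. ct * dirac_delta \<phi>) g f = c) \<and>
            (\<forall>C. has_ergodic_capacity M W \<alpha> Hhat C \<longleftrightarrow>
                 C = W / ln 2 * exp (1 / (c * \<alpha>)) * Ei_gen 1 (1 / (c * \<alpha>)))"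
    unfolding Let_def using ergodic_capacity_white[OF assms(3,2)] by blast
next
  fix ct :: real and Xt Yt C and ct' :: real and Xt' Yt' C' g'
  assume "ct > 0" "ct' > 0" "gen_rayleigh_channel M (\<lambda>\<phi>. ct * dirac_delta \<phi>) Xt Yt"
    and C: "has_ergodic_capacity M W \<alpha> (gen_fourier_transform Xt Yt g) C"
    and "prob_space M'" "decay_function g'" "gen_rayleigh_channel M' (\<lambda>\<phi>. ct' * dirac_delta \<phi>) Xt' Yt'"
    and C': "has_ergodic_capacity M' W \<alpha> (gen_fourier_transform Xt' Yt' g') C'"
    and eq: "2 * ct * integral UNIV (\<lambda>\<tau>. (g \<tau>)\<^sup>2) = 2 * ct' * integral UNIV (\<lambda>\<tau>. (g' \<tau>)\<^sup>2)"
  then interpret A: white_channel M ct Xt Yt g + B: white_channel M' ct' Xt' Yt' g'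
    using assms by (auto intro: gen_rayleigh_channel_white_channel)
  show "C = C'"
    \<comment> \<open>Both capacities are the same expression in c, W and \<alpha>.\<close>
    using C C' unfolding A.ergodic_capacity_white[OF assms(3,2)] B.ergodic_capacity_white[OF assms(3,2)] eq
    by simp
qed

end
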